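(* Let $\mathscr{H}$ be a complex Hilbert space with a fixed orthonormal basis, let $\mathscr{A}\subseteq \mathbb{B}(\mathscr{H})$ be a $C^*$-algebra, and let $T$ be a compact Hausdorff space equipped with a Radon measure $\mu$, where $T$ is also a totally ordered set. Let $(A_t)_{t\in T}, (B_t)_{t\in T}, (C_t)_{t\in T}, (D_t)_{t\in T}$ be increasing fields of positive operators in $\mathcal{C}(T,\mathscr{A})$, let $\alpha: T\to [0,+\infty)$ be a measurable function, and let $\sigma$ be an operator mean whose representing function is super-multiplicative. Assume that all the integrals below exist. Then $$\int_{T} \alpha(s)\, d\mu(s)\int_{T}\alpha(t)\big((A_t\circ B_t)\,\sigma\,(C_t\circ D_t)\big)\, d\mu(t)\;\geq\;\left(\int_{T}\alpha(t) (A_t\sigma C_t)\, d\mu(t)\right)\circ\left(\int_{T}\alpha(s) (B_s\sigma D_s)\, d\mu(s)\right).$$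
   Context: $X\ge 0$ means $\langle Xx,x\rangle\ge0$ for all $x$; for self-adjoint $X,Y$, $X\ge Y$ means $X-Y\ge 0$. $\mathcal{C}(T,\mathscr{A})$ is the set of norm-continuous functions $T\to\mathscr{A}$. With $\preceq$ the total order on $T$, a field $(A_t)$ is increasing if $t\preceq s$ implies $A_t\le A_s$. Given the fixed orthonormal basis $\{e_j\}$, the Hadamard product is defined by $\langle (A\circ B)e_i,e_j\rangle=\langle Ae_i,e_j\rangle\langle Be_i,e_j\rangle$. Integrals of operator-valued functions are Bochner integrals. An operator mean (Kubo–Ando) is a binary operation $\sigma$ on strictly positive (positive invertible) operators such that: (i) $A\le C$, $B\le D$ imply $A\sigma B\le C\sigma D$; (ii) $A_n\downarrow A$, $B_n\downarrow B$ imply $A_n\sigma B_n\downarrow A\sigma B$ (decreasing sequences, strong operator convergence); (iii) $S^*(A\sigma B)S\le (S^*AS)\sigma(S^*BS)$ for all $S\in\mathbb{B}(\mathscr{H})$; (iv) $I\sigma I=I$. Its representing function is the positive operator monotone function $f$ on $(0,\infty)$, $f(1)=1$, with $f(t)I=I\sigma(tI)$; one has $A\sigma B=A^{1/2}f(A^{-1/2}BA^{-1/2})A^{1/2}$ for strictly positive $A,B$. For positive $A,B$, $A\sigma B$ is the strong-operator limit of $(A+\varepsilon I)\sigma(B+\varepsilon I)$ as $\varepsilon\downarrow0$. A function $f$ is super-multiplicative if $f(xy)\ge f(x)f(y)$ for all $x,y$ in its domain. *)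

theory Defs
  imports "HOL-Analysis.Analysis" "Jordan_Normal_Form.Schur_Decomposition"
begin

section \<open>Complex Hilbert spaces and bounded operators\<close>

text \<open>
  The inner product is linear in its first argument. The axiom \<open>cinner_self\<close> makes it
  positive definite and identifies the norm of the Banach space with the Hilbert space norm.
\<close>

class chilbert_space = banach +
  fixes scaleC :: "complex \<Rightarrow> 'a \<Rightarrow> 'a"  (infixr \<open>*\<^sub>C\<close> 75)
    and cinner :: "'a \<Rightarrow> 'a \<Rightarrow> complex"
  assumes scaleC_add_right: "c *\<^sub>C (x + y) = c *\<^sub>C x + c *\<^sub>C y"
    and scaleC_add_left: "(c + d) *\<^sub>C x = c *\<^sub>C x + d *\<^sub>C x"
    and scaleC_scaleC: "c *\<^sub>C d *\<^sub>C x = (c * d) *\<^sub>C x"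
    and scaleC_of_real: "complex_of_real r *\<^sub>C x = r *\<^sub>R x"
    and cinner_add_left: "cinner (x + y) z = cinner x z + cinner y z"
    and cinner_scaleC_left: "cinner (c *\<^sub>C x) y = c * cinner x y"
    and cinner_commute: "cinner x y = cnj (cinner y x)"
    and cinner_self: "cinner x x = complex_of_real ((norm x)\<^sup>2)"

definition orthonormal_basis :: "'h::chilbert_space set \<Rightarrow> bool" where
  "orthonormal_basis E \<longleftrightarrow>
     (\<forall>u\<in>E. \<forall>v\<in>E. cinner u v = (if u = v then 1 else 0)) \<and>
     closure {\<Sum>u\<in>F. c u *\<^sub>C u | F c. finite F \<and> F \<subseteq> E} = UNIV"

text \<open>
  The type \<open>'h \<Rightarrow>\<^sub>L 'h\<close> consists of the bounded real-linear maps; the operators are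
  the complex-linear ones among them, with the operator norm.
\<close>

definition bounded_ops :: "('h::chilbert_space \<Rightarrow>\<^sub>L 'h) set" where
  "bounded_ops = {X. \<forall>c x. blinfun_apply X (c *\<^sub>C x) = c *\<^sub>C blinfun_apply X x}"

definition op_adjoint :: "('h::chilbert_space \<Rightarrow>\<^sub>L 'h) \<Rightarrow> ('h \<Rightarrow>\<^sub>L 'h)" where
  "op_adjoint X = (THE Y. Y \<in> bounded_ops \<and>
     (\<forall>x y. cinner (blinfun_apply X x) y = cinner x (blinfun_apply Y y)))"

text \<open>The order on \<^typ>\<open>complex\<close> is that of \<^theory>\<open>HOL-Library.Complex_Order\<close>:
  \<open>0 \<le> z\<close> says that \<open>z\<close> is real and nonnegative.\<close>

definition op_pos :: "('h::chilbert_space \<Rightarrow>\<^sub>L 'h) \<Rightarrow> bool" where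
  "op_pos X \<longleftrightarrow> X \<in> bounded_ops \<and> (\<forall>x. 0 \<le> cinner (blinfun_apply X x) x)"

definition op_le :: "('h::chilbert_space \<Rightarrow>\<^sub>L 'h) \<Rightarrow> ('h \<Rightarrow>\<^sub>L 'h) \<Rightarrow> bool"  (infix \<open>\<le>\<^sub>o\<^sub>p\<close> 50) where
  "X \<le>\<^sub>o\<^sub>p Y \<longleftrightarrow> op_pos (Y - X)"

definition op_strictly_pos :: "('h::chilbert_space \<Rightarrow>\<^sub>L 'h) \<Rightarrow> bool" where
  "op_strictly_pos X \<longleftrightarrow> op_pos X \<and>
     (\<exists>Y\<in>bounded_ops. X o\<^sub>L Y = id_blinfun \<and> Y o\<^sub>L X = id_blinfun)"

definition cstar_subalgebra :: "('h::chilbert_space \<Rightarrow>\<^sub>L 'h) set \<Rightarrow> bool" where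
  "cstar_subalgebra \<A> \<longleftrightarrow>
     \<A> \<subseteq> bounded_ops \<and> closed \<A> \<and> 0 \<in> \<A> \<and>
     (\<forall>X\<in>\<A>. \<forall>Y\<in>\<A>. X + Y \<in> \<A> \<and> X o\<^sub>L Y \<in> \<A>) \<and>
     (\<forall>c. \<forall>X\<in>\<A>. Blinfun (\<lambda>x. c *\<^sub>C blinfun_apply X x) \<in> \<A>) \<and>
     (\<forall>X\<in>\<A>. op_adjoint X \<in> \<A>)"

definition hadamard ::
  "'h::chilbert_space set \<Rightarrow> ('h \<Rightarrow>\<^sub>L 'h) \<Rightarrow> ('h \<Rightarrow>\<^sub>L 'h) \<Rightarrow> ('h \<Rightarrow>\<^sub>L 'h)" where
  "hadamard E X Y = (THE Z. Z \<in> bounded_ops \<and>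
     (\<forall>u\<in>E. \<forall>v\<in>E. cinner (blinfun_apply Z u) v =
        cinner (blinfun_apply X u) v * cinner (blinfun_apply Y u) v))"

definition strong_limit :: "('i \<Rightarrow> ('h::chilbert_space \<Rightarrow>\<^sub>L 'h)) \<Rightarrow> ('h \<Rightarrow>\<^sub>L 'h) \<Rightarrow> 'i filter \<Rightarrow> bool" where
  "strong_limit X L F \<longleftrightarrow>
     (\<forall>x. ((\<lambda>i. blinfun_apply (X i) x) \<longlongrightarrow> blinfun_apply L x) F)"

definition op_decreasing_to :: "(nat \<Rightarrow> ('h::chilbert_space \<Rightarrow>\<^sub>L 'h)) \<Rightarrow> ('h \<Rightarrow>\<^sub>L 'h) \<Rightarrow> bool"
    (infix \<open>\<down>\<^sub>o\<^sub>p\<close> 50) where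
  "X \<down>\<^sub>o\<^sub>p L \<longleftrightarrow> (\<forall>n. X (Suc n) \<le>\<^sub>o\<^sub>p X n) \<and> strong_limit X L sequentially"


section \<open>Operator means\<close>

type_synonym 'h op_binary = "('h \<Rightarrow>\<^sub>L 'h) \<Rightarrow> ('h \<Rightarrow>\<^sub>L 'h) \<Rightarrow> ('h \<Rightarrow>\<^sub>L 'h)"

text \<open>
  A mean is given by its values on strictly positive operators; \<open>mean_ext \<sigma>\<close> is its extension to
  positive operators. By monotonicity and continuity from above, the two agree on strictly
  positive operators.
\<close>

definition mean_ext :: "'h::chilbert_space op_binary \<Rightarrow> 'h op_binary" where
  "mean_ext \<sigma> A B = (THE L. L \<in> bounded_ops \<and>
     strong_limit (\<lambda>\<epsilon>::real. \<sigma> (A + \<epsilon> *\<^sub>R id_blinfun) (B + \<epsilon> *\<^sub>R id_blinfun)) L (at_right 0))"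

text \<open>
  In the transformer inequality \<open>S\<close> need not be invertible, so that \<open>S\<^sup>* A S\<close> and \<open>S\<^sup>* B S\<close> are
  only positive and their mean has to be taken in the extended sense.
\<close>

definition operator_mean :: "'h::chilbert_space op_binary \<Rightarrow> bool" where
  "operator_mean \<sigma> \<longleftrightarrow>
     (\<forall>A B. op_strictly_pos A \<and> op_strictly_pos B \<longrightarrow> op_strictly_pos (\<sigma> A B)) \<and>
     (\<forall>A B C D. op_strictly_pos A \<and> op_strictly_pos B \<and> op_strictly_pos C \<and> op_strictly_pos D \<and>
        A \<le>\<^sub>o\<^sub>p C \<and> B \<le>\<^sub>o\<^sub>p D \<longrightarrow> \<sigma> A B \<le>\<^sub>o\<^sub>p \<sigma> C D) \<and>
     (\<forall>As Bs A B. (\<forall>n. op_strictly_pos (As n) \<and> op_strictly_pos (Bs n)) \<and>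
        op_strictly_pos A \<and> op_strictly_pos B \<and> As \<down>\<^sub>o\<^sub>p A \<and> Bs \<down>\<^sub>o\<^sub>p B \<longrightarrow>
        (\<lambda>n. \<sigma> (As n) (Bs n)) \<down>\<^sub>o\<^sub>p \<sigma> A B) \<and>
     (\<forall>A B. \<forall>S\<in>bounded_ops. op_strictly_pos A \<and> op_strictly_pos B \<longrightarrow>
        op_adjoint S o\<^sub>L \<sigma> A B o\<^sub>L S
          \<le>\<^sub>o\<^sub>p mean_ext \<sigma> (op_adjoint S o\<^sub>L A o\<^sub>L S) (op_adjoint S o\<^sub>L B o\<^sub>L S)) \<and>
     \<sigma> id_blinfun id_blinfun = id_blinfun"

text \<open>
  A function on the positive half-line is operator monotone if it is matrix monotone of every
  order. \<open>mat_fun n f A X\<close> says that \<open>A\<close> is Hermitian with spectrum in the open positive half-line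
  and that \<open>X = f(A)\<close>, computed from a spectral decomposition of \<open>A\<close>.
\<close>

definition mat_fun :: "nat \<Rightarrow> (real \<Rightarrow> real) \<Rightarrow> complex mat \<Rightarrow> complex mat \<Rightarrow> bool" where
  "mat_fun n f A X \<longleftrightarrow> (\<exists>U\<in>carrier_mat n n. \<exists>d :: nat \<Rightarrow> real.
     U * mat_adjoint U = 1\<^sub>m n \<and> mat_adjoint U * U = 1\<^sub>m n \<and> (\<forall>i<n. 0 < d i) \<and>
     A = U * mat_diag n (\<lambda>i. complex_of_real (d i)) * mat_adjoint U \<and>
     X = U * mat_diag n (\<lambda>i. complex_of_real (f (d i))) * mat_adjoint U)"

definition mat_le :: "nat \<Rightarrow> complex mat \<Rightarrow> complex mat \<Rightarrow> bool" where
  "mat_le n A B \<longleftrightarrow> (\<forall>v\<in>carrier_vec n. 0 \<le> ((B - A) *\<^sub>v v) \<bullet>c v)"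

definition operator_monotone :: "(real \<Rightarrow> real) \<Rightarrow> bool" where
  "operator_monotone f \<longleftrightarrow>
     (\<forall>n A B X Y. mat_fun n f A X \<and> mat_fun n f B Y \<and> mat_le n A B \<longrightarrow> mat_le n X Y)"

text \<open>
  If the Hilbert space is infinite-dimensional, operator monotonicity of \<open>f\<close> follows from the
  last conjunct and the axioms of a mean. In finite dimension it does not, and it expresses that
  \<open>\<sigma>\<close> comes from a mean in the sense of Kubo and Ando, whose axioms refer to an
  infinite-dimensional space.
\<close>

definition representing_function :: "'h::chilbert_space op_binary \<Rightarrow> (real \<Rightarrow> real) \<Rightarrow> bool" where
  "representing_function \<sigma> f \<longleftrightarrow>
     operator_monotone f \<and> (\<forall>t>0. 0 < f t) \<and> f 1 = 1 \<and>
     (\<forall>t>0. \<sigma> id_blinfun (t *\<^sub>R id_blinfun) = f t *\<^sub>R id_blinfun)"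

definition super_multiplicative :: "(real \<Rightarrow> real) \<Rightarrow> bool" where
  "super_multiplicative f \<longleftrightarrow> (\<forall>x>0. \<forall>y>0. f x * f y \<le> f (x * y))"


section \<open>Radon measures, Bochner integrals and fields of operators\<close>

definition radon_measure :: "'t::t2_space measure \<Rightarrow> bool" where
  "radon_measure \<mu> \<longleftrightarrow> sets \<mu> = sets borel \<and>
     (\<forall>K. compact K \<longrightarrow> emeasure \<mu> K < \<infinity>) \<and>
     (\<forall>S\<in>sets borel. emeasure \<mu> S = (INF U\<in>{U. open U \<and> S \<subseteq> U}. emeasure \<mu> U)) \<and>
     (\<forall>U. open U \<longrightarrow> emeasure \<mu> U = (SUP K\<in>{K. compact K \<and> K \<subseteq> U}. emeasure \<mu> K))"

text \<open>
  The library's \<^const>\<open>has_bochner_integral\<close> needs a second countable codomain, which excludes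
  spaces of operators. Here Borel measurability of the integrand is replaced by strong
  measurability, that is, by almost everywhere convergence of the simple functions.
\<close>

definition has_strong_bochner_integral ::
  "'a measure \<Rightarrow> ('a \<Rightarrow> 'b::real_normed_vector) \<Rightarrow> 'b \<Rightarrow> bool" where
  "has_strong_bochner_integral M f x \<longleftrightarrow> (\<exists>s.
     (\<forall>i::nat. Bochner_Integration.simple_bochner_integrable M (s i)) \<and>
     (AE t in M. (\<lambda>i. s i t) \<longlonglongrightarrow> f t) \<and>
     (\<lambda>i. \<integral>\<^sup>+t. ennreal (norm (f t - s i t)) \<partial>M) \<longlonglongrightarrow> 0 \<and>
     (\<lambda>i. Bochner_Integration.simple_bochner_integral M (s i)) \<longlonglongrightarrow> x)"

definition bochner_integrable :: "'a measure \<Rightarrow> ('a \<Rightarrow> 'b::real_normed_vector) \<Rightarrow> bool" where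
  "bochner_integrable M f \<longleftrightarrow> (\<exists>x. has_strong_bochner_integral M f x)"

definition bochner_integral :: "'a measure \<Rightarrow> ('a \<Rightarrow> 'b::real_normed_vector) \<Rightarrow> 'b" where
  "bochner_integral M f = (THE x. has_strong_bochner_integral M f x)"

text \<open>No compatibility between the order and the topology of the index space is required.\<close>

definition increasing_positive_field ::
  "('h::chilbert_space \<Rightarrow>\<^sub>L 'h) set \<Rightarrow> ('t::{t2_space,linorder} \<Rightarrow> ('h \<Rightarrow>\<^sub>L 'h)) \<Rightarrow> bool" where
  "increasing_positive_field \<A> A \<longleftrightarrow>
     continuous_on UNIV A \<and> range A \<subseteq> \<A> \<and> (\<forall>t. op_pos (A t)) \<and>
     (\<forall>t s. t \<le> s \<longrightarrow> A t \<le>\<^sub>o\<^sub>p A s)"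

end

(*
  Jointly diagonalizing A and C by a congruence on a finite section, A = S* S and C = S* a S, gives
  A \<sigma> C = S* f(a) S there, and likewise B = T* T, D = T* b T. The Hadamard product of the two means is
  then W* (f(a_k) f(b_l)) W, where W is the coordinatewise product of S and T, so that
  A \<circ> B = W* W and C \<circ> D = W* (a_k b_l) W. Super-multiplicativity bounds the middle factor by
  f(a_k b_l), and the Hansen-Jensen inequality for the operator monotone f turns the result into a section of
  (A \<circ> B) \<sigma> (C \<circ> D). No tensor product of Hilbert spaces is needed, and the argument is the same in
  finite dimension. Passing from finite sections to the mean itself only uses the transformer
  inequality and continuity from above. The integral inequality follows from
  (K_t - K_s) \<circ> (L_t - L_s) \<ge> 0 for the increasing fields K = A \<sigma> C and L = B \<sigma> D.
*)
theory Submission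
  imports Defs "Jordan_Normal_Form.Spectral_Radius"
begin

text \<open>Means enter in two opposite directions. The transformer inequality bounds a compressed
  mean from above by the mean of the compressions. This suits \<open>\<sigma> A C\<close> and
  \<open>\<sigma> B D\<close>, but the mean of the Hadamard products has to be bounded from below.
  The lower estimate is therefore proved for all pairs \<open>X'\<close>, \<open>Y'\<close> that
  dominate a compressed pair, and is then carried to the limit along a specially chosen sequence of
  sections. A mean is known through its axioms only, with \<open>f\<close> visible just on scalars,
  so the value of \<open>I \<sigma> L\<close> for diagonal \<open>L\<close> is extracted from the
  transformer inequality with reflections and rank-one projections. The matrix inequality for
  \<open>f\<close> loses an \<epsilon>, which right continuity of \<open>f\<close> recovers, itself
  a trace of continuity from above. Estimates are made on real quadratic forms of finite
  combinations of basis vectors, so the basis may have any cardinality. Matrix entries of the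
  integrands are measurable only up to null sets; they are replaced by measurable representatives,
  finitely many at a time.\<close>

section \<open>Algebra of the inner product and the Cauchy-Schwarz inequality\<close>

lemma scaleC_one [simp]: "1 *\<^sub>C (x::'h::chilbert_space) = x"
  using scaleC_of_real[of 1 x] by simp

lemma scaleC_zero_left [simp]: "0 *\<^sub>C (x::'h::chilbert_space) = 0"
  using scaleC_of_real[of 0 x] by simp

lemma scaleC_zero_right [simp]: "c *\<^sub>C (0::'h::chilbert_space) = 0"
  using scaleC_add_right[of c 0 "0::'h"] by simp

lemma scaleC_minus_left: "(- c) *\<^sub>C x = - (c *\<^sub>C (x::'h::chilbert_space))"
  using scaleC_add_left[of c "-c" x] by (simp add: eq_neg_iff_add_eq_0 add.commute)

lemma scaleC_minus_right: "c *\<^sub>C (- x) = - (c *\<^sub>C (x::'h::chilbert_space))"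
  using scaleC_add_right[of c x "-x"] by (simp add: eq_neg_iff_add_eq_0 add.commute)

lemma scaleC_diff_right: "c *\<^sub>C (x - y) = c *\<^sub>C x - c *\<^sub>C (y::'h::chilbert_space)"
  using scaleC_add_right[of c x "-y"] by (simp add: scaleC_minus_right)

lemma scaleC_diff_left: "(c - d) *\<^sub>C x = c *\<^sub>C x - d *\<^sub>C (x::'h::chilbert_space)"
  using scaleC_add_left[of c "-d" x] by (simp add: scaleC_minus_left)

lemma scaleC_sum_right: "c *\<^sub>C (\<Sum>i\<in>I. g i) = (\<Sum>i\<in>I. c *\<^sub>C (g i::'h::chilbert_space))"
  by (induction I rule: infinite_finite_induct) (auto simp: scaleC_add_right)

lemma scaleC_sum_left: "(\<Sum>i\<in>I. g i) *\<^sub>C (x::'h::chilbert_space) = (\<Sum>i\<in>I. g i *\<^sub>C x)"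
  by (induction I rule: infinite_finite_induct) (auto simp: scaleC_add_left)

lemma cinner_zero_left [simp]: "cinner 0 (y::'h::chilbert_space) = 0"
  using cinner_add_left[of 0 0 y] by simp

lemma cinner_zero_right [simp]: "cinner (y::'h::chilbert_space) 0 = 0"
  using cinner_commute[of y 0] by simp

lemma cinner_minus_left: "cinner (- x) y = - cinner x (y::'h::chilbert_space)"
  using cinner_add_left[of x "-x" y] by (simp add: eq_neg_iff_add_eq_0 add.commute)

lemma cinner_diff_left: "cinner (x - z) y = cinner x y - cinner z (y::'h::chilbert_space)"
  using cinner_add_left[of x "-z" y] by (simp add: cinner_minus_left)

lemma cinner_add_right: "cinner y (x + z) = cinner y x + cinner y (z::'h::chilbert_space)"
  using arg_cong[OF cinner_add_left[of x z y], of cnj] by (simp flip: cinner_commute)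

lemma cinner_minus_right: "cinner y (- x) = - cinner y (x::'h::chilbert_space)"
  using arg_cong[OF cinner_minus_left[of x y], of cnj] by (simp flip: cinner_commute)

lemma cinner_diff_right: "cinner y (x - z) = cinner y x - cinner y (z::'h::chilbert_space)"
  using arg_cong[OF cinner_diff_left[of x z y], of cnj] by (simp flip: cinner_commute)

lemma cinner_scaleC_right: "cinner y (c *\<^sub>C x) = cnj c * cinner y (x::'h::chilbert_space)"
  using arg_cong[OF cinner_scaleC_left[of c x y], of cnj] by (simp flip: cinner_commute)

lemma cinner_scaleR_left: "cinner (r *\<^sub>R x) y = of_real r * cinner x (y::'h::chilbert_space)"
  by (simp add: cinner_scaleC_left flip: scaleC_of_real)

lemma cinner_scaleR_right: "cinner y (r *\<^sub>R x) = of_real r * cinner y (x::'h::chilbert_space)"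
  by (simp add: cinner_scaleC_right flip: scaleC_of_real)

lemma cinner_sum_left: "cinner (\<Sum>i\<in>I. g i) (y::'h::chilbert_space) = (\<Sum>i\<in>I. cinner (g i) y)"
  by (induction I rule: infinite_finite_induct) (auto simp: cinner_add_left)

lemma cinner_sum_right: "cinner (y::'h::chilbert_space) (\<Sum>i\<in>I. g i) = (\<Sum>i\<in>I. cinner y (g i))"
  by (induction I rule: infinite_finite_induct) (auto simp: cinner_add_right)

lemmas cinner_simps = cinner_add_left cinner_add_right cinner_diff_left cinner_diff_right
  cinner_minus_left cinner_minus_right cinner_scaleC_left cinner_scaleC_right
  cinner_scaleR_left cinner_scaleR_right

lemma norm_scaleC [simp]: "norm (c *\<^sub>C x) = cmod c * norm (x::'h::chilbert_space)"
proof -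
  have "cinner (c *\<^sub>C x) (c *\<^sub>C x) = of_real ((cmod c * norm x)\<^sup>2)"
    unfolding cinner_scaleC_left cinner_scaleC_right cinner_self[of x]
    by (simp only: power_mult_distrib of_real_mult complex_norm_square mult_ac)
  then have "(norm (c *\<^sub>C x))\<^sup>2 = (cmod c * norm x)\<^sup>2"
    unfolding cinner_self by (simp only: of_real_eq_iff)
  then show ?thesis by (simp add: power2_eq_iff_nonneg)
qed

lemma Re_cinner_self [simp]: "Re (cinner x x) = (norm (x::'h::chilbert_space))\<^sup>2"
  by (simp add: cinner_self del: of_real_power)

lemma norm_add_sq: "(norm (x + y))\<^sup>2 = (norm x)\<^sup>2 + 2 * Re (cinner x y) + (norm (y::'h::chilbert_space))\<^sup>2"
proof -
  have "Re (cinner y x) = Re (cinner x y)" using cinner_commute[of x y] by simp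
  then show ?thesis
    by (simp add: cinner_simps flip: Re_cinner_self)
qed

lemma cinner_eq_zero_all: "(\<And>y. cinner x y = 0) \<Longrightarrow> x = (0::'h::chilbert_space)"
  using Re_cinner_self[of x] by simp

lemma cinner_ext_left: "(\<And>y. cinner x y = cinner z y) \<Longrightarrow> x = (z::'h::chilbert_space)"
  using cinner_eq_zero_all[of "x - z"] by (simp add: cinner_simps)

text \<open>Here \<open>a\<close>, \<open>b\<close> and \<open>z\<close> stand for the values \<open>B x x\<close>, \<open>B y y\<close> and \<open>B y x\<close> of a sesquilinear form.\<close>

lemma psd_form_cauchy_schwarz:
  fixes a b :: real and z :: complex
  assumes "\<And>c::complex. 0 \<le> a + 2 * Re (c * z) + (cmod c)\<^sup>2 * b"
    and "0 \<le> a" "0 \<le> b"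
  shows "(cmod z)\<^sup>2 \<le> a * b"
proof (cases "z = 0")
  case True then show ?thesis using assms by simp
next
  case False
  define m where "m = (cmod z)\<^sup>2"
  have m: "m > 0" using False by (simp add: m_def)
  \<comment> \<open>Choosing \<open>c\<close> opposite in phase to \<open>z\<close> makes the cross
    term real, which leaves a quadratic polynomial in one real variable.\<close>
  have *: "0 \<le> a - 2 * t * m + t\<^sup>2 * m * b" for t :: real
  proof -
    have "Re ((- of_real t * cnj z) * z) = - t * m"
      unfolding m_def by (simp add: cmod_def power2_eq_square algebra_simps)
    moreover have "(cmod (- of_real t * cnj z))\<^sup>2 = t\<^sup>2 * m"
      by (simp add: m_def norm_mult power_mult_distrib)
    ultimately show ?thesis using assms(1)[of "- of_real t * cnj z"] by simp
  qed
  show ?thesis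
  proof (cases "b = 0")
    case True
    \<comment> \<open>With \<open>b = 0\<close> the polynomial is linear with negative slope; at
      this \<open>t\<close> it takes the value -1.\<close>
    have "a - 2 * ((a + 1) / (2 * m)) * m = -1" using m by (simp add: field_simps)
    with *[of "(a+1)/(2*m)"] True have False by simp
    then show ?thesis ..
  next
    case False
    then have b: "b > 0" using assms by simp
    \<comment> \<open>\<open>t = 1/b\<close> is the minimizer of the quadratic.\<close>
    have "a - 2 * (1/b) * m + (1/b)\<^sup>2 * m * b = a - m / b"
      using b by (simp add: field_simps power2_eq_square)
    with *[of "1/b"] have "m / b \<le> a" by simp
    then show ?thesis using b unfolding m_def[symmetric] by (simp add: field_simps)
  qed
qed

lemma cauchy_schwarz: "cmod (cinner x y) \<le> norm x * norm (y::'h::chilbert_space)"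
proof -
  have "(cmod (cinner y x))\<^sup>2 \<le> (norm x)\<^sup>2 * (norm y)\<^sup>2"
  proof (rule psd_form_cauchy_schwarz)
    fix c
    have "0 \<le> (norm (x + c *\<^sub>C y))\<^sup>2" by simp
    also have "\<dots> = (norm x)\<^sup>2 + 2 * Re (c * cinner y x) + (cmod c)\<^sup>2 * (norm y)\<^sup>2"
    proof -
      have "Re (cinner x (c *\<^sub>C y)) = Re (c * cinner y x)"
        using cinner_commute[of x y] by (simp add: cinner_simps)
      then show ?thesis by (simp add: norm_add_sq power_mult_distrib)
    qed
    finally show "0 \<le> (norm x)\<^sup>2 + 2 * Re (c * cinner y x) + (cmod c)\<^sup>2 * (norm y)\<^sup>2" .
  qed auto
  then have "cmod (cinner y x) \<le> norm x * norm y"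
    by (auto simp: power_mult_distrib intro: power2_le_imp_le[of _ "norm x * norm y"])
  then show ?thesis using cinner_commute[of x y] by simp
qed

lemma bounded_bilinear_cinner: "bounded_bilinear (cinner :: 'h::chilbert_space \<Rightarrow> 'h \<Rightarrow> complex)"
proof
  show "\<exists>K. \<forall>a b. cmod (cinner a b) \<le> norm (a::'h) * norm b * K"
    using cauchy_schwarz by (intro exI[of _ 1]) auto
qed (auto simp: cinner_simps scaleR_conv_of_real)

lemmas tendsto_cinner [tendsto_intros] = bounded_bilinear.tendsto[OF bounded_bilinear_cinner]

lemma bounded_linear_scaleC: "bounded_linear ((*\<^sub>C) c :: 'h::chilbert_space \<Rightarrow> 'h)"
proof
  fix r and x :: 'h
  show "c *\<^sub>C r *\<^sub>R x = r *\<^sub>R c *\<^sub>C x"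
    by (simp add: scaleC_scaleC mult.commute flip: scaleC_of_real)
  show "\<exists>K. \<forall>x::'h. norm (c *\<^sub>C x) \<le> norm x * K"
    by (intro exI[of _ "cmod c"]) (auto simp: mult.commute)
qed (rule scaleC_add_right)

lemmas tendsto_scaleC [tendsto_intros] = bounded_linear.tendsto[OF bounded_linear_scaleC]

section \<open>Operators and their quadratic forms\<close>

text \<open>Taking the real part makes \<open>qf X x\<close> a real number that is linear in
  \<open>X\<close> for every bounded map; on positive operators nothing is lost, because there the
  form is real. Operator inequalities are handled below as inequalities between these
  numbers.\<close>

definition qf :: "('h::chilbert_space \<Rightarrow>\<^sub>L 'h) \<Rightarrow> 'h \<Rightarrow> real" where
  "qf X x = Re (cinner (X x) x)"

lemma bounded_ops_scaleC: "X \<in> bounded_ops \<Longrightarrow> X (c *\<^sub>C x) = c *\<^sub>C X x"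
  by (simp add: bounded_ops_def)

lemma bounded_ops_add: "X \<in> bounded_ops \<Longrightarrow> Y \<in> bounded_ops \<Longrightarrow> X + Y \<in> bounded_ops"
  by (simp add: bounded_ops_def blinfun.add_left scaleC_add_right)

lemma bounded_ops_diff: "X \<in> bounded_ops \<Longrightarrow> Y \<in> bounded_ops \<Longrightarrow> X - Y \<in> bounded_ops"
  by (simp add: bounded_ops_def blinfun.diff_left scaleC_diff_right)

lemma scaleC_scaleR_commute: "c *\<^sub>C r *\<^sub>R x = r *\<^sub>R c *\<^sub>C (x::'h::chilbert_space)"
  by (simp add: scaleC_scaleC mult.commute flip: scaleC_of_real)

lemma bounded_ops_scaleR: "X \<in> bounded_ops \<Longrightarrow> r *\<^sub>R X \<in> bounded_ops"
  by (simp add: bounded_ops_def blinfun.scaleR_left scaleC_scaleR_commute)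

lemma bounded_ops_id: "id_blinfun \<in> bounded_ops"
  by (simp add: bounded_ops_def)

lemma bounded_ops_compose: "X \<in> bounded_ops \<Longrightarrow> Y \<in> bounded_ops \<Longrightarrow> X o\<^sub>L Y \<in> bounded_ops"
  by (simp add: bounded_ops_def)

lemma bounded_ops_sum:
  assumes "X \<in> bounded_ops"
  shows "X (\<Sum>i\<in>I. c i *\<^sub>C g i) = (\<Sum>i\<in>I. c i *\<^sub>C X (g i))"
  by (simp add: blinfun.sum_right bounded_ops_scaleC[OF assms])

lemma bounded_opsE:
  assumes add: "\<And>x y. g (x + y) = g x + g y" and scale: "\<And>c x. g (c *\<^sub>C x) = c *\<^sub>C g x"
    and bnd: "\<And>x. norm (g x) \<le> K * norm (x::'h::chilbert_space)"
  obtains X where "X \<in> bounded_ops" "blinfun_apply X = g"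
proof -
  have "bounded_linear g"
  proof
    show "g (r *\<^sub>R x) = r *\<^sub>R g x" for r x
      using scale[of "of_real r" x] by (simp add: scaleC_of_real)
    show "\<exists>K. \<forall>x. norm (g x) \<le> norm x * K" using bnd by (auto simp: mult.commute)
  qed (rule add)
  then have "blinfun_apply (Blinfun g) = g" by (rule bounded_linear_Blinfun_apply)
  with scale show thesis by (intro that[of "Blinfun g"]) (auto simp: bounded_ops_def)
qed

lemma qf_add: "qf (X + Y) x = qf X x + qf Y x"
  by (simp add: qf_def blinfun.add_left cinner_simps)

lemma qf_diff: "qf (X - Y) x = qf X x - qf Y x"
  by (simp add: qf_def blinfun.diff_left cinner_simps)

lemma qf_scaleR: "qf (r *\<^sub>R X) x = r * qf X x"
  by (simp add: qf_def blinfun.scaleR_left cinner_simps)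

lemma qf_zero: "qf 0 x = 0"
  by (simp add: qf_def)

lemma qf_id [simp]: "qf id_blinfun x = (norm x)\<^sup>2"
  by (simp add: qf_def)

lemmas qf_simps = qf_add qf_diff qf_scaleR qf_id

lemma op_pos_qf: "op_pos X \<Longrightarrow> 0 \<le> qf X x"
  by (auto simp: op_pos_def qf_def less_eq_complex_def)

lemma op_pos_bounded_ops: "op_pos X \<Longrightarrow> X \<in> bounded_ops"
  by (simp add: op_pos_def)

text \<open>Polarization: reality of the form at x + y and at x + iy fixes the imaginary and the
  real parts of its off-diagonal values.\<close>

lemma op_pos_selfadjoint:
  assumes "op_pos X"
  shows "cinner (X x) y = cinner x (X y)"
proof -
  have B: "X \<in> bounded_ops" and im: "Im (cinner (X z) z) = 0" for z
    using assms by (auto simp: op_pos_def less_eq_complex_def)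
  let ?s = "\<lambda>x y. cinner (X x) y"
  have "Im (?s x y) + Im (?s y x) = 0"
    using im[of "x + y"] im[of x] im[of y] by (simp add: blinfun.add_right cinner_simps)
  moreover have "Re (?s x y) = Re (?s y x)"
    using im[of "x + \<i> *\<^sub>C y"] im[of x] im[of y]
    by (simp add: blinfun.add_right cinner_simps bounded_ops_scaleC[OF B])
  ultimately have "?s x y = cnj (?s y x)" by (auto simp: complex_eq_iff)
  then show ?thesis by (metis cinner_commute)
qed

lemma op_posI:
  assumes "X \<in> bounded_ops" "\<And>x y. cinner (X x) y = cinner x (X y)"
    "\<And>x. 0 \<le> qf X x"
  shows "op_pos X"
proof -
  have "Im (cinner (X x) x) = 0" for x
    using assms(2)[of x x] cinner_commute[of x "X x"] by (simp add: complex_eq_iff)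
  then show ?thesis using assms by (auto simp: op_pos_def less_eq_complex_def qf_def)
qed

lemma op_pos_add: "op_pos X \<Longrightarrow> op_pos Y \<Longrightarrow> op_pos (X + Y)"
  by (auto simp: op_pos_def bounded_ops_add blinfun.add_left cinner_simps less_eq_complex_def)

lemma op_pos_scaleR: "op_pos X \<Longrightarrow> 0 \<le> r \<Longrightarrow> op_pos (r *\<^sub>R X)"
  by (auto simp: op_pos_def bounded_ops_scaleR blinfun.scaleR_left cinner_simps less_eq_complex_def)

lemma op_pos_id: "op_pos id_blinfun"
  by (auto simp: op_pos_def bounded_ops_id less_eq_complex_def cinner_self)

text \<open>Self-adjointness of both operators makes the form of the difference real, so that only
  its sign remains to be compared. This is the passage between the operator order and
  \<open>qf\<close>.\<close>

lemma op_le_iff: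
  assumes "op_pos X" "op_pos Y"
  shows "X \<le>\<^sub>o\<^sub>p Y \<longleftrightarrow> (\<forall>x. qf X x \<le> qf Y x)"
proof
  assume "X \<le>\<^sub>o\<^sub>p Y"
  then show "\<forall>x. qf X x \<le> qf Y x"
    using op_pos_qf[of "Y - X"] by (auto simp: op_le_def qf_diff)
next
  assume "\<forall>x. qf X x \<le> qf Y x"
  then show "X \<le>\<^sub>o\<^sub>p Y" unfolding op_le_def
    using assms
    by (intro op_posI bounded_ops_diff)
      (auto simp: qf_diff blinfun.diff_left cinner_simps op_pos_selfadjoint op_pos_bounded_ops)
qed

lemma op_le_qf: "X \<le>\<^sub>o\<^sub>p Y \<Longrightarrow> qf X x \<le> qf Y x"
  using op_pos_qf[of "Y - X" x] by (auto simp: op_le_def qf_diff)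

lemma qf_add_arg:
  assumes "op_pos X"
  shows "qf X (x + y) = qf X x + 2 * Re (cinner (X x) y) + qf X y"
proof -
  have "Re (cinner (X y) x) = Re (cinner (X x) y)"
    using op_pos_selfadjoint[OF assms, of y x] cinner_commute[of y "X x"] by simp
  then show ?thesis by (simp add: qf_def blinfun.add_right cinner_simps)
qed

lemma qf_scaleC:
  assumes "X \<in> bounded_ops"
  shows "qf X (c *\<^sub>C x) = (cmod c)\<^sup>2 * qf X x"
proof -
  have "cinner (X (c *\<^sub>C x)) (c *\<^sub>C x) = of_real ((cmod c)\<^sup>2) * cinner (X x) x"
    by (simp add: bounded_ops_scaleC[OF assms] cinner_simps complex_norm_square del: of_real_power)
  then show ?thesis by (simp add: qf_def del: of_real_power)
qed

lemma qf_minus: "qf X (- x) = qf X x"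
  by (simp add: qf_def blinfun.minus_right cinner_simps)

lemma op_pos_cauchy_schwarz:
  assumes "op_pos X"
  shows "(cmod (cinner (X x) y))\<^sup>2 \<le> qf X x * qf X y"
proof -
  note B = op_pos_bounded_ops[OF assms]
  have "(cmod (cnj (cinner (X x) y)))\<^sup>2 \<le> qf X x * qf X y"
  proof (rule psd_form_cauchy_schwarz)
    fix c
    have "0 \<le> qf X (x + c *\<^sub>C y)" by (rule op_pos_qf[OF assms])
    also have "\<dots> = qf X x + 2 * Re (c * cnj (cinner (X x) y)) + (cmod c)\<^sup>2 * qf X y"
      by (simp add: qf_add_arg[OF assms] qf_scaleC[OF B] cinner_simps)
    finally show "0 \<le> \<dots>" .
  qed (auto simp: op_pos_qf assms)
  then show ?thesis by simp
qed

lemma qf_le_norm: "qf X x \<le> norm X * (norm x)\<^sup>2"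
proof -
  have "qf X x \<le> cmod (cinner (X x) x)"
    unfolding qf_def by (rule complex_Re_le_cmod)
  also have "\<dots> \<le> norm (X x) * norm x" by (rule cauchy_schwarz)
  also have "\<dots> \<le> (norm X * norm x) * norm x"
    by (intro mult_right_mono norm_blinfun) auto
  finally show ?thesis by (simp add: power2_eq_square mult_ac)
qed

text \<open>Cauchy-Schwarz for the form of \<open>X\<close>, applied to \<open>x\<close> and
  \<open>X x\<close>, bounds |Xx|^4 by the product of the two form values. A bounded positive
  operator with small form at \<open>x\<close> thus has a small image of \<open>x\<close>, which is
  how monotone families become strongly convergent.\<close>

lemma op_pos_norm_sq_le:
  assumes X: "op_pos X" and M: "\<And>x. qf X x \<le> M * (norm x)\<^sup>2"
  shows "(norm (X x))\<^sup>2 \<le> M * qf X x"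
proof (cases "X x = 0")
  case True then show ?thesis
    by (simp add: qf_def)
next
  case False
  let ?y = "X x"
  have "((norm ?y)\<^sup>2)\<^sup>2 = (cmod (cinner ?y ?y))\<^sup>2" by (simp add: cinner_self del: of_real_power)
  also have "\<dots> \<le> qf X x * qf X ?y" by (rule op_pos_cauchy_schwarz[OF X])
  also have "\<dots> \<le> qf X x * (M * (norm ?y)\<^sup>2)" by (intro mult_left_mono M op_pos_qf X)
  finally have "(norm ?y)\<^sup>2 * (norm ?y)\<^sup>2 \<le> (M * qf X x) * (norm ?y)\<^sup>2"
    by (simp add: power2_eq_square mult_ac)
  then show ?thesis by (rule mult_right_le_imp_le) (use False in simp)
qed

lemma op_pos_norm_le:
  assumes X: "op_pos X" and M: "\<And>x. qf X x \<le> M * (norm x)\<^sup>2" "0 \<le> M"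
  shows "norm (X x) \<le> M * norm x"
proof -
  have "(norm (X x))\<^sup>2 \<le> M * qf X x" by (rule op_pos_norm_sq_le[OF X M(1)])
  also have "\<dots> \<le> M * (M * (norm x)\<^sup>2)" by (intro mult_left_mono M)
  also have "\<dots> = (M * norm x)\<^sup>2" by (simp add: power2_eq_square mult_ac)
  finally show ?thesis by (rule power2_le_imp_le) (use M(2) in simp)
qed

text \<open>The inverse exists because \<open>x \<mapsto> x - (X x - y) / M\<close> is a contraction for \<open>M\<close> an upper bound of
  \<open>X\<close>; its fixed point solves \<open>X x = y\<close>.\<close>

lemma op_strictly_posI:
  fixes X :: "'h::chilbert_space \<Rightarrow>\<^sub>L 'h"
  assumes X: "op_pos X" and c: "0 < c" and lower: "\<And>x. c * (norm x)\<^sup>2 \<le> qf X x"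
  shows "op_strictly_pos X"
proof -
  note B = op_pos_bounded_ops[OF X]
  \<comment> \<open>Adding \<open>c\<close> keeps \<open>M\<close> positive and at least
    \<open>c\<close>, so the contraction constant 1 - c/M lies in [0,1) even on the trivial space,
    where \<open>norm X\<close> is 0.\<close>
  define M where "M = norm X + c"
  have M: "M > 0" "M \<ge> c" using c by (auto simp: M_def add_nonneg_pos)
  define T where "T = id_blinfun - (1 / M) *\<^sub>R X"
  have qT: "qf T x = (norm x)\<^sup>2 - qf X x / M" for x
    by (simp add: T_def qf_simps)
  have qX: "qf X x \<le> M * (norm x)\<^sup>2" for x
  proof -
    have "qf X x \<le> norm X * (norm x)\<^sup>2" by (rule qf_le_norm)
    also have "\<dots> \<le> M * (norm x)\<^sup>2" using c by (intro mult_right_mono) (auto simp: M_def)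
    finally show ?thesis .
  qed
  have T: "op_pos T"
  proof (rule op_posI)
    show "T \<in> bounded_ops" unfolding T_def by (intro bounded_ops_diff bounded_ops_id bounded_ops_scaleR B)
    show "0 \<le> qf T x" for x using qX[of x] M by (simp add: qT field_simps)
  qed (simp add: T_def blinfun.diff_left blinfun.scaleR_left cinner_simps op_pos_selfadjoint[OF X])
  define k where "k = 1 - c / M"
  have k: "0 \<le> k" "k < 1" using M c by (auto simp: k_def field_simps)
  have Tn: "norm (T x) \<le> k * norm x" for x
  proof (rule op_pos_norm_le[OF T _ k(1)])
    fix x have "c * (norm x)\<^sup>2 / M \<le> qf X x / M" using lower[of x] M by (simp add: divide_right_mono)
    then show "qf T x \<le> k * (norm x)\<^sup>2" by (simp add: qT k_def algebra_simps)
  qed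
  have "\<exists>x. X x = y" for y
  proof -
    define g where "g x = T x + (1 / M) *\<^sub>R y" for x
    have "\<exists>!x. g x = x"
    proof (rule banach_fix_type[OF k])
      show "\<forall>x z. dist (g x) (g z) \<le> k * dist x z"
        using Tn by (auto simp: g_def dist_norm simp flip: blinfun.diff_right)
    qed
    then obtain x where "g x = x" by auto
    moreover have "(1 / M) *\<^sub>R (X x - y) = x - g x"
      by (simp add: g_def T_def blinfun.diff_left blinfun.scaleR_left scaleR_diff_right)
    ultimately have "X x - y = 0" using M by simp
    then show ?thesis by auto
  qed
  then obtain g where g: "\<And>y. X (g y) = y" by metis
  \<comment> \<open>The lower bound yields injectivity and, read at \<open>g x\<close>, the norm
    bound 1/c for the inverse; injectivity is also what makes the chosen right inverse
    linear.\<close>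
  have low: "c * norm x \<le> norm (X x)" for x
  proof (cases "x = 0")
    case False
    have "c * (norm x)\<^sup>2 \<le> cmod (cinner (X x) x)"
      using lower[of x] complex_Re_le_cmod[of "cinner (X x) x"] by (simp add: qf_def)
    also have "\<dots> \<le> norm (X x) * norm x" by (rule cauchy_schwarz)
    finally show ?thesis using False by (simp add: power2_eq_square)
  qed auto
  have inj: "x = z" if "X x = X z" for x z
  proof -
    have "c * norm (x - z) \<le> 0" using low[of "x - z"] that by (simp add: blinfun.diff_right)
    then show ?thesis using c by (simp add: mult_le_0_iff)
  qed
  obtain Y where Y: "Y \<in> bounded_ops" "blinfun_apply Y = g"
  proof (rule bounded_opsE)
    show "g (x + y) = g x + g y" for x y by (rule inj) (simp add: g blinfun.add_right)
    show "g (a *\<^sub>C x) = a *\<^sub>C g x" for a x by (rule inj) (simp add: g bounded_ops_scaleC[OF B])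
    show "norm (g x) \<le> (1 / c) * norm x" for x using low[of "g x"] c by (simp add: g field_simps)
  qed blast
  have "X o\<^sub>L Y = id_blinfun" "Y o\<^sub>L X = id_blinfun"
    by (auto intro!: blinfun_eqI simp: Y g inj)
  with X Y(1) show ?thesis by (auto simp: op_strictly_pos_def)
qed

lemma op_strictly_pos_pos: "op_strictly_pos X \<Longrightarrow> op_pos X"
  by (simp add: op_strictly_pos_def)

lemma op_strictly_pos_add_id:
  assumes "op_pos X" "0 < \<epsilon>"
  shows "op_strictly_pos (X + \<epsilon> *\<^sub>R id_blinfun)"
  using assms op_pos_qf[of X]
  by (intro op_strictly_posI[of _ \<epsilon>] op_pos_add op_pos_scaleR op_pos_id) (auto simp: qf_simps)

text \<open>The definite description is resolved by exhibiting a candidate: each operator put into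
  the transformer inequality comes with an explicit adjoint, and testing against inner products
  gives uniqueness.\<close>

lemma op_adjoint_eqI:
  fixes S S' :: "'h::chilbert_space \<Rightarrow>\<^sub>L 'h"
  assumes "S' \<in> bounded_ops" "\<And>x y. cinner (S x) y = cinner x (S' y)"
  shows "op_adjoint S = S'"
  unfolding op_adjoint_def
proof (rule the_equality)
  fix Y assume Y: "Y \<in> bounded_ops \<and> (\<forall>x y. cinner (S x) y = cinner x (Y y))"
  show "Y = S'"
  proof (rule blinfun_eqI)
    fix y
    show "Y y = S' y"
    proof (rule cinner_ext_left)
      fix z
      have "cinner z (Y y) = cinner z (S' y)" using Y assms(2) by metis
      then show "cinner (Y y) z = cinner (S' y) z" by (metis cinner_commute)
    qed
  qed
qed (use assms in auto)

section \<open>Orthonormal bases\<close>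

definition csubspace :: "'h::chilbert_space set \<Rightarrow> bool" where
  "csubspace V \<longleftrightarrow> 0 \<in> V \<and> (\<forall>x\<in>V. \<forall>y\<in>V. x + y \<in> V) \<and> (\<forall>c. \<forall>x\<in>V. c *\<^sub>C x \<in> V)"

lemma csubspace_sum: "csubspace V \<Longrightarrow> (\<And>i. i \<in> I \<Longrightarrow> g i \<in> V) \<Longrightarrow> (\<Sum>i\<in>I. c i *\<^sub>C g i) \<in> V"
  by (induction I rule: infinite_finite_induct) (auto simp: csubspace_def)

lemma csubspace_diff:
  assumes "csubspace V" "x \<in> V" "y \<in> V"
  shows "x - y \<in> V"
proof -
  have "(-1) *\<^sub>C y \<in> V" using assms by (auto simp: csubspace_def)
  then have "- y \<in> V" by (simp add: scaleC_minus_left)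
  then have "x + - y \<in> V" using assms by (auto simp: csubspace_def simp del: add_uminus_conv_diff)
  then show ?thesis by simp
qed

lemma onb_cinner:
  "orthonormal_basis E \<Longrightarrow> u \<in> E \<Longrightarrow> v \<in> E \<Longrightarrow> cinner u v = (if u = v then 1 else 0)"
  by (simp add: orthonormal_basis_def)

lemma onb_coeff:
  assumes "orthonormal_basis E" "finite F" "F \<subseteq> E" "v \<in> E"
  shows "cinner (\<Sum>u\<in>F. c u *\<^sub>C u) v = (if v \<in> F then c v else 0)"
proof -
  have "cinner (\<Sum>u\<in>F. c u *\<^sub>C u) v = (\<Sum>u\<in>F. if u = v then c u else 0)"
    unfolding cinner_sum_left
    using assms by (intro sum.cong) (auto simp: cinner_scaleC_left onb_cinner)
  then show ?thesis using assms(2) by simp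
qed

lemma onb_norm_sq:
  assumes "orthonormal_basis E" "finite F" "F \<subseteq> E"
  shows "(norm (\<Sum>u\<in>F. c u *\<^sub>C u))\<^sup>2 = (\<Sum>u\<in>F. (cmod (c u))\<^sup>2)"
proof -
  let ?x = "\<Sum>u\<in>F. c u *\<^sub>C u"
  have "cinner ?x ?x = (\<Sum>u\<in>F. cnj (c u) * cinner ?x u)"
    by (simp only: cinner_sum_right cinner_scaleC_right)
  also have "\<dots> = (\<Sum>u\<in>F. cnj (c u) * c u)"
    using assms(3) by (intro sum.cong) (auto simp: onb_coeff[OF assms] subset_iff)
  finally have "Re (cinner ?x ?x) = (\<Sum>u\<in>F. Re (cnj (c u) * c u))" by simp
  then show ?thesis by (simp add: cmod_def power2_eq_square)
qed

text \<open>For finite orthonormal \<open>F\<close> this is the orthogonal projection onto the span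
  of \<open>F\<close>, kept as a plain function. For infinite \<open>F\<close> the sum has the
  default value 0; that case is covered by \<open>proj\<close>.\<close>

definition pr :: "'h::chilbert_space set \<Rightarrow> 'h \<Rightarrow> 'h" where
  "pr F x = (\<Sum>u\<in>F. cinner x u *\<^sub>C u)"

lemma pr_coeff:
  "orthonormal_basis E \<Longrightarrow> finite F \<Longrightarrow> F \<subseteq> E \<Longrightarrow> v \<in> E \<Longrightarrow>
    cinner (pr F x) v = (if v \<in> F then cinner x v else 0)"
  by (simp add: pr_def onb_coeff)

lemma pr_norm_sq:
  "orthonormal_basis E \<Longrightarrow> finite F \<Longrightarrow> F \<subseteq> E \<Longrightarrow>
    (norm (pr F x))\<^sup>2 = (\<Sum>u\<in>F. (cmod (cinner x u))\<^sup>2)"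
  by (simp add: pr_def onb_norm_sq)

lemma pr_orth:
  assumes "orthonormal_basis E" "finite F" "F \<subseteq> E"
  shows "cinner (x - pr F x) (\<Sum>u\<in>F. c u *\<^sub>C u) = 0"
  using assms(3)
  by (auto simp: cinner_sum_right cinner_simps pr_coeff[OF assms] subset_iff intro!: sum.neutral)

text \<open>The error of \<open>pr F\<close> is orthogonal to all combinations over
  \<open>F\<close>, so any other combination adds its squared distance from
  \<open>pr F x\<close>.\<close>

lemma pr_best:
  assumes "orthonormal_basis E" "finite F" "F \<subseteq> E"
  shows "norm (x - pr F x) \<le> norm (x - (\<Sum>u\<in>F. c u *\<^sub>C u))"
proof -
  let ?d = "\<Sum>u\<in>F. (cinner x u - c u) *\<^sub>C u"
  have d: "?d = pr F x - (\<Sum>u\<in>F. c u *\<^sub>C u)"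
    by (simp add: pr_def scaleC_diff_left sum_subtractf)
  have "(norm ((x - pr F x) + ?d))\<^sup>2 = (norm (x - pr F x))\<^sup>2 + (norm ?d)\<^sup>2"
    unfolding norm_add_sq pr_orth[OF assms] by simp
  then have "(norm (x - pr F x))\<^sup>2 \<le> (norm (x - (\<Sum>u\<in>F. c u *\<^sub>C u)))\<^sup>2"
    unfolding d by simp
  then show ?thesis by (rule power2_le_imp_le) simp
qed

lemma pr_pythagoras:
  assumes "orthonormal_basis E" "finite F" "F \<subseteq> E"
  shows "(norm x)\<^sup>2 = (norm (x - pr F x))\<^sup>2 + (norm (pr F x))\<^sup>2"
proof -
  have "cinner (x - pr F x) (pr F x) = 0"
    using pr_orth[OF assms, of x "\<lambda>u. cinner x u"] by (simp add: pr_def)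
  then show ?thesis using norm_add_sq[of "x - pr F x" "pr F x"] by simp
qed

lemma bessel:
  assumes "orthonormal_basis E" "finite F" "F \<subseteq> E"
  shows "(\<Sum>u\<in>F. (cmod (cinner x u))\<^sup>2) \<le> (norm x)\<^sup>2"
  using pr_pythagoras[OF assms, of x] by (simp add: pr_norm_sq[OF assms])

lemma pr_norm_le:
  assumes "orthonormal_basis E" "finite F" "F \<subseteq> E"
  shows "norm (pr F x) \<le> norm x" "norm (x - pr F x) \<le> norm x"
  using pr_pythagoras[OF assms, of x] by (auto intro!: power2_le_imp_le[OF _ norm_ge_zero])

lemma pr_mono:
  assumes "orthonormal_basis E" "finite G" "G \<subseteq> E" "F \<subseteq> G"
  shows "norm (x - pr G x) \<le> norm (x - pr F x)"
proof -
  have "pr F x = (\<Sum>u\<in>G. (if u \<in> F then cinner x u else 0) *\<^sub>C u)"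
    unfolding pr_def using assms by (intro sum.mono_neutral_cong_left) auto
  then show ?thesis using pr_best[OF assms(1-3), of x "\<lambda>u. if u \<in> F then cinner x u else 0"] by simp
qed

text \<open>Density in the definition of a basis gives some nearby combination; replacing its
  coefficients by the Fourier coefficients can only improve it.\<close>

lemma onb_approx:
  assumes "orthonormal_basis E" "0 < e"
  obtains F where "finite F" "F \<subseteq> E" "norm (x - pr F x) < e"
proof -
  have "x \<in> closure {\<Sum>u\<in>F. c u *\<^sub>C u | F c. finite F \<and> F \<subseteq> E}"
    using assms(1) by (simp add: orthonormal_basis_def)
  then obtain F c where F: "finite F" "F \<subseteq> E" "dist (\<Sum>u\<in>F. c u *\<^sub>C u) x < e"
    using assms(2) unfolding closure_approachable by blast
  have "norm (x - pr F x) < e"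
    using pr_best[OF assms(1) F(1,2), of x c] F(3) by (simp add: dist_norm norm_minus_commute)
  with F show thesis by (intro that)
qed

lemma onb_dense_induct:
  assumes E: "orthonormal_basis E" and V: "csubspace V" "closed V" "E \<subseteq> V"
  shows "x \<in> V"
proof -
  have "x \<in> closure V" unfolding closure_approachable
  proof (intro allI impI)
    fix e :: real assume "0 < e"
    then obtain F where F: "finite F" "F \<subseteq> E" "norm (x - pr F x) < e"
      using onb_approx[OF E] by metis
    have "pr F x \<in> V" unfolding pr_def using F V by (intro csubspace_sum) auto
    then show "\<exists>y\<in>V. dist y x < e" using F(3) by (auto simp: dist_norm norm_minus_commute)
  qed
  then show ?thesis using V(2) by simp
qed

lemma onb_eqI:
  assumes E: "orthonormal_basis E" and eq: "\<And>u. u \<in> E \<Longrightarrow> cinner x u = cinner y u"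
  shows "x = y"
proof (rule cinner_ext_left)
  fix z
  have "z \<in> {z. cinner x z = cinner y z}"
  proof (rule onb_dense_induct[OF E])
    show "closed {z. cinner x z = cinner y z}"
      by (intro closed_Collect_eq continuous_intros bounded_bilinear.continuous_on[OF bounded_bilinear_cinner])
  qed (use eq in \<open>auto simp: csubspace_def cinner_simps\<close>)
  then show "cinner x z = cinner y z" by simp
qed

text \<open>The basis may be uncountable, so the vector is a limit along a sequence of finite sets
  whose square sums approach the supremum. Whatever is left out of all these sets carries no
  mass.\<close>

lemma riesz_fischer:
  assumes E: "orthonormal_basis E" and M: "\<And>F. finite F \<Longrightarrow> F \<subseteq> E \<Longrightarrow> (\<Sum>u\<in>F. (cmod (c u))\<^sup>2) \<le> M"
  shows "\<exists>w. \<forall>u\<in>E. cinner w u = c u"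
proof -
  define s where "s F = (\<Sum>u\<in>F. (cmod (c u))\<^sup>2)" for F
  define fin where "fin = {F. finite F \<and> F \<subseteq> E}"
  define S where "S = (SUP F\<in>fin. s F)"
  have bdd: "bdd_above (s ` fin)" using M by (auto simp: s_def fin_def bdd_above_def)
  have ne: "s ` fin \<noteq> {}" by (auto simp: fin_def)
  have le: "s F \<le> S" if "F \<in> fin" for F
    unfolding S_def by (rule cSUP_upper[OF that bdd])
  have "\<exists>F\<in>fin. S - 1 / real (Suc n) < s F" for n
  proof -
    have "S - 1 / real (Suc n) < S" by simp
    then show ?thesis unfolding S_def by (subst (asm) less_cSUP_iff) (use ne bdd in auto)
  qed
  then obtain F where F: "\<And>n. F n \<in> fin" "\<And>n. S - 1 / real (Suc n) < s (F n)" by metis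
  \<comment> \<open>Unions make the sets increasing, and enlarging a set keeps its square sum within
    1/(n+1) of the supremum.\<close>
  define G where "G n = (\<Union>k\<le>n. F k)" for n
  have G: "finite (G n)" "G n \<subseteq> E" for n using F by (auto simp: G_def fin_def)
  then have Gf: "G n \<in> fin" for n by (simp add: fin_def)
  have Gm: "G n \<subseteq> G m" if "n \<le> m" for n m
    unfolding G_def using that by (intro UN_mono) auto
  have sG: "S - 1 / real (Suc n) < s (G n)" for n
  proof -
    have "s (F n) \<le> s (G n)" unfolding s_def
      by (rule sum_mono2) (use G in \<open>auto simp: G_def\<close>)
    with F(2)[of n] show ?thesis by simp
  qed
  define w where "w n = (\<Sum>u\<in>G n. c u *\<^sub>C u)" for n
  have dist: "(norm (w m - w n))\<^sup>2 < 1 / real (Suc n)" if "n \<le> m" for n m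
  proof -
    have "w m - w n = (\<Sum>u\<in>G m - G n. c u *\<^sub>C u)"
      unfolding w_def using sum_diff[OF G(1) Gm[OF that], of "\<lambda>u. c u *\<^sub>C u"] by simp
    then have "(norm (w m - w n))\<^sup>2 = (\<Sum>u\<in>G m - G n. (cmod (c u))\<^sup>2)"
      using onb_norm_sq[OF E, of "G m - G n" c] G[of m] by auto
    also have "\<dots> = s (G m) - s (G n)"
      unfolding s_def using sum_diff[OF G(1) Gm[OF that]] by simp
    finally show ?thesis using le[OF Gf[of m]] sG[of n] by simp
  qed
  have "Cauchy w"
  proof (rule CauchyI')
    fix e :: real assume e: "0 < e"
    obtain N where N: "inverse (real (Suc N)) < e\<^sup>2" using reals_Archimedean[of "e\<^sup>2"] e by auto
    have "norm (w m - w n) < e" if "n \<ge> N" "m > n" for m n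
    proof -
      have "(norm (w m - w n))\<^sup>2 < 1 / real (Suc n)" using that by (intro dist) auto
      also have "\<dots> \<le> 1 / real (Suc N)" using that by (intro divide_left_mono) auto
      also have "\<dots> < e\<^sup>2" using N by (simp add: inverse_eq_divide)
      finally show ?thesis using e by (auto intro: power2_less_imp_less[of _ e])
    qed
    then show "\<exists>N. \<forall>m\<ge>N. \<forall>n>m. dist (w m) (w n) < e"
      by (intro exI[of _ N]) (auto simp: dist_norm norm_minus_commute)
  qed
  then obtain w0 where w0: "w \<longlonglongrightarrow> w0" using Cauchy_convergent convergent_def by blast
  have "cinner w0 u = c u" if u: "u \<in> E" for u
  proof -
    have lim: "(\<lambda>n. cinner (w n) u) \<longlonglongrightarrow> cinner w0 u" by (intro tendsto_intros w0)
    have val: "cinner (w n) u = (if u \<in> G n then c u else 0)" for n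
      unfolding w_def by (rule onb_coeff[OF E G u])
    have "(\<lambda>n. cinner (w n) u) \<longlonglongrightarrow> c u"
    proof (cases "\<exists>n. u \<in> G n")
      case True
      then obtain n where "u \<in> G n" by auto
      then have "\<forall>m\<ge>n. cinner (w m) u = c u" using Gm val by auto
      then show ?thesis by (intro tendsto_eventually) (auto simp: eventually_sequentially)
    next
      case False
      \<comment> \<open>Adding \<open>u\<close> to \<open>G n\<close> cannot push the sum above
        \<open>S\<close>, so its share is at most the gap 1/(n+1). Hence \<open>c u = 0\<close>,
        which is the coefficient that all \<open>w n\<close> have at \<open>u\<close>.\<close>
      have "(cmod (c u))\<^sup>2 \<le> inverse (real (Suc n))" for n
      proof -
        have "s (insert u (G n)) = s (G n) + (cmod (c u))\<^sup>2"
          using False G by (simp add: s_def)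
        moreover have "insert u (G n) \<in> fin" using G u by (auto simp: fin_def)
        ultimately show ?thesis using le[of "insert u (G n)"] sG[of n] by (simp add: inverse_eq_divide)
      qed
      then have "(cmod (c u))\<^sup>2 \<le> 0"
        using LIMSEQ_le_const[OF LIMSEQ_inverse_real_of_nat] by blast
      then show ?thesis using False val by simp
    qed
    with lim show ?thesis by (rule LIMSEQ_unique)
  qed
  then show ?thesis by auto
qed

text \<open>Riesz-Fischer supplies the image of each vector. Since a vector is determined by its
  coefficients, linearity of the coefficient functionals passes to the operator, and the bound on
  finite coefficient sums passes to its norm.\<close>

lemma op_from_coeffs:
  assumes E: "orthonormal_basis E"
    and add: "\<And>u x y. u \<in> E \<Longrightarrow> \<phi> u (x + y) = \<phi> u x + \<phi> u y"
    and scale: "\<And>u c x. u \<in> E \<Longrightarrow> \<phi> u (c *\<^sub>C x) = c * \<phi> u x"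
    and M: "\<And>F x. finite F \<Longrightarrow> F \<subseteq> E \<Longrightarrow> (\<Sum>u\<in>F. (cmod (\<phi> u x))\<^sup>2) \<le> (M * norm x)\<^sup>2" "0 \<le> M"
  obtains X where "X \<in> bounded_ops" "\<And>x u. u \<in> E \<Longrightarrow> cinner (X x) u = \<phi> u x"
    "\<And>x. norm (X x) \<le> M * norm x"
proof -
  have "\<exists>w. \<forall>u\<in>E. cinner w u = \<phi> u x" for x
    by (rule riesz_fischer[OF E M(1)])
  then obtain g where g: "\<And>x u. u \<in> E \<Longrightarrow> cinner (g x) u = \<phi> u x" by metis
  have bnd: "norm (g x) \<le> M * norm x" for x
  proof (rule field_le_epsilon)
    fix e :: real assume "0 < e"
    then obtain F where F: "finite F" "F \<subseteq> E" "norm (g x - pr F (g x)) < e"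
      using onb_approx[OF E] by metis
    have "(norm (pr F (g x)))\<^sup>2 = (\<Sum>u\<in>F. (cmod (\<phi> u x))\<^sup>2)"
      unfolding pr_norm_sq[OF E F(1,2)] using F g by (intro sum.cong) auto
    also have "\<dots> \<le> (M * norm x)\<^sup>2" using F by (intro M)
    finally have "norm (pr F (g x)) \<le> M * norm x" using M(2) by (auto intro: power2_le_imp_le[of _ "M * norm x"])
    then show "norm (g x) \<le> M * norm x + e"
      using F(3) norm_triangle_sub[of "g x" "pr F (g x)"] by simp
  qed
  obtain X where "X \<in> bounded_ops" "blinfun_apply X = g"
  proof (rule bounded_opsE)
    show "g (x + y) = g x + g y" for x y
      by (rule onb_eqI[OF E]) (simp add: g add cinner_simps)
    show "g (c *\<^sub>C x) = c *\<^sub>C g x" for c x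
      by (rule onb_eqI[OF E]) (simp add: g scale cinner_simps)
  qed (use bnd in blast)+
  with g bnd show thesis by (intro that[of X]) auto
qed

section \<open>Coordinate projections and their monotone limits\<close>

text \<open>The set may be infinite, as for the union of an increasing sequence of finite sections.
  On an orthonormal basis the coefficient clause determines the chosen operator.\<close>

definition proj :: "'h::chilbert_space set \<Rightarrow> 'h set \<Rightarrow> ('h \<Rightarrow>\<^sub>L 'h)" where
  "proj E G = (SOME P. P \<in> bounded_ops \<and> (\<forall>x. norm (P x) \<le> norm x) \<and>
     (\<forall>x. \<forall>u\<in>E. cinner (P x) u = (if u \<in> G then cinner x u else 0)))"

lemma proj_props:
  assumes E: "orthonormal_basis E"
  shows proj_bounded_ops: "proj E G \<in> bounded_ops"
    and proj_norm: "norm ((proj E G) x) \<le> norm x"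
    and proj_coeff: "u \<in> E \<Longrightarrow> cinner ((proj E G) x) u = (if u \<in> G then cinner x u else 0)"
proof -
  obtain P where P: "P \<in> bounded_ops" "\<And>x. norm (P x) \<le> 1 * norm x"
     "\<And>x u. u \<in> E \<Longrightarrow> cinner (P x) u = (if u \<in> G then cinner x u else 0)"
  proof (rule op_from_coeffs[OF E])
    fix F and x :: 'a assume F: "finite F" "F \<subseteq> E"
    have "(\<Sum>u\<in>F. (cmod (if u \<in> G then cinner x u else 0))\<^sup>2) \<le> (\<Sum>u\<in>F. (cmod (cinner x u))\<^sup>2)"
      by (intro sum_mono) auto
    also have "\<dots> \<le> (norm x)\<^sup>2" by (rule bessel[OF E F])
    finally show "(\<Sum>u\<in>F. (cmod (if u \<in> G then cinner x u else 0))\<^sup>2) \<le> (1 * norm x)\<^sup>2" by simp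
  qed (auto simp: cinner_simps)
  then have "\<exists>P. P \<in> bounded_ops \<and> (\<forall>x. norm (P x) \<le> norm x) \<and>
     (\<forall>x. \<forall>u\<in>E. cinner (P x) u = (if u \<in> G then cinner x u else 0))"
    by (intro exI[of _ P]) auto
  from someI_ex[OF this] show "proj E G \<in> bounded_ops"
    "norm ((proj E G) x) \<le> norm x"
    "u \<in> E \<Longrightarrow> cinner ((proj E G) x) u = (if u \<in> G then cinner x u else 0)"
    unfolding proj_def[symmetric] by auto
qed

lemma proj_basis:
  assumes E: "orthonormal_basis E" and "u \<in> E"
  shows "(proj E G) u = (if u \<in> G then u else 0)"
  by (rule onb_eqI[OF E]) (use assms in \<open>auto simp: proj_coeff onb_cinner\<close>)

lemma proj_finite:
  assumes E: "orthonormal_basis E" and "finite F" "F \<subseteq> E"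
  shows "(proj E F) x = pr F x"
  by (rule onb_eqI[OF E]) (use assms in \<open>auto simp: proj_coeff pr_coeff\<close>)

lemma proj_proj:
  assumes E: "orthonormal_basis E"
  shows "(proj E G) ((proj E G') x) = (proj E (G \<inter> G')) x"
  by (rule onb_eqI[OF E]) (use assms in \<open>auto simp: proj_coeff\<close>)

lemma op_selfadjoint_onbI:
  assumes E: "orthonormal_basis E" and X: "X \<in> bounded_ops" and Y: "Y \<in> bounded_ops"
    and eq: "\<And>u v. u \<in> E \<Longrightarrow> v \<in> E \<Longrightarrow> cinner (X u) v = cinner u (Y v)"
  shows "cinner (X x) y = cinner x (Y y)"
proof -
  have "x \<in> {x. cinner (X x) v = cinner x (Y v)}" if v: "v \<in> E" for x v
  proof (rule onb_dense_induct[OF E])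
    show "closed {x. cinner (X x) v = cinner x (Y v)}"
      by (intro closed_Collect_eq continuous_intros bounded_bilinear.continuous_on[OF bounded_bilinear_cinner])
  qed (use eq v in \<open>auto simp: csubspace_def cinner_simps blinfun.add_right bounded_ops_scaleC[OF X]\<close>)
  then have *: "cinner (X x) v = cinner x (Y v)" if "v \<in> E" for x v
    using that by simp
  have "y \<in> {y. cinner (X x) y = cinner x (Y y)}"
  proof (rule onb_dense_induct[OF E])
    show "closed {y. cinner (X x) y = cinner x (Y y)}"
      by (intro closed_Collect_eq continuous_intros bounded_bilinear.continuous_on[OF bounded_bilinear_cinner])
  qed (use * in \<open>auto simp: csubspace_def cinner_simps blinfun.add_right bounded_ops_scaleC[OF Y]\<close>)
  then show ?thesis by simp
qed

lemma proj_selfadjoint: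
  assumes E: "orthonormal_basis E"
  shows "cinner ((proj E G) x) y = cinner x ((proj E G) y)"
  by (rule op_selfadjoint_onbI[OF E proj_bounded_ops[OF E] proj_bounded_ops[OF E]])
    (auto simp: proj_basis[OF E] onb_cinner[OF E])

lemma proj_qf:
  assumes E: "orthonormal_basis E"
  shows "qf (proj E G) x = (norm ((proj E G) x))\<^sup>2"
  using proj_selfadjoint[OF E, of G "(proj E G) x" x] proj_proj[OF E, of G G x]
  by (simp add: qf_def flip: Re_cinner_self)

lemma proj_pos:
  assumes E: "orthonormal_basis E"
  shows "op_pos (proj E G)"
  by (intro op_posI proj_bounded_ops[OF E] proj_selfadjoint[OF E]) (simp add: proj_qf[OF E])

lemma proj_complement_qf:
  assumes E: "orthonormal_basis E"
  shows "qf (id_blinfun - proj E G) x = (norm (x - (proj E G) x))\<^sup>2"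
proof -
  let ?p = "(proj E G) x"
  have "cinner (x - ?p) ?p = 0"
    using proj_selfadjoint[OF E, of G x ?p] proj_proj[OF E, of G G x] proj_selfadjoint[OF E, of G ?p x]
    by (simp add: cinner_simps)
  then have "(norm x)\<^sup>2 = (norm (x - ?p))\<^sup>2 + (norm ?p)\<^sup>2"
    using norm_add_sq[of "x - ?p" ?p] by simp
  then show ?thesis by (simp add: qf_simps proj_qf[OF E])
qed

lemma proj_complement_pos:
  assumes E: "orthonormal_basis E"
  shows "op_pos (id_blinfun - proj E G)"
  by (intro op_posI bounded_ops_diff bounded_ops_id proj_bounded_ops[OF E])
    (auto simp: proj_complement_qf[OF E] blinfun.diff_left cinner_simps proj_selfadjoint[OF E])

lemma proj_mono_qf:
  assumes E: "orthonormal_basis E" and "G \<subseteq> G'"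
  shows "qf (proj E G) x \<le> qf (proj E G') x"
proof -
  have "(proj E G) x = (proj E G) ((proj E G') x)"
    using assms by (simp add: proj_proj Int_absorb2)
  then have "norm ((proj E G) x) \<le> norm ((proj E G') x)"
    using proj_norm[OF E] by metis
  then show ?thesis by (simp add: proj_qf[OF E] power_mono)
qed

text \<open>The limit vector has coefficients only in the union, so a finite set approximating it
  may be cut down to the union and is then swallowed by some \<open>F N\<close>. From there on best
  approximation keeps the error small.\<close>

lemma proj_strong_limit:
  fixes F :: "nat \<Rightarrow> 'h::chilbert_space set"
  assumes E: "orthonormal_basis E" and F: "\<And>n. finite (F n)" "\<And>n. F n \<subseteq> E" "incseq F"
  shows "(\<lambda>n. (proj E (F n)) x) \<longlonglongrightarrow> (proj E (\<Union>n. F n)) x"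
proof (rule LIMSEQ_I)
  fix e :: real assume e: "0 < e"
  let ?y = "(proj E (\<Union>n. F n)) x"
  have Fy: "(proj E (F n)) x = pr (F n) ?y" for n
    using proj_proj[OF E, of "F n" "\<Union>n. F n" x] proj_finite[OF E F(1,2)]
    by (simp add: Int_absorb2 UN_upper)
  obtain H where H: "finite H" "H \<subseteq> E" "norm (?y - pr H ?y) < e"
    using onb_approx[OF E e] by metis
  define K where "K = H \<inter> (\<Union>n. F n)"
  have "pr H ?y = pr K ?y"
    unfolding pr_def K_def using H
    by (intro sum.mono_neutral_right) (auto simp: proj_coeff[OF E] subsetD[OF H(2)])
  obtain N where N: "K \<subseteq> F N"
  proof -
    have "finite K" "K \<subseteq> (\<Union>n. F n)" using H by (auto simp: K_def)
    then have "\<exists>N. K \<subseteq> F N"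
    proof (induction K rule: finite_induct)
      case (insert a K)
      then obtain N m where "K \<subseteq> F N" "a \<in> F m" by auto
      then have "insert a K \<subseteq> F (max N m)"
        using F(3) monoD[OF F(3), of N "max N m"] monoD[OF F(3), of m "max N m"] by auto
      then show ?case by blast
    qed auto
    then show thesis using that by auto
  qed
  have "norm ((proj E (F n)) x - ?y) < e" if "n \<ge> N" for n
  proof -
    have "K \<subseteq> F n" using N monoD[OF F(3) that] by auto
    then have "norm (?y - pr (F n) ?y) \<le> norm (?y - pr K ?y)"
      by (intro pr_mono[OF E F(1,2)])
    with H(3) \<open>pr H ?y = pr K ?y\<close> show ?thesis by (simp add: Fy norm_minus_commute)
  qed
  then show "\<exists>N. \<forall>n\<ge>N. norm ((proj E (F n)) x - ?y) < e" by auto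
qed

section \<open>Strong limits\<close>

lemma strong_limit_qf:
  "strong_limit X L F \<Longrightarrow> ((\<lambda>i. qf (X i) x) \<longlongrightarrow> qf L x) F"
  unfolding strong_limit_def qf_def by (intro tendsto_Re tendsto_cinner tendsto_const) auto

lemma strong_limit_unique:
  "F \<noteq> bot \<Longrightarrow> strong_limit X L F \<Longrightarrow> strong_limit X L' F \<Longrightarrow> L = L'"
  unfolding strong_limit_def by (intro blinfun_eqI) (metis tendsto_unique)

lemma strong_limit_pos:
  assumes F: "F \<noteq> bot" and X: "\<forall>\<^sub>F i in F. op_pos (X i)" and L: "L \<in> bounded_ops" "strong_limit X L F"
  shows "op_pos L"
proof (rule op_posI[OF L(1)])
  fix x y
  have "((\<lambda>i. cinner ((X i) x) y) \<longlongrightarrow> cinner (L x) y) F"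
    using L(2) by (intro tendsto_cinner tendsto_const) (auto simp: strong_limit_def)
  moreover have "((\<lambda>i. cinner x ((X i) y)) \<longlongrightarrow> cinner x (L y)) F"
    using L(2) by (intro tendsto_cinner tendsto_const) (auto simp: strong_limit_def)
  then have "((\<lambda>i. cinner ((X i) x) y) \<longlongrightarrow> cinner x (L y)) F"
    by (rule Lim_transform_eventually) (use X in \<open>auto elim!: eventually_mono simp: op_pos_selfadjoint\<close>)
  ultimately show "cinner (L x) y = cinner x (L y)"
    using F tendsto_unique by blast
  show "0 \<le> qf L x"
    by (rule tendsto_lowerbound[OF strong_limit_qf[OF L(2)] _ F])
      (use X in \<open>auto elim!: eventually_mono simp: op_pos_qf\<close>)
qed

lemma strong_limit_exists:
  fixes X :: "'i \<Rightarrow> ('h::chilbert_space \<Rightarrow>\<^sub>L 'h)"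
  assumes F: "F \<noteq> bot" and B: "\<forall>\<^sub>F i in F. X i \<in> bounded_ops"
    and M: "\<forall>\<^sub>F i in F. \<forall>x. norm ((X i) x) \<le> M * norm x"
    and lim: "\<And>x. \<exists>y. ((\<lambda>i. (X i) x) \<longlongrightarrow> y) F"
  shows "\<exists>L\<in>bounded_ops. strong_limit X L F"
proof -
  obtain g where g: "\<And>x. ((\<lambda>i. (X i) x) \<longlongrightarrow> g x) F" using lim by metis
  obtain L where "L \<in> bounded_ops" "blinfun_apply L = g"
  proof (rule bounded_opsE)
    fix x y c
    have "((\<lambda>i. (X i) x + (X i) y) \<longlongrightarrow> g (x + y)) F"
      using g[of "x + y"] by (simp add: blinfun.add_right)
    with tendsto_add[OF g g] show "g (x + y) = g x + g y"
      using F tendsto_unique by blast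
    have "((\<lambda>i. c *\<^sub>C (X i) x) \<longlongrightarrow> g (c *\<^sub>C x)) F"
      by (rule Lim_transform_eventually[OF g])
        (use B in \<open>auto elim!: eventually_mono simp: bounded_ops_scaleC\<close>)
    with tendsto_scaleC[OF g] show "g (c *\<^sub>C x) = c *\<^sub>C g x"
      using F tendsto_unique by blast
    show "norm (g x) \<le> M * norm x"
      by (rule tendsto_upperbound[OF tendsto_norm[OF g] _ F])
        (use M in \<open>auto elim!: eventually_mono\<close>)
  qed blast
  with g show ?thesis by (auto simp: strong_limit_def)
qed

text \<open>Symmetry of the distance allows the hypothesis to order the two parameters, which is the
  form in which a monotone family yields it.\<close>

lemma Cauchy_at_right_0:
  fixes g :: "real \<Rightarrow> 'a::complete_space"
  assumes C: "\<And>e. 0 < e \<Longrightarrow> \<exists>r>0. \<forall>s t. 0 < s \<longrightarrow> s \<le> t \<longrightarrow> t \<le> r \<longrightarrow> dist (g t) (g s) < e"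
  shows "\<exists>l. (g \<longlongrightarrow> l) (at_right 0)"
proof -
  have "cauchy_filter (filtermap g (at_right 0))"
    unfolding cauchy_filter_metric_filtermap
  proof (intro allI impI)
    fix e :: real assume "0 < e"
    then obtain r where r: "0 < r" "\<And>s t. 0 < s \<Longrightarrow> s \<le> t \<Longrightarrow> t \<le> r \<Longrightarrow> dist (g t) (g s) < e"
      using C by blast
    have "dist (g s) (g t) < e" if "0 < s" "s \<le> r" "0 < t" "t \<le> r" for s t
      using r(2)[of s t] r(2)[of t s] that by (cases "s \<le> t") (auto simp: dist_commute)
    then show "\<exists>P. eventually P (at_right 0) \<and> (\<forall>s t. P s \<and> P t \<longrightarrow> dist (g s) (g t) < e)"
      using r(1) by (intro exI[of _ "\<lambda>t. 0 < t \<and> t \<le> r"])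
        (auto simp: eventually_at_right_field intro!: exI[of _ r])
  qed
  moreover have "filtermap g (at_right 0) \<noteq> bot" by (simp add: filtermap_bot_iff)
  ultimately obtain l where "filtermap g (at_right 0) \<le> nhds l"
    using complete_UNIV[where 'a='a] unfolding complete_uniform by (metis UNIV_I principal_UNIV top_greatest)
  then show ?thesis by (auto simp: filterlim_def)
qed

text \<open>Monotone convergence for operators: the quadratic forms converge as decreasing bounded
  numbers, and \<open>op_pos_norm_sq_le\<close> upgrades this to convergence of the vectors.\<close>

lemma decreasing_strong_limit:
  fixes X :: "real \<Rightarrow> ('h::chilbert_space \<Rightarrow>\<^sub>L 'h)"
  assumes X: "\<And>t. 0 < t \<Longrightarrow> op_pos (X t)"
    and dec: "\<And>s t x. 0 < s \<Longrightarrow> s \<le> t \<Longrightarrow> qf (X s) x \<le> qf (X t) x"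
  shows "\<exists>L\<in>bounded_ops. strong_limit X L (at_right 0)"
proof (rule strong_limit_exists)
  define M where "M = norm (X 1)"
  have M: "qf (X t) x \<le> M * (norm x)\<^sup>2" if "0 < t" "t \<le> 1" for t x
    using dec[OF that, of x] qf_le_norm[of "X 1" x] by (simp add: M_def)
  have ev: "\<forall>\<^sub>F t in at_right 0. P t" if "\<And>t. 0 < t \<Longrightarrow> t \<le> 1 \<Longrightarrow> P t" for P :: "real \<Rightarrow> bool"
    unfolding eventually_at_right_field by (intro exI[of _ 1]) (auto intro: that)
  show "\<forall>\<^sub>F t in at_right 0. X t \<in> bounded_ops" by (rule ev) (simp add: op_pos_bounded_ops X)
  show "\<forall>\<^sub>F t in at_right 0. \<forall>x. norm ((X t) x) \<le> M * norm x"
    by (rule ev) (intro allI op_pos_norm_le X M; simp add: M_def)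
  show "\<exists>y. ((\<lambda>t. (X t) x) \<longlongrightarrow> y) (at_right 0)" for x
  proof (rule Cauchy_at_right_0)
    fix e :: real assume e: "0 < e"
    define m where "m = (INF t\<in>{0<..}. qf (X t) x)"
    have bdd: "bdd_below ((\<lambda>t. qf (X t) x) ` {0<..})"
      using X by (auto simp: bdd_below_def intro!: exI[of _ 0] op_pos_qf)
    have m_le: "m \<le> qf (X t) x" if "0 < t" for t
      unfolding m_def using that by (intro cINF_lower bdd) auto
    \<comment> \<open>Chosen so that \<open>M * \<eta> < e\<^sup>2\<close>; the summand 1 covers
      \<open>M = 0\<close>.\<close>
    define \<eta> where "\<eta> = e\<^sup>2 / (M + 1)"
    have "M \<ge> 0" by (simp add: M_def)
    then have eta: "\<eta> > 0" "M * \<eta> < e\<^sup>2" using e by (auto simp: \<eta>_def field_simps)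
    have "\<exists>t\<in>{0<..}. qf (X t) x < m + \<eta>"
      using cINF_less_iff[of "{0::real<..}" "\<lambda>t. qf (X t) x" "m + \<eta>"] bdd eta(1) unfolding m_def by auto
    then obtain t0 where t0: "0 < t0" "qf (X t0) x < m + \<eta>" by auto
    have "dist ((X t) x) ((X s) x) < e"
      if st: "0 < s" "s \<le> t" "t \<le> min t0 1" for s t
    proof -
      have pos: "op_pos (X t - X s)"
        using op_le_iff[OF X[OF st(1)] X[of t]] dec[OF st(1,2)] st by (simp add: op_le_def)
      have bnd: "qf (X t - X s) y \<le> M * (norm y)\<^sup>2" for y
        using M[of t y] op_pos_qf[OF X[OF st(1)], of y] st by (simp add: qf_diff)
      have "(norm ((X t - X s) x))\<^sup>2 \<le> M * qf (X t - X s) x"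
        by (rule op_pos_norm_sq_le[OF pos bnd])
      also have "\<dots> \<le> M * \<eta>"
        using m_le[OF st(1)] dec[of t t0 x] t0(2) st \<open>M \<ge> 0\<close> by (intro mult_left_mono) (auto simp: qf_diff)
      also have "\<dots> < e\<^sup>2" by (rule eta)
      finally have "norm ((X t - X s) x) < e" by (rule power2_less_imp_less) (use e in simp)
      then show ?thesis by (simp add: dist_norm blinfun.diff_left)
    qed
    then show "\<exists>r>0. \<forall>s t. 0 < s \<longrightarrow> s \<le> t \<longrightarrow> t \<le> r \<longrightarrow>
        dist ((X t) x) ((X s) x) < e"
      using t0(1) by (intro exI[of _ "min t0 1"]) auto
  qed
qed simp

section \<open>Operator means\<close>

lemma mean_pos: "operator_mean \<sigma> \<Longrightarrow> op_strictly_pos A \<Longrightarrow> op_strictly_pos B \<Longrightarrow> op_pos (\<sigma> A B)"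
  by (simp add: operator_mean_def op_strictly_pos_pos)

lemma mean_mono:
  assumes "operator_mean \<sigma>" "op_strictly_pos A" "op_strictly_pos B" "op_strictly_pos C" "op_strictly_pos D"
    "\<And>x. qf A x \<le> qf C x" "\<And>x. qf B x \<le> qf D x"
  shows "qf (\<sigma> A B) x \<le> qf (\<sigma> C D) x"
proof -
  have "A \<le>\<^sub>o\<^sub>p C" "B \<le>\<^sub>o\<^sub>p D"
    using assms by (auto simp: op_le_iff op_strictly_pos_pos)
  with assms have "\<sigma> A B \<le>\<^sub>o\<^sub>p \<sigma> C D"
    by (intro assms(1)[unfolded operator_mean_def, THEN conjunct2, THEN conjunct1, rule_format]) auto
  then show ?thesis by (rule op_le_qf)
qed

lemma mean_continuous:
  assumes "operator_mean \<sigma>" "\<And>n. op_strictly_pos (As n)" "\<And>n. op_strictly_pos (Bs n)"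
    "op_strictly_pos A" "op_strictly_pos B"
    "\<And>n x. qf (As (Suc n)) x \<le> qf (As n) x" "\<And>n x. qf (Bs (Suc n)) x \<le> qf (Bs n) x"
    "strong_limit As A sequentially" "strong_limit Bs B sequentially"
  shows "strong_limit (\<lambda>n. \<sigma> (As n) (Bs n)) (\<sigma> A B) sequentially"
proof -
  have "As \<down>\<^sub>o\<^sub>p A" "Bs \<down>\<^sub>o\<^sub>p B"
    using assms by (auto simp: op_decreasing_to_def op_le_iff op_strictly_pos_pos)
  with assms have "(\<lambda>n. \<sigma> (As n) (Bs n)) \<down>\<^sub>o\<^sub>p \<sigma> A B"
    by (intro assms(1)[unfolded operator_mean_def, THEN conjunct2, THEN conjunct2, THEN conjunct1,
        rule_format]) auto
  then show ?thesis by (simp add: op_decreasing_to_def)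
qed

text \<open>By joint monotonicity the shifted means decrease as \<epsilon> decreases, so the limit
  in the definite description exists and lies below each of them.\<close>

lemma mean_ext_limit:
  assumes \<sigma>: "operator_mean \<sigma>" and A: "op_pos A" and B: "op_pos B"
  shows mean_ext_pos: "op_pos (mean_ext \<sigma> A B)"
    and mean_ext_strong_limit: "strong_limit (\<lambda>\<epsilon>::real. \<sigma> (A + \<epsilon> *\<^sub>R id_blinfun) (B + \<epsilon> *\<^sub>R id_blinfun))
      (mean_ext \<sigma> A B) (at_right 0)"
    and mean_ext_le_eps: "0 < \<epsilon> \<Longrightarrow>
      qf (mean_ext \<sigma> A B) x \<le> qf (\<sigma> (A + \<epsilon> *\<^sub>R id_blinfun) (B + \<epsilon> *\<^sub>R id_blinfun)) x"
proof -
  define X where "X \<epsilon> = \<sigma> (A + \<epsilon> *\<^sub>R id_blinfun) (B + \<epsilon> *\<^sub>R id_blinfun)" for \<epsilon> :: real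
  have pos: "op_pos (X t)" if "0 < t" for t
    unfolding X_def using that by (intro mean_pos[OF \<sigma>] op_strictly_pos_add_id A B)
  have dec: "qf (X s) x \<le> qf (X t) x" if "0 < s" "s \<le> t" for s t x
    unfolding X_def using that
    by (intro mean_mono[OF \<sigma>] op_strictly_pos_add_id A B) (auto simp: qf_simps mult_right_mono)
  obtain L where L: "L \<in> bounded_ops" "strong_limit X L (at_right 0)"
    using decreasing_strong_limit[of X] pos dec by blast
  have "mean_ext \<sigma> A B = L"
    unfolding mean_ext_def X_def[symmetric]
    by (rule the_equality) (use L strong_limit_unique[OF trivial_limit_at_right_real, of X] in auto)
  moreover have "op_pos L"
    by (rule strong_limit_pos[OF _ _ L])
      (auto simp: eventually_at_right_field intro!: exI[of _ 1] pos)
  moreover have "qf L x \<le> qf (X \<epsilon>) x" if "0 < \<epsilon>"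
    by (rule tendsto_upperbound[OF strong_limit_qf[OF L(2)]])
      (use that in \<open>auto simp: eventually_at_right_field intro!: exI[of _ \<epsilon>] dec\<close>)
  ultimately show "op_pos (mean_ext \<sigma> A B)"
    "strong_limit (\<lambda>\<epsilon>::real. \<sigma> (A + \<epsilon> *\<^sub>R id_blinfun) (B + \<epsilon> *\<^sub>R id_blinfun)) (mean_ext \<sigma> A B) (at_right 0)"
    "0 < \<epsilon> \<Longrightarrow> qf (mean_ext \<sigma> A B) x \<le> qf (\<sigma> (A + \<epsilon> *\<^sub>R id_blinfun) (B + \<epsilon> *\<^sub>R id_blinfun)) x"
    using L(2) unfolding X_def[symmetric] by auto
qed

lemma mean_ext_mono:
  assumes \<sigma>: "operator_mean \<sigma>" and pos: "op_pos A" "op_pos B" "op_pos C" "op_pos D"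
    and le: "\<And>x. qf A x \<le> qf C x" "\<And>x. qf B x \<le> qf D x"
  shows "qf (mean_ext \<sigma> A B) x \<le> qf (mean_ext \<sigma> C D) x"
proof (rule tendsto_lowerbound[OF strong_limit_qf[OF mean_ext_strong_limit[OF \<sigma> pos(3,4)]]])
  have "qf (mean_ext \<sigma> A B) x \<le> qf (\<sigma> (C + \<epsilon> *\<^sub>R id_blinfun) (D + \<epsilon> *\<^sub>R id_blinfun)) x" if "0 < \<epsilon>" for \<epsilon>
  proof -
    have "qf (mean_ext \<sigma> A B) x \<le> qf (\<sigma> (A + \<epsilon> *\<^sub>R id_blinfun) (B + \<epsilon> *\<^sub>R id_blinfun)) x"
      by (rule mean_ext_le_eps[OF \<sigma> pos(1,2) that])
    also have "\<dots> \<le> qf (\<sigma> (C + \<epsilon> *\<^sub>R id_blinfun) (D + \<epsilon> *\<^sub>R id_blinfun)) x"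
      using le that by (intro mean_mono[OF \<sigma>] op_strictly_pos_add_id pos) (auto simp: qf_simps)
    finally show ?thesis .
  qed
  then show "\<forall>\<^sub>F \<epsilon> in at_right 0. qf (mean_ext \<sigma> A B) x
      \<le> qf (\<sigma> (C + \<epsilon> *\<^sub>R id_blinfun) (D + \<epsilon> *\<^sub>R id_blinfun)) x"
    by (auto simp: eventually_at_right_field intro!: exI[of _ 1])
qed simp

lemma strong_limit_add_inverse:
  "strong_limit (\<lambda>n. X + inverse (real (Suc n)) *\<^sub>R id_blinfun) X sequentially"
  unfolding strong_limit_def
proof
  fix x
  have "(\<lambda>n. X x + inverse (real (Suc n)) *\<^sub>R x) \<longlonglongrightarrow> X x + 0 *\<^sub>R x"
    by (intro tendsto_intros LIMSEQ_inverse_real_of_nat)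
  then show "(\<lambda>n. (X + inverse (real (Suc n)) *\<^sub>R id_blinfun) x) \<longlonglongrightarrow> X x"
    by (simp add: blinfun.add_left blinfun.scaleR_left)
qed

lemma inverse_Suc_decreasing: "inverse (real (Suc (Suc n))) \<le> inverse (real (Suc n))"
  by (intro le_imp_inverse_le) auto

text \<open>Continuity from above is an axiom about sequences with a strictly positive limit. The
  shifts 1/(n+1) of such a pair form a sequence of this kind, and through them its own mean is
  compared with the extended one.\<close>

lemma mean_ext_le_mean:
  assumes \<sigma>: "operator_mean \<sigma>" and pos: "op_pos A" "op_pos B" "op_strictly_pos C" "op_strictly_pos D"
    and le: "\<And>x. qf A x \<le> qf C x" "\<And>x. qf B x \<le> qf D x"
  shows "qf (mean_ext \<sigma> A B) x \<le> qf (\<sigma> C D) x"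
proof -
  note pos' = pos(3,4)[THEN op_strictly_pos_pos]
  let ?e = "\<lambda>n. inverse (real (Suc n))"
  have "strong_limit (\<lambda>n. \<sigma> (C + ?e n *\<^sub>R id_blinfun) (D + ?e n *\<^sub>R id_blinfun)) (\<sigma> C D) sequentially"
    by (intro mean_continuous[OF \<sigma>] op_strictly_pos_add_id pos pos' strong_limit_add_inverse)
      (auto simp: qf_simps intro!: mult_right_mono inverse_Suc_decreasing simp del: of_nat_Suc)
  from strong_limit_qf[OF this] show ?thesis
  proof (rule tendsto_lowerbound)
    have "qf (mean_ext \<sigma> A B) x \<le> qf (\<sigma> (C + ?e n *\<^sub>R id_blinfun) (D + ?e n *\<^sub>R id_blinfun)) x" for n
    proof -
      have "qf (mean_ext \<sigma> A B) x \<le> qf (mean_ext \<sigma> C D) x"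
        by (rule mean_ext_mono[OF \<sigma> pos(1,2) pos' le])
      also have "\<dots> \<le> qf (\<sigma> (C + ?e n *\<^sub>R id_blinfun) (D + ?e n *\<^sub>R id_blinfun)) x"
        by (rule mean_ext_le_eps[OF \<sigma> pos']) simp
      finally show ?thesis .
    qed
    then show "\<forall>\<^sub>F n in sequentially. qf (mean_ext \<sigma> A B) x
        \<le> qf (\<sigma> (C + ?e n *\<^sub>R id_blinfun) (D + ?e n *\<^sub>R id_blinfun)) x"
      by simp
  qed simp
qed

text \<open>Combining the transformer inequality with monotonicity removes the extended mean from it.\<close>

lemma mean_transformer:
  fixes S S' :: "'h::chilbert_space \<Rightarrow>\<^sub>L 'h"
  assumes \<sigma>: "operator_mean \<sigma>"
    and S: "S \<in> bounded_ops" "S' \<in> bounded_ops"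
      "\<And>x y. cinner (S x) y = cinner x (S' y)"
    and pos: "op_strictly_pos A" "op_strictly_pos B" "op_strictly_pos C" "op_strictly_pos D"
    and le: "\<And>x. qf A (S x) \<le> qf C x" "\<And>x. qf B (S x) \<le> qf D x"
  shows "qf (\<sigma> A B) (S x) \<le> qf (\<sigma> C D) x"
proof -
  have S': "cinner (S' x) y = cinner x (S y)" for x y
    using S(3)[of y x] by (metis cinner_commute)
  have q: "qf (S' o\<^sub>L X o\<^sub>L S) x = qf X (S x)" for X x
    by (simp add: qf_def S')
  have p: "op_pos (S' o\<^sub>L X o\<^sub>L S)" if "op_strictly_pos X" for X
  proof -
    have X: "op_pos X" using that by (rule op_strictly_pos_pos)
    show ?thesis
      by (intro op_posI bounded_ops_compose S op_pos_bounded_ops[OF X])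
        (auto simp: q op_pos_qf[OF X] S' S(3) op_pos_selfadjoint[OF X])
  qed
  have "op_adjoint S = S'" by (rule op_adjoint_eqI[OF S(2,3)])
  with S(1) pos(1,2) have "S' o\<^sub>L \<sigma> A B o\<^sub>L S \<le>\<^sub>o\<^sub>p mean_ext \<sigma> (S' o\<^sub>L A o\<^sub>L S) (S' o\<^sub>L B o\<^sub>L S)"
    using \<sigma>[unfolded operator_mean_def, THEN conjunct2, THEN conjunct2, THEN conjunct2,
        THEN conjunct1, rule_format, of S A B] by simp
  then have "qf (\<sigma> A B) (S x) \<le> qf (mean_ext \<sigma> (S' o\<^sub>L A o\<^sub>L S) (S' o\<^sub>L B o\<^sub>L S)) x"
    using op_le_qf[of "S' o\<^sub>L \<sigma> A B o\<^sub>L S"] by (simp add: q)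
  also have "\<dots> \<le> qf (\<sigma> C D) x"
    using le by (intro mean_ext_le_mean[OF \<sigma>] p pos) (auto simp: q)
  finally show ?thesis .
qed

lemma op_strictly_pos_scaleR_id: "0 < t \<Longrightarrow> op_strictly_pos (t *\<^sub>R id_blinfun)"
  by (intro op_strictly_posI[of _ t] op_pos_scaleR op_pos_id) (auto simp: qf_simps)

lemma op_strictly_pos_id: "op_strictly_pos id_blinfun"
  using op_strictly_pos_scaleR_id[of 1] by simp

text \<open>Evaluation at a unit vector turns statements about scalar operators into statements
  about \<open>f\<close>. Continuity of the mean from above becomes continuity from the right, the
  side from which the shifted arguments approach later.\<close>

lemma representing_function_right_continuous:
  fixes \<sigma> :: "'h::chilbert_space op_binary" and e :: 'h
  assumes \<sigma>: "operator_mean \<sigma>" and f: "representing_function \<sigma> f" and t: "0 < t" and e: "norm e = 1"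
  shows "(\<lambda>n. f (t + inverse (real (Suc n)))) \<longlonglongrightarrow> f t"
proof -
  let ?e = "\<lambda>n. inverse (real (Suc n))"
  have tn: "0 < t + ?e n" for n using t by (simp add: add_pos_pos)
  have fq: "qf (\<sigma> id_blinfun (s *\<^sub>R id_blinfun)) e = f s" if "0 < s" for s
    using f that e by (simp add: representing_function_def qf_simps)
  have lim: "strong_limit (\<lambda>n. (t + ?e n) *\<^sub>R id_blinfun) (t *\<^sub>R id_blinfun :: 'h \<Rightarrow>\<^sub>L 'h) sequentially"
    using strong_limit_add_inverse[of "t *\<^sub>R id_blinfun :: 'h \<Rightarrow>\<^sub>L 'h"] by (simp add: scaleR_add_left)
  have id: "strong_limit (\<lambda>n. id_blinfun) (id_blinfun :: 'h \<Rightarrow>\<^sub>L 'h) sequentially"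
    by (simp add: strong_limit_def)
  have "strong_limit (\<lambda>n. \<sigma> id_blinfun ((t + ?e n) *\<^sub>R id_blinfun)) (\<sigma> id_blinfun (t *\<^sub>R id_blinfun)) sequentially"
    using lim id t tn
    by (intro mean_continuous[OF \<sigma>] op_strictly_pos_scaleR_id op_strictly_pos_id)
      (auto simp: qf_simps intro!: mult_right_mono inverse_Suc_decreasing simp del: of_nat_Suc)
  from strong_limit_qf[OF this, of e] show ?thesis using fq t tn by simp
qed

text \<open>If \<open>L\<close> is diagonal on \<open>F\<close>, then so is \<open>I \<sigma> L\<close>, because it commutes with the reflections
  that \<open>L\<close> commutes with.\<close>

lemma mean_id_diagonal:
  fixes E F :: "'h::chilbert_space set"
  assumes E: "orthonormal_basis E" and \<sigma>: "operator_mean \<sigma>" and f: "representing_function \<sigma> f"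
    and F: "finite F" "F \<subseteq> E" and L: "op_strictly_pos L"
    and Lu: "\<And>u. u \<in> F \<Longrightarrow> L u = l u *\<^sub>R u" and l: "\<And>u. u \<in> F \<Longrightarrow> 0 < l u"
  shows "qf (\<sigma> id_blinfun L) (\<Sum>u\<in>F. c u *\<^sub>C u) = (\<Sum>u\<in>F. f (l u) * (cmod (c u))\<^sup>2)"
proof -
  define Q where "Q = \<sigma> id_blinfun L"
  have Lp: "op_pos L" by (rule op_strictly_pos_pos[OF L])
  have Q: "op_pos Q" unfolding Q_def by (intro mean_pos[OF \<sigma>] op_strictly_pos_id L)
  \<comment> \<open>\<open>Q\<close> has no cross terms between \<open>u\<close> and its orthogonal
    complement; adding basis vectors one at a time then computes \<open>Q\<close> on the span of
    \<open>F\<close>.\<close>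
  have orth: "qf Q (c *\<^sub>C u + v) = (cmod c)\<^sup>2 * qf Q u + qf Q v"
    if u: "u \<in> F" and v: "cinner v u = 0" for u v c
  proof -
    have uE: "u \<in> E" using u F by auto
    have uu: "cinner u u = 1" using onb_cinner[OF E uE uE] by simp
    define J where "J = id_blinfun - 2 *\<^sub>R proj E {u}"
    have J: "J x = x - 2 *\<^sub>R cinner x u *\<^sub>C u" for x
      using uE by (simp add: J_def blinfun.diff_left blinfun.scaleR_left proj_finite[OF E] pr_def)
    have JB: "J \<in> bounded_ops" unfolding J_def
      by (intro bounded_ops_diff bounded_ops_id bounded_ops_scaleR proj_bounded_ops[OF E])
    have Jadj: "cinner (J x) y = cinner x (J y)" for x y
      by (simp add: J_def blinfun.diff_left blinfun.scaleR_left cinner_simps proj_selfadjoint[OF E])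
    have JJ: "J (J x) = x" for x
      by (simp add: J cinner_simps uu scaleC_diff_left scaleC_scaleC algebra_simps
          flip: scaleC_of_real) (simp add: scaleC_minus_left)
    \<comment> \<open>An eigenvector of a positive \<open>X\<close> splits off orthogonally, so the
      form of \<open>X\<close> cannot see the sign change along \<open>u\<close>.\<close>
    have qJ: "qf X (J x) = qf X x"
      if X: "op_pos X" and Xu: "X u = k *\<^sub>R u" for X x k
    proof -
      define a where "a = cinner x u"
      have "qf X (x + (- 2 * a) *\<^sub>C u) = qf X x + 2 * Re (cinner (X x) ((- 2 * a) *\<^sub>C u))
          + qf X ((- 2 * a) *\<^sub>C u)"
        by (rule qf_add_arg[OF X])
      also have "cinner (X x) ((- 2 * a) *\<^sub>C u) = - 2 * of_real k * (cnj a * a)"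
        by (simp add: op_pos_selfadjoint[OF X] bounded_ops_scaleC[OF op_pos_bounded_ops[OF X]] Xu
            cinner_simps a_def)
      also have "qf X ((- 2 * a) *\<^sub>C u) = 4 * (cmod a)\<^sup>2 * k"
        by (simp add: qf_scaleC[OF op_pos_bounded_ops[OF X]] norm_mult power_mult_distrib)
          (simp add: qf_def Xu cinner_simps uu)
      also have "Re (- 2 * of_real k * (cnj a * a)) = - 2 * k * (cmod a)\<^sup>2"
        unfolding cmod_power2 by (simp add: power2_eq_square)
      finally have "qf X (x + (- 2 * a) *\<^sub>C u) = qf X x" by simp
      moreover have "J x = x + (- 2 * a) *\<^sub>C u"
        by (simp add: J a_def scaleC_scaleC scaleC_minus_left flip: scaleC_of_real)
      ultimately show ?thesis by simp
    qed
    \<comment> \<open>The transformer inequality with \<open>S = J\<close> applies because both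
      arguments are invariant under \<open>J\<close>; as \<open>J\<close> is an involution, the
      inequality is in fact an equality.\<close>
    have le: "qf Q (J x) \<le> qf Q x" for x
      unfolding Q_def
    proof (rule mean_transformer[OF \<sigma> JB JB Jadj op_strictly_pos_id L op_strictly_pos_id L])
      show "qf id_blinfun (J x) \<le> qf id_blinfun x" for x
        using qJ[OF op_pos_id, of 1 x] by simp
      show "qf L (J x) \<le> qf L x" for x
        using qJ[OF Lp Lu[OF u]] by simp
    qed
    have "qf Q (J x) = qf Q x" for x
      using le[of x] le[of "J x"] by (simp add: JJ)
    moreover have "J (c *\<^sub>C u + v) = v - c *\<^sub>C u"
      by (simp add: J cinner_simps uu v scaleR_2)
    ultimately have "qf Q (c *\<^sub>C u + v) = qf Q (v + - (c *\<^sub>C u))" by (metis add_uminus_conv_diff)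
    \<comment> \<open>Parallelogram law; the two values on the left agree by invariance under
      \<open>J\<close>.\<close>
    moreover have "qf Q (v + c *\<^sub>C u) + qf Q (v + - (c *\<^sub>C u)) = 2 * (qf Q v + qf Q (c *\<^sub>C u))"
      unfolding qf_add_arg[OF Q] qf_minus by (simp add: cinner_simps)
    ultimately show ?thesis
      by (simp add: add.commute qf_scaleC[OF op_pos_bounded_ops[OF Q]])
  qed
  \<comment> \<open>Compression to the line of \<open>u\<close> works in both directions:
    \<open>P L P\<close> lies below \<open>l u\<close> times the identity, which bounds the value
    from above, and \<open>l u\<close> times \<open>P\<close> lies below \<open>L\<close>, which
    bounds it from below.\<close>
  have diag: "qf Q u = f (l u)" if u: "u \<in> F" for u
  proof -
    have uE: "u \<in> E" using u F by auto
    have uu: "cinner u u = 1" using onb_cinner[OF E uE uE] by simp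
    have nu: "norm u = 1" using Re_cinner_self[of u] norm_ge_zero[of u] by (simp add: uu power2_eq_1_iff)
    let ?P = "proj E {u}"
    have P: "?P x = cinner x u *\<^sub>C u" for x
      using uE by (simp add: proj_finite[OF E] pr_def)
    have nP: "(norm (?P x))\<^sup>2 \<le> (norm x)\<^sup>2" for x
      by (intro power_mono proj_norm[OF E]) simp
    have LP: "qf L (?P x) = l u * (norm (?P x))\<^sup>2" for x
      by (simp add: P qf_scaleC[OF op_pos_bounded_ops[OF Lp]] nu)
        (simp add: qf_def Lu[OF u] cinner_simps uu)
    have fq: "qf (\<sigma> id_blinfun (l u *\<^sub>R id_blinfun)) u = f (l u)"
      using f l[OF u] by (simp add: representing_function_def qf_simps nu)
    have Pu: "?P u = u" by (simp add: P uu)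
    have lu: "op_strictly_pos (l u *\<^sub>R id_blinfun :: 'h \<Rightarrow>\<^sub>L 'h)"
      by (rule op_strictly_pos_scaleR_id[OF l[OF u]])
    note tr = mean_transformer[OF \<sigma> proj_bounded_ops[OF E] proj_bounded_ops[OF E] proj_selfadjoint[OF E],
        of id_blinfun _ id_blinfun _ "{u}" u, OF op_strictly_pos_id _ op_strictly_pos_id]
    have "qf (\<sigma> id_blinfun L) (?P u) \<le> qf (\<sigma> id_blinfun (l u *\<^sub>R id_blinfun)) u"
    proof (rule tr[OF L lu])
      show "qf L (?P x) \<le> qf (l u *\<^sub>R id_blinfun) x" for x
        unfolding LP qf_scaleR qf_id using nP[of x] l[OF u] by (intro mult_left_mono) auto
    qed (simp add: nP)
    moreover have "qf (\<sigma> id_blinfun (l u *\<^sub>R id_blinfun)) (?P u) \<le> qf (\<sigma> id_blinfun L) u"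
    proof (rule tr[OF lu L])
      fix x
      let ?v = "x - ?P x"
      have "qf L (?P x + ?v) = qf L (?P x)
          + 2 * Re (cinner (L (?P x)) ?v) + qf L ?v"
        by (rule qf_add_arg[OF Lp])
      also have "cinner (L (?P x)) ?v = 0"
        using cinner_commute[of u x]
        by (simp add: P bounded_ops_scaleC[OF op_pos_bounded_ops[OF Lp]] Lu[OF u] cinner_simps uu)
      finally show "qf (l u *\<^sub>R id_blinfun) (?P x) \<le> qf L x"
        using op_pos_qf[OF Lp, of ?v] by (simp add: LP qf_simps)
    qed (simp add: nP)
    ultimately show ?thesis by (simp add: Pu fq Q_def)
  qed
  have "qf Q (\<Sum>u\<in>G. c u *\<^sub>C u) = (\<Sum>u\<in>G. f (l u) * (cmod (c u))\<^sup>2)" if "G \<subseteq> F" for G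
    using finite_subset[OF that F(1)] that
  proof (induction G rule: finite_induct)
    case empty
    show ?case by (simp add: qf_def)
  next
    case (insert u G)
    have "cinner (\<Sum>u\<in>G. c u *\<^sub>C u) u = 0"
      using insert F by (subst onb_coeff[OF E]) auto
    then show ?case using insert by (simp add: orth diag)
  qed
  then show ?thesis by (simp add: Q_def)
qed

section \<open>Simultaneous diagonalization\<close>

lemma mult_mat_vec_index:
  "A \<in> carrier_mat nr nc \<Longrightarrow> v \<in> carrier_vec nc \<Longrightarrow> i < nr \<Longrightarrow>
    vec_index (A *\<^sub>v v) i = (\<Sum>j<nc. A $$ (i, j) * vec_index v j)"
  by (auto simp: mult_mat_vec_def Matrix.scalar_prod_def atLeast0LessThan intro!: sum.cong)

text \<open>The vector is an eigenvector of the matrix A^(-1) C, which exists over the complex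
  numbers; injectivity of \<open>a\<close> provides the inverse. An enumeration of the index set
  carries the pencil to matrices.\<close>

lemma pencil_eigenvector:
  fixes a c :: "'i \<Rightarrow> 'i \<Rightarrow> complex"
  assumes I: "finite I" "I \<noteq> {}"
    and inj: "\<And>x. (\<And>p. p \<in> I \<Longrightarrow> (\<Sum>q\<in>I. a p q * x q) = 0) \<Longrightarrow> \<forall>q\<in>I. x q = 0"
  obtains z x where "\<exists>q\<in>I. x q \<noteq> 0"
    "\<And>p. p \<in> I \<Longrightarrow> (\<Sum>q\<in>I. c p q * x q) = z * (\<Sum>q\<in>I. a p q * x q)"
proof -
  define n where "n = card I"
  have n: "n > 0" using I by (auto simp: n_def card_gt_0_iff)
  obtain h where h: "bij_betw h {..<n} I"
    using ex_bij_betw_nat_finite[OF I(1)] by (auto simp: n_def atLeast0LessThan)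
  define A where "A = Matrix.mat n n (\<lambda>(i, j). a (h i) (h j))"
  define C where "C = Matrix.mat n n (\<lambda>(i, j). c (h i) (h j))"
  have A: "A \<in> carrier_mat n n" and C: "C \<in> carrier_mat n n" by (auto simp: A_def C_def)
  define X where "X v q = vec_index v (inv_into {..<n} h q)" for v :: "complex Matrix.vec" and q
  have hI: "h i \<in> I" if "i < n" for i using h that by (auto simp: bij_betw_def)
  have inv_h: "inv_into {..<n} h (h i) = i" if "i < n" for i
    using h that by (auto simp: bij_betw_def)
  have sum_I: "(\<Sum>q\<in>I. g q) = (\<Sum>j<n. g (h j))" for g :: "'i \<Rightarrow> complex"
    by (rule sum.reindex_bij_betw[OF h, symmetric])
  have Av: "vec_index (A *\<^sub>v v) i = (\<Sum>q\<in>I. a (h i) q * X v q)"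
    and Cv: "vec_index (C *\<^sub>v v) i = (\<Sum>q\<in>I. c (h i) q * X v q)" if "v \<in> carrier_vec n" "i < n" for v i
    using that unfolding sum_I mult_mat_vec_index[OF A that] mult_mat_vec_index[OF C that]
    by (auto simp: A_def C_def X_def inv_h intro!: sum.cong)
  have nz: "\<exists>q\<in>I. X v q \<noteq> 0" if "v \<in> carrier_vec n" "v \<noteq> 0\<^sub>v n" for v
  proof -
    obtain i where i: "i < n" "vec_index v i \<noteq> 0" using \<open>v \<noteq> 0\<^sub>v n\<close> \<open>v \<in> carrier_vec n\<close>
      by (metis eq_vecI carrier_vecD index_zero_vec)
    then show ?thesis using hI inv_h by (intro bexI[of _ "h i"]) (auto simp: X_def)
  qed
  have "Determinant.det A \<noteq> 0"
  proof
    assume "Determinant.det A = 0"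
    then obtain v where v: "v \<in> carrier_vec n" "v \<noteq> 0\<^sub>v n" "A *\<^sub>v v = 0\<^sub>v n"
      using det_0_iff_vec_prod_zero[OF A] by auto
    have "(\<Sum>q\<in>I. a p q * X v q) = 0" if p: "p \<in> I" for p
    proof -
      obtain i where "i < n" "p = h i" using h p by (auto simp: bij_betw_def)
      then show ?thesis using Av[OF v(1), of i] v(3) by simp
    qed
    from inj[OF this] nz[OF v(1,2)] show False by blast
  qed
  then have "A \<in> Units (ring_mat TYPE(complex) n ())" by (rule det_non_zero_imp_unit[OF A])
  then obtain B where B: "B \<in> carrier_mat n n" "A * B = 1\<^sub>m n" by (auto simp: Units_def ring_mat_def)
  have "spectrum (B * C) \<noteq> {}" by (rule spectrum_non_empty) (use B C n in auto)
  then obtain z v where v: "v \<in> carrier_vec n" "v \<noteq> 0\<^sub>v n" and eq: "(B * C) *\<^sub>v v = z \<cdot>\<^sub>v v"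
    using B C by (auto simp: spectrum_def eigenvalue_def eigenvector_def)
  have "C *\<^sub>v v = (A * B) *\<^sub>v (C *\<^sub>v v)" using C v(1) by (simp add: B(2))
  also have "\<dots> = A *\<^sub>v (B *\<^sub>v (C *\<^sub>v v))" using A B(1) C v(1) by (intro assoc_mult_mat_vec) auto
  also have "B *\<^sub>v (C *\<^sub>v v) = z \<cdot>\<^sub>v v"
    using assoc_mult_mat_vec[OF B(1) C v(1)] eq by simp
  also have "A *\<^sub>v (z \<cdot>\<^sub>v v) = z \<cdot>\<^sub>v (A *\<^sub>v v)" using A v(1) by (rule mult_mat_vec)
  finally have CA: "C *\<^sub>v v = z \<cdot>\<^sub>v (A *\<^sub>v v)" .
  show thesis
  proof (rule that[of "X v" z])
    show "\<exists>q\<in>I. X v q \<noteq> 0" by (rule nz[OF v])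
    fix p assume "p \<in> I"
    then obtain i where i: "i < n" "p = h i" using h by (auto simp: bij_betw_def)
    have "vec_index (C *\<^sub>v v) i = z * vec_index (A *\<^sub>v v) i"
      unfolding CA using A i by simp
    then show "(\<Sum>q\<in>I. c p q * X v q) = z * (\<Sum>q\<in>I. a p q * X v q)"
      using Av[OF v(1) i(1)] Cv[OF v(1) i(1)] i(2) by simp
  qed
qed

lemma csubspace_orthogonal:
  assumes "X \<in> bounded_ops"
  shows "csubspace {y. cinner (X y) v = 0}"
  using assms by (auto simp: csubspace_def blinfun.add_right bounded_ops_scaleC cinner_simps)

lemma csubspace_Int: "csubspace V \<Longrightarrow> csubspace W \<Longrightarrow> csubspace (V \<inter> W)"
  by (auto simp: csubspace_def)

text \<open>Induction on the index set: a generalized eigenvector \<open>v\<close> of the pencil of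
  \<open>A\<close> and \<open>C\<close> is split off, the remaining vectors are made orthogonal to
  it for the form of \<open>A\<close>, and orthogonality for \<open>C\<close> follows from the
  eigenvalue equation. Equality of the spans is expressed by saying that the same subspaces contain
  both families.\<close>

lemma simultaneous_diagonalization_family:
  fixes A C :: "'h::chilbert_space \<Rightarrow>\<^sub>L 'h"
  assumes A: "op_pos A" "\<And>x. x \<noteq> 0 \<Longrightarrow> 0 < qf A x" and C: "op_pos C" and I: "finite I"
    and ind: "\<forall>x. (\<Sum>i\<in>I. x i *\<^sub>C b i) = 0 \<longrightarrow> (\<forall>i\<in>I. x i = 0)"
  shows "\<exists>r. (\<forall>i\<in>I. qf A (r i) = 1) \<and>
    (\<forall>i\<in>I. \<forall>j\<in>I. i \<noteq> j \<longrightarrow>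
       cinner (A (r i)) (r j) = 0 \<and> cinner (C (r i)) (r j) = 0) \<and>
    (\<forall>V. csubspace V \<longrightarrow> b ` I \<subseteq> V \<longleftrightarrow> r ` I \<subseteq> V)"
  using I ind
proof (induction I arbitrary: b rule: finite_psubset_induct)
  case (psubset I)
  note AB = op_pos_bounded_ops[OF A(1)] and CB = op_pos_bounded_ops[OF C]
  show ?case
  proof (cases "I = {}")
    case False
    have inj: "\<forall>q\<in>I. x q = 0"
      if x: "\<And>p. p \<in> I \<Longrightarrow> (\<Sum>q\<in>I. cinner (A (b q)) (b p) * x q) = 0" for x
    proof -
      define v where "v = (\<Sum>q\<in>I. x q *\<^sub>C b q)"
      have "cinner (A v) (b p) = 0" if "p \<in> I" for p
        using x[OF that] by (simp add: v_def bounded_ops_sum[OF AB] cinner_sum_left cinner_simps mult.commute)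
      then have "cinner (A v) v = 0"
        by (subst (2) v_def) (simp add: cinner_sum_right cinner_simps)
      then have "v = 0" using A(2)[of v] by (cases "v = 0") (auto simp: qf_def)
      then show ?thesis using psubset.prems unfolding v_def by blast
    qed
    obtain z x where x: "\<exists>q\<in>I. x q \<noteq> 0" and eq: "\<And>p. p \<in> I \<Longrightarrow>
        (\<Sum>q\<in>I. cinner (C (b q)) (b p) * x q) =
        z * (\<Sum>q\<in>I. cinner (A (b q)) (b p) * x q)"
    proof (rule pencil_eigenvector[OF psubset.hyps False, of "\<lambda>p q. cinner (A (b q)) (b p)"
          "\<lambda>p q. cinner (C (b q)) (b p)"], goal_cases)
      case (1 x)
      show ?case by (rule inj) (rule 1(2))
    next
      case (2 z x)
      show ?case by (rule 2(1)[OF 2(2) 2(3)])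
    qed
    define v where "v = (\<Sum>q\<in>I. x q *\<^sub>C b q)"
    have v0: "v \<noteq> 0" using x psubset.prems unfolding v_def by blast
    then have qv: "qf A v > 0" by (rule A(2))
    have Cv: "cinner (C v) (b p) = z * cinner (A v) (b p)" if "p \<in> I" for p
      using eq[OF that]
      by (simp add: v_def bounded_ops_sum[OF AB] bounded_ops_sum[OF CB] cinner_sum_left cinner_simps mult.commute)
    \<comment> \<open>Since \<open>x j\<close> is nonzero, \<open>v\<close> can replace
      \<open>b j\<close> without changing the span; the induction runs on the other indices.\<close>
    obtain j where j: "j \<in> I" "x j \<noteq> 0" using x by auto
    \<comment> \<open>The Gram-Schmidt coefficient for the inner product given by
      \<open>A\<close>.\<close>
    define k where "k i = cinner (A (b i)) v / cinner (A v) v" for i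
    have Avv: "cinner (A v) v \<noteq> 0" using qv by (auto simp: qf_def)
    define b' where "b' i = b i - k i *\<^sub>C v" for i
    have bA: "cinner (A (b' i)) v = 0" for i
      using Avv by (simp add: b'_def k_def blinfun.diff_right bounded_ops_scaleC[OF AB] cinner_simps)
    \<comment> \<open>The eigenvalue equation is known against the \<open>b p\<close> only. The
      vectors satisfying it form a subspace, so it extends to the span, which contains the
      \<open>b' i\<close>.\<close>
    have Cvb: "cinner (C v) y = z * cinner (A v) y"
      if y: "\<And>V. csubspace V \<Longrightarrow> b ` I \<subseteq> V \<Longrightarrow> y \<in> V" for y
    proof -
      have "csubspace {y. cinner (C v) y = z * cinner (A v) y}"
        by (auto simp: csubspace_def cinner_simps algebra_simps)
      from y[OF this] Cv show ?thesis by auto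
    qed
    have b'V: "b' i \<in> V" if "csubspace V" "b ` I \<subseteq> V" "i \<in> I" for i V
    proof -
      have "v \<in> V" unfolding v_def using that by (intro csubspace_sum) auto
      then show ?thesis unfolding b'_def using that
        by (intro csubspace_diff) (auto simp: csubspace_def)
    qed
    have bC: "cinner (C (b' i)) v = 0" if i: "i \<in> I" for i
    proof -
      have "cinner (C v) (b' i) = z * cinner (A v) (b' i)"
        by (rule Cvb) (use b'V i in auto)
      moreover have "cinner (A v) (b' i) = 0"
        using bA[of i] op_pos_selfadjoint[OF A(1), of v "b' i"] cinner_commute[of v] by simp
      ultimately show ?thesis
        using op_pos_selfadjoint[OF C, of v "b' i"] cinner_commute[of "C (b' i)" v] by simp
    qed
    let ?J = "I - {j}"
    have ind': "\<forall>y. (\<Sum>i\<in>?J. y i *\<^sub>C b' i) = 0 \<longrightarrow> (\<forall>i\<in>?J. y i = 0)"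
    proof (intro allI impI)
      fix y assume y: "(\<Sum>i\<in>?J. y i *\<^sub>C b' i) = 0"
      \<comment> \<open>\<open>t\<close> collects the multiples of \<open>v\<close> subtracted in
        the \<open>b' i\<close>. Rewriting the relation in terms of the \<open>b i\<close> gives the
        coefficients \<open>y'\<close>, whose entry at \<open>j\<close> is \<open>- t * x j\<close>,
        and this forces \<open>t = 0\<close>.\<close>
      define t where "t = (\<Sum>i\<in>?J. y i * k i)"
      define y' where "y' i = (if i = j then 0 else y i) - t * x i" for i
      have "(\<Sum>i\<in>I. (if i = j then 0 else y i) *\<^sub>C b i) = (\<Sum>i\<in>?J. y i *\<^sub>C b i)"
        using psubset.hyps by (intro sum.mono_neutral_cong_right) auto
      also have "\<dots> = (\<Sum>i\<in>?J. y i *\<^sub>C b' i) + t *\<^sub>C v"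
        by (simp add: b'_def t_def scaleC_diff_right sum_subtractf scaleC_sum_left scaleC_scaleC)
      finally have "(\<Sum>i\<in>I. y' i *\<^sub>C b i) = 0"
        using y by (simp add: y'_def scaleC_diff_left sum_subtractf v_def scaleC_sum_right scaleC_scaleC)
      then have y': "\<forall>i\<in>I. y' i = 0" using psubset.prems by blast
      have t: "t = 0" using bspec[OF y' j(1)] j(2) by (simp add: y'_def)
      show "\<forall>i\<in>?J. y i = 0"
      proof
        fix i assume i: "i \<in> ?J"
        then have "y' i = 0" using y' by auto
        then show "y i = 0" using i t by (simp add: y'_def)
      qed
    qed
    have "?J \<subset> I" using j by auto
    from psubset.IH[OF this ind'] obtain r where
      "\<forall>i\<in>?J. qf A (r i) = 1" and
      r2': "\<forall>i\<in>?J. \<forall>l\<in>?J. i \<noteq> l \<longrightarrow>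
        cinner (A (r i)) (r l) = 0 \<and> cinner (C (r i)) (r l) = 0" and
      "\<forall>V. csubspace V \<longrightarrow> b' ` ?J \<subseteq> V \<longleftrightarrow> r ` ?J \<subseteq> V"
      by (elim exE conjE) (rule that)
    then have r1: "\<And>i. i \<in> ?J \<Longrightarrow> qf A (r i) = 1"
      and r3: "\<And>V. csubspace V \<Longrightarrow> b' ` ?J \<subseteq> V \<longleftrightarrow> r ` ?J \<subseteq> V" by auto
    have r2: "cinner (A (r i)) (r l) = 0 \<and> cinner (C (r i)) (r l) = 0"
      if "i \<in> ?J" "l \<in> ?J" "i \<noteq> l" for i l
      using r2' that by blast
    define s where "s i = (if i = j then (1 / sqrt (qf A v)) *\<^sub>R v else r i)" for i
    have sc: "s j = complex_of_real (1 / sqrt (qf A v)) *\<^sub>C v"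
      by (simp only: s_def scaleC_of_real if_True refl)
    have "csubspace ({y. cinner (A y) v = 0} \<inter> {y. cinner (C y) v = 0})"
      by (intro csubspace_Int csubspace_orthogonal AB CB)
    from r3[OF this] have rv: "cinner (A (r i)) v = 0" "cinner (C (r i)) v = 0"
      if "i \<in> ?J" for i
      using bA bC that by auto
    have vr: "cinner (X v) (r i) = 0"
      if "op_pos X" "cinner (X (r i)) v = 0" for X i
      using that op_pos_selfadjoint[of X v "r i"] cinner_commute[of v] by simp
    show ?thesis
    proof (intro exI[of _ s] conjI ballI allI impI)
      fix i assume i: "i \<in> I"
      show "qf A (s i) = 1"
      proof (cases "i = j")
        case True
        have "qf A (s j) = (1 / sqrt (qf A v))\<^sup>2 * qf A v"
          unfolding sc qf_scaleC[OF AB] by (simp add: norm_divide power_divide)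
        also have "\<dots> = 1" using qv by (simp add: power_divide)
        finally show ?thesis using True by simp
      qed (use r1 i in \<open>auto simp: s_def\<close>)
      fix l assume l: "l \<in> I" "i \<noteq> l"
      show "cinner (A (s i)) (s l) = 0"
        using l i r2[of i l] rv[of i] rv[of l] vr[OF A(1), of l]
        by (auto simp: s_def blinfun.scaleR_right cinner_simps)
      show "cinner (C (s i)) (s l) = 0"
        using l i r2[of i l] rv[of i] rv[of l] vr[OF C, of l]
        by (auto simp: s_def blinfun.scaleR_right cinner_simps)
    next
      fix V :: "'h set" assume V: "csubspace V"
      have sV: "c *\<^sub>C y \<in> V" if "y \<in> V" for c y using V that by (auto simp: csubspace_def)
      show "b ` I \<subseteq> V \<longleftrightarrow> s ` I \<subseteq> V"
      proof
        assume bV: "b ` I \<subseteq> V"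
        have "v \<in> V" unfolding v_def using bV V by (intro csubspace_sum) auto
        then have "s j \<in> V" unfolding sc by (rule sV)
        moreover have "r ` ?J \<subseteq> V" using r3[OF V] b'V[OF V bV] by auto
        ultimately show "s ` I \<subseteq> V" by (auto simp: s_def)
      next
        assume SV: "s ` I \<subseteq> V"
        then have "s j \<in> V" using j by auto
        then have "complex_of_real (sqrt (qf A v)) *\<^sub>C s j \<in> V" by (rule sV)
        moreover have "complex_of_real (sqrt (qf A v)) *\<^sub>C s j = v"
          unfolding sc scaleC_scaleC using qv by (simp flip: of_real_mult)
        ultimately have vV: "v \<in> V" by simp
        have "r ` ?J \<subseteq> V"
        proof
          fix y assume "y \<in> r ` ?J"
          then obtain i where "i \<in> ?J" "y = r i" by auto
          then have "y = s i" "i \<in> I" by (auto simp: s_def)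
          then show "y \<in> V" using SV by auto
        qed
        then have b'JV: "b' ` ?J \<subseteq> V" using r3[OF V] by simp
        have biV: "b i \<in> V" if "i \<in> ?J" for i
        proof -
          have "b' i + k i *\<^sub>C v \<in> V"
            using V b'JV that sV[OF vV, of "k i"] by (auto simp: csubspace_def)
          then show ?thesis by (simp add: b'_def)
        qed
        \<comment> \<open>The exchange is reversed: \<open>b j\<close> is recovered from
          \<open>v\<close> and the other vectors by dividing by \<open>x j\<close>.\<close>
        have "v = x j *\<^sub>C b j + (\<Sum>i\<in>?J. x i *\<^sub>C b i)"
          unfolding v_def by (rule sum.remove[OF psubset.hyps j(1)])
        then have "x j *\<^sub>C b j = v - (\<Sum>i\<in>?J. x i *\<^sub>C b i)" by simp
        also have "\<dots> \<in> V" using V vV biV by (intro csubspace_diff csubspace_sum) auto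
        finally have "inverse (x j) *\<^sub>C x j *\<^sub>C b j \<in> V" by (rule sV)
        then have "b j \<in> V" using j(2) by (simp add: scaleC_scaleC)
        with biV show "b ` I \<subseteq> V" by auto
      qed
    qed
  qed auto
qed

text \<open>The vectors \<open>A (r i)\<close> act as coordinate functionals for the basis
  \<open>r\<close> of the section. The vectors satisfying the expansion formula form a subspace, so
  it passes from the \<open>r i\<close> to \<open>F\<close> and on to the range of
  \<open>pr F\<close>.\<close>

lemma simultaneous_diagonalization:
  fixes A C :: "'h::chilbert_space \<Rightarrow>\<^sub>L 'h"
  assumes E: "orthonormal_basis E" and F: "finite F" "F \<subseteq> E"
    and A: "op_pos A" "\<And>x. x \<noteq> 0 \<Longrightarrow> 0 < qf A x" and C: "op_pos C"
  obtains r where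
    "\<And>i j. i \<in> F \<Longrightarrow> j \<in> F \<Longrightarrow> cinner (A (r i)) (r j) = (if i = j then 1 else 0)"
    "\<And>i j. i \<in> F \<Longrightarrow> j \<in> F \<Longrightarrow>
      cinner (C (r i)) (r j) = (if i = j then complex_of_real (qf C (r i)) else 0)"
    "\<And>i. i \<in> F \<Longrightarrow> pr F (r i) = r i"
    "\<And>x. pr F x = x \<Longrightarrow> x = (\<Sum>i\<in>F. cinner x (A (r i)) *\<^sub>C r i)"
proof -
  have "\<exists>r. (\<forall>i\<in>F. qf A (r i) = 1) \<and>
    (\<forall>i\<in>F. \<forall>j\<in>F. i \<noteq> j \<longrightarrow>
       cinner (A (r i)) (r j) = 0 \<and> cinner (C (r i)) (r j) = 0) \<and>
    (\<forall>V. csubspace V \<longrightarrow> (\<lambda>u. u) ` F \<subseteq> V \<longleftrightarrow> r ` F \<subseteq> V)"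
  proof (rule simultaneous_diagonalization_family[OF A(1) _ C F(1)])
    show "\<forall>x. (\<Sum>i\<in>F. x i *\<^sub>C i) = 0 \<longrightarrow> (\<forall>i\<in>F. x i = 0)"
    proof (intro allI impI ballI)
      fix x i assume x: "(\<Sum>i\<in>F. x i *\<^sub>C i) = 0" and "i \<in> F"
      then have "cinner (\<Sum>i\<in>F. x i *\<^sub>C i) i = x i" using F by (subst onb_coeff[OF E F]) auto
      then show "x i = 0" by (simp add: x)
    qed
  qed (rule A(2))
  then obtain r where "\<forall>i\<in>F. qf A (r i) = 1"
    and r2': "\<forall>i\<in>F. \<forall>j\<in>F. i \<noteq> j \<longrightarrow>
       cinner (A (r i)) (r j) = 0 \<and> cinner (C (r i)) (r j) = 0"
    and "\<forall>V. csubspace V \<longrightarrow> (\<lambda>u. u) ` F \<subseteq> V \<longleftrightarrow> r ` F \<subseteq> V"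
    by (elim exE conjE) (rule that)
  then have r1: "\<And>i. i \<in> F \<Longrightarrow> qf A (r i) = 1"
    and r3: "\<And>V. csubspace V \<Longrightarrow> F \<subseteq> V \<longleftrightarrow> r ` F \<subseteq> V" by auto
  have r2: "cinner (A (r i)) (r j) = 0 \<and> cinner (C (r i)) (r j) = 0"
    if "i \<in> F" "j \<in> F" "i \<noteq> j" for i j
    using r2' that by blast
  have diag: "cinner (X x) x = complex_of_real (qf X x)" if "op_pos X" for X and x :: 'h
    using that by (auto simp: op_pos_def less_eq_complex_def qf_def complex_eq_iff)
  have A_ij: "cinner (A (r i)) (r j) = (if i = j then 1 else 0)" if "i \<in> F" "j \<in> F" for i j
    using that r1 r2 diag[OF A(1)] by auto
  have pr_add: "pr F (x + y) = pr F x + pr F y" "pr F (c *\<^sub>C x) = c *\<^sub>C pr F x" for x y c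
    by (simp_all add: pr_def cinner_simps scaleC_add_left sum.distrib scaleC_sum_right scaleC_scaleC)
  show thesis
  proof (rule that)
    fix i assume i: "i \<in> F"
    have "csubspace {x. pr F x = x}"
      by (auto simp: csubspace_def pr_add) (simp add: pr_def)
    moreover have "F \<subseteq> {x. pr F x = x}"
    proof
      fix u assume u: "u \<in> F"
      then have uE: "u \<in> E" using F by auto
      have "pr F u = u" using proj_basis[OF E uE, of F] proj_finite[OF E F, of u] u by simp
      then show "u \<in> {x. pr F x = x}" by simp
    qed
    ultimately show "pr F (r i) = r i" using r3 i by auto
  next
    fix x assume x: "pr F x = x"
    let ?V = "{x. x = (\<Sum>i\<in>F. cinner x (A (r i)) *\<^sub>C r i)}"
    have V: "csubspace ?V" unfolding csubspace_def
    proof (intro conjI ballI allI)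
      fix x y c assume "x \<in> ?V" "y \<in> ?V"
      then have xy: "(\<Sum>i\<in>F. cinner x (A (r i)) *\<^sub>C r i) = x"
        "(\<Sum>i\<in>F. cinner y (A (r i)) *\<^sub>C r i) = y" by auto
      show "x + y \<in> ?V"
        by (simp add: cinner_simps scaleC_add_left sum.distrib xy)
      have "(\<Sum>i\<in>F. cinner (c *\<^sub>C x) (A (r i)) *\<^sub>C r i)
          = c *\<^sub>C (\<Sum>i\<in>F. cinner x (A (r i)) *\<^sub>C r i)"
        by (simp add: cinner_simps scaleC_sum_right scaleC_scaleC)
      then show "c *\<^sub>C x \<in> ?V" by (simp add: xy)
    qed simp
    have "r ` F \<subseteq> ?V"
    proof safe
      fix j assume j: "j \<in> F"
      have "(\<Sum>i\<in>F. cinner (r j) (A (r i)) *\<^sub>C r i) = (\<Sum>i\<in>F. if i = j then r i else 0)"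
        using j A_ij by (intro sum.cong) (auto simp: op_pos_selfadjoint[OF A(1), symmetric])
      then show "r j = (\<Sum>i\<in>F. cinner (r j) (A (r i)) *\<^sub>C r i)" using F(1) j by simp
    qed
    then have "F \<subseteq> ?V" using r3[OF V] by simp
    then have "pr F x \<in> ?V" unfolding pr_def by (intro csubspace_sum[OF V]) auto
    then show "x = (\<Sum>i\<in>F. cinner x (A (r i)) *\<^sub>C r i)" using x by simp
  qed (use A_ij r2 diag[OF C] in auto)
qed

section \<open>A Jensen inequality for operator monotone functions\<close>

lemma sum_gram:
  fixes v :: "'i \<Rightarrow> 'k \<Rightarrow> complex"
  shows "complex_of_real (\<Sum>k\<in>K. N k * (cmod (\<Sum>i\<in>I. x i * v i k))\<^sup>2) =
    (\<Sum>i\<in>I. \<Sum>j\<in>I. x i * cnj (x j) * (\<Sum>k\<in>K. of_real (N k) * v i k * cnj (v j k)))"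
proof -
  have "complex_of_real (N k * (cmod (\<Sum>i\<in>I. x i * v i k))\<^sup>2) =
      (\<Sum>i\<in>I. \<Sum>j\<in>I. x i * cnj (x j) * (of_real (N k) * v i k * cnj (v j k)))" for k
    unfolding of_real_mult complex_norm_square cnj_sum sum_product
    unfolding sum_distrib_left by (simp add: mult_ac)
  then have "complex_of_real (\<Sum>k\<in>K. N k * (cmod (\<Sum>i\<in>I. x i * v i k))\<^sup>2) =
      (\<Sum>k\<in>K. \<Sum>i\<in>I. \<Sum>j\<in>I. x i * cnj (x j) * (of_real (N k) * v i k * cnj (v j k)))"
    by (simp del: of_real_mult of_real_power)
  also have "\<dots> = (\<Sum>i\<in>I. \<Sum>k\<in>K. \<Sum>j\<in>I. x i * cnj (x j) * (of_real (N k) * v i k * cnj (v j k)))"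
    by (rule sum.swap)
  also have "\<dots> = (\<Sum>i\<in>I. \<Sum>j\<in>I. \<Sum>k\<in>K. x i * cnj (x j) * (of_real (N k) * v i k * cnj (v j k)))"
    by (intro sum.cong refl sum.swap)
  finally show ?thesis by (simp only: sum_distrib_left)
qed

lemma sum_gram_diagonal:
  fixes v :: "'i \<Rightarrow> 'k \<Rightarrow> complex"
  assumes I: "finite I"
    and d: "\<And>i j. i \<in> I \<Longrightarrow> j \<in> I \<Longrightarrow>
      (\<Sum>k\<in>K. of_real (N k) * v i k * cnj (v j k)) = (if i = j then complex_of_real (l i) else 0)"
  shows "(\<Sum>k\<in>K. N k * (cmod (\<Sum>i\<in>I. x i * v i k))\<^sup>2) = (\<Sum>i\<in>I. l i * (cmod (x i))\<^sup>2)"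
proof -
  have "complex_of_real (\<Sum>k\<in>K. N k * (cmod (\<Sum>i\<in>I. x i * v i k))\<^sup>2) =
      (\<Sum>i\<in>I. \<Sum>j\<in>I. if i = j then x i * cnj (x j) * of_real (l i) else 0)"
    unfolding sum_gram using d by (intro sum.cong) auto
  also have "\<dots> = (\<Sum>i\<in>I. x i * cnj (x i) * of_real (l i))"
    using I by (intro sum.cong) auto
  also have "\<dots> = complex_of_real (\<Sum>i\<in>I. l i * (cmod (x i))\<^sup>2)"
    by (simp only: of_real_sum of_real_mult complex_norm_square mult_ac)
  finally show ?thesis by (simp only: of_real_eq_iff)
qed

lemma mat_adjoint_index:
  fixes A :: "complex mat"
  shows "mat_adjoint A = Matrix.mat (dim_col A) (dim_row A) (\<lambda>(i, j). cnj (A $$ (j, i)))"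
  by (rule eq_matI) (auto simp: mat_adjoint_def mat_of_rows_def conjugate_complex_def)

lemma mult_mat_zero_vec:
  fixes A :: "complex mat"
  assumes "A \<in> carrier_mat nr nc"
  shows "A *\<^sub>v 0\<^sub>v nc = 0\<^sub>v nr"
  by (rule eq_vecI) (use assms in \<open>auto simp: mult_mat_vec_index[OF assms]\<close>)

lemma spectral_quadratic_form:
  fixes W :: "complex mat"
  assumes W: "W \<in> carrier_mat n n" and w: "w \<in> carrier_vec n"
  shows "((W * mat_diag n (\<lambda>i. complex_of_real (g i)) * mat_adjoint W) *\<^sub>v w) \<bullet>c w =
    complex_of_real (\<Sum>k<n. g k * (cmod (vec_index (mat_adjoint W *\<^sub>v w) k))\<^sup>2)"
proof -
  let ?D = "mat_diag n (\<lambda>i. complex_of_real (g i))"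
  define u where "u = mat_adjoint W *\<^sub>v w"
  have W': "mat_adjoint W \<in> carrier_mat n n" using W by (auto simp: mat_adjoint_index)
  have u: "u \<in> carrier_vec n" using W' w by (auto simp: u_def)
  have D: "?D \<in> carrier_mat n n" by simp
  have Du: "?D *\<^sub>v u \<in> carrier_vec n" by (rule mult_mat_vec_carrier[OF D u])
  have "(W * ?D * mat_adjoint W) *\<^sub>v w = W *\<^sub>v (?D *\<^sub>v u)"
    unfolding u_def using assoc_mult_mat_vec[OF mult_carrier_mat[OF W D] W' w]
      assoc_mult_mat_vec[OF W D u[unfolded u_def]] by simp
  then have "((W * ?D * mat_adjoint W) *\<^sub>v w) \<bullet>c w = (\<Sum>i<n. vec_index (W *\<^sub>v (?D *\<^sub>v u)) i * cnj (vec_index w i))"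
    using w by (simp add: Matrix.scalar_prod_def atLeast0LessThan conjugate_complex_def)
  also have "\<dots> = (\<Sum>i<n. (\<Sum>k<n. W $$ (i, k) * vec_index (?D *\<^sub>v u) k) * cnj (vec_index w i))"
    by (intro sum.cong) (auto simp: mult_mat_vec_index[OF W Du])
  also have "\<dots> = (\<Sum>k<n. \<Sum>i<n. vec_index (?D *\<^sub>v u) k * (W $$ (i, k) * cnj (vec_index w i)))"
    unfolding sum_distrib_right by (subst sum.swap) (simp add: mult_ac)
  also have "\<dots> = (\<Sum>k<n. vec_index (?D *\<^sub>v u) k * cnj (vec_index u k))"
  proof (intro sum.cong refl)
    fix k assume "k \<in> {..<n}"
    then have "cnj (vec_index u k) = (\<Sum>i<n. W $$ (i, k) * cnj (vec_index w i))"
      using W by (simp add: u_def mult_mat_vec_index[OF W' w]) (simp add: mat_adjoint_index)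
    then show "(\<Sum>i<n. vec_index (?D *\<^sub>v u) k * (W $$ (i, k) * cnj (vec_index w i)))
        = vec_index (?D *\<^sub>v u) k * cnj (vec_index u k)"
      by (simp add: sum_distrib_left)
  qed
  also have "\<dots> = (\<Sum>k<n. of_real (g k) * (vec_index u k * cnj (vec_index u k)))"
  proof (intro sum.cong refl)
    fix k assume k: "k \<in> {..<n}"
    then have "vec_index (?D *\<^sub>v u) k = (\<Sum>j<n. ?D $$ (k, j) * vec_index u j)"
      by (intro mult_mat_vec_index[OF D u]) auto
    also have "\<dots> = (\<Sum>j<n. if k = j then of_real (g j) * vec_index u j else 0)"
      by (rule sum.cong) (use k in \<open>auto simp: mat_diag_def\<close>)
    also have "\<dots> = of_real (g k) * vec_index u k" using k by simp
    finally show "vec_index (?D *\<^sub>v u) k * cnj (vec_index u k) = of_real (g k) * (vec_index u k * cnj (vec_index u k))"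
      by simp
  qed
  also have "\<dots> = complex_of_real (\<Sum>k<n. g k * (cmod (vec_index u k))\<^sup>2)"
    by (simp only: of_real_sum of_real_mult complex_norm_square)
  finally show ?thesis by (simp only: u_def)
qed

text \<open>Operator monotonicity for a conjugated diagonal matrix below a diagonal one, written in
  sums of squares. Both sides are read off from explicit spectral decompositions, the second with
  the identity as its unitary.\<close>

lemma operator_monotone_quadratic_form:
  fixes W :: "complex mat" and d g :: "nat \<Rightarrow> real"
  assumes f: "operator_monotone f" and W: "W \<in> carrier_mat n n"
    and unitary: "W * mat_adjoint W = 1\<^sub>m n" "mat_adjoint W * W = 1\<^sub>m n"
    and pos: "\<And>i. i < n \<Longrightarrow> 0 < d i" "\<And>i. i < n \<Longrightarrow> 0 < g i"
    and le: "\<And>w. w \<in> carrier_vec n \<Longrightarrow> (\<Sum>k<n. d k * (cmod (vec_index (mat_adjoint W *\<^sub>v w) k))\<^sup>2)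
      \<le> (\<Sum>k<n. g k * (cmod (vec_index w k))\<^sup>2)"
    and w: "w \<in> carrier_vec n"
  shows "(\<Sum>k<n. f (d k) * (cmod (vec_index (mat_adjoint W *\<^sub>v w) k))\<^sup>2)
      \<le> (\<Sum>k<n. f (g k) * (cmod (vec_index w k))\<^sup>2)"
proof -
  have one_adj: "mat_adjoint (1\<^sub>m n :: complex mat) = 1\<^sub>m n"
    by (rule eq_matI) (auto simp: mat_adjoint_index)
  define spec where "spec V h = V * mat_diag n (\<lambda>i. complex_of_real (h i)) * mat_adjoint V"
    for V :: "complex mat" and h :: "nat \<Rightarrow> real"
  have W': "mat_adjoint W \<in> carrier_mat n n" using W by (auto simp: mat_adjoint_index)
  have carr: "spec W h \<in> carrier_mat n n" "spec (1\<^sub>m n) h \<in> carrier_mat n n" for h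
    unfolding spec_def one_adj using W W' mat_diag_dim[of n "\<lambda>i. complex_of_real (h i)"]
    by (meson mult_carrier_mat one_carrier_mat)+
  have qs: "(spec V h *\<^sub>v w) \<bullet>c w = complex_of_real (\<Sum>k<n. h k * (cmod (vec_index (mat_adjoint V *\<^sub>v w) k))\<^sup>2)"
    if "V \<in> carrier_mat n n" "w \<in> carrier_vec n" for V h w
    unfolding spec_def by (rule spectral_quadratic_form[OF that])
  have le_iff: "0 \<le> ((spec (1\<^sub>m n) h' - spec W h) *\<^sub>v w) \<bullet>c w \<longleftrightarrow>
      (\<Sum>k<n. h k * (cmod (vec_index (mat_adjoint W *\<^sub>v w) k))\<^sup>2) \<le> (\<Sum>k<n. h' k * (cmod (vec_index w k))\<^sup>2)"
    if w: "w \<in> carrier_vec n" for h h' w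
  proof -
    have "((spec (1\<^sub>m n) h' - spec W h) *\<^sub>v w) \<bullet>c w = (spec (1\<^sub>m n) h' *\<^sub>v w) \<bullet>c w - (spec W h *\<^sub>v w) \<bullet>c w"
      unfolding minus_mult_distrib_mat_vec[OF carr(2) carr(1) w]
      by (rule minus_scalar_prod_distrib[of _ n])
        (use carr w mult_mat_vec_carrier[OF carr(1) w] mult_mat_vec_carrier[OF carr(2) w] in auto)
    also have "\<dots> = complex_of_real ((\<Sum>k<n. h' k * (cmod (vec_index w k))\<^sup>2)
        - (\<Sum>k<n. h k * (cmod (vec_index (mat_adjoint W *\<^sub>v w) k))\<^sup>2))"
      using w W by (simp only: qs one_carrier_mat one_adj one_mult_mat_vec of_real_diff)
    finally show ?thesis by (simp only: less_eq_complex_def) simp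
  qed
  have "mat_fun n f (spec W d) (spec W (\<lambda>i. f (d i)))"
    unfolding mat_fun_def spec_def using W unitary pos by blast
  moreover have "mat_fun n f (spec (1\<^sub>m n) g) (spec (1\<^sub>m n) (\<lambda>i. f (g i)))"
    unfolding mat_fun_def spec_def
    by (intro bexI[of _ "1\<^sub>m n"] exI[of _ g]) (auto simp: one_adj pos)
  moreover have "mat_le n (spec W d) (spec (1\<^sub>m n) g)"
    unfolding mat_le_def using le le_iff by blast
  ultimately have "mat_le n (spec W (\<lambda>i. f (d i))) (spec (1\<^sub>m n) (\<lambda>i. f (g i)))"
    using f unfolding operator_monotone_def by blast
  then show ?thesis
    unfolding mat_le_def using le_iff[OF w, of "\<lambda>i. f (g i)" "\<lambda>i. f (d i)"] w by blast
qed

text \<open>Young's inequality for the cross term, with a free weight \<open>\<eta>\<close>.\<close>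

lemma weighted_norm_add_le:
  fixes p h :: complex
  assumes "0 < \<eta>"
  shows "(cmod (p + h))\<^sup>2 \<le> (1 + \<eta>) * (cmod p)\<^sup>2 + (1 + 1 / \<eta>) * (cmod h)\<^sup>2"
proof -
  have "0 \<le> (sqrt \<eta> * cmod p - cmod h / sqrt \<eta>)\<^sup>2" by simp
  also have "\<dots> = \<eta> * (cmod p)\<^sup>2 + (cmod h)\<^sup>2 / \<eta> - 2 * cmod p * cmod h"
    using assms by (simp add: power2_diff power_mult_distrib power_divide)
  finally have *: "2 * cmod p * cmod h \<le> \<eta> * (cmod p)\<^sup>2 + (cmod h)\<^sup>2 / \<eta>" by simp
  have "(cmod (p + h))\<^sup>2 \<le> (cmod p + cmod h)\<^sup>2" by (intro power_mono norm_triangle_ineq) simp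
  also have "\<dots> = (cmod p)\<^sup>2 + (cmod h)\<^sup>2 + 2 * cmod p * cmod h" by (simp add: power2_sum)
  finally show ?thesis using * by (simp add: algebra_simps)
qed

lemma sum_lessThan_add: "(\<Sum>k<m + n. g k) = (\<Sum>k<m. g k) + (\<Sum>k<n. g (m + k :: nat) :: real)"
  by (induction n) (auto simp: add.assoc)

lemma sum_append_vec:
  assumes "p \<in> carrier_vec m" "q \<in> carrier_vec n"
  shows "(\<Sum>k<m + n. h k (vec_index (p @\<^sub>v q) k)) =
    (\<Sum>k<m. h k (vec_index p k)) + (\<Sum>k<n. h (m + k) (vec_index q k) :: real)"
proof -
  have "dim_vec p = m" "dim_vec q = n" using assms by (auto dest: carrier_vecD)
  then show ?thesis unfolding sum_lessThan_add by simp
qed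

text \<open>The isometry with columns \<open>v i\<close> is dilated to a unitary matrix, so that the compression of
  a diagonal matrix becomes the corner of a matrix dominated by a block diagonal one.\<close>

lemma operator_monotone_jensen:
  fixes v :: "nat \<Rightarrow> nat \<Rightarrow> complex" and N l :: "nat \<Rightarrow> real"
  assumes f: "operator_monotone f"
    and orth: "\<And>i j. i < n \<Longrightarrow> j < n \<Longrightarrow> (\<Sum>k<m. v i k * cnj (v j k)) = (if i = j then 1 else 0)"
    and N: "\<And>k. k < m \<Longrightarrow> 0 < N k"
    and diag: "\<And>i j. i < n \<Longrightarrow> j < n \<Longrightarrow>
      (\<Sum>k<m. of_real (N k) * v i k * cnj (v j k)) = (if i = j then complex_of_real (l i) else 0)"
    and l: "\<And>i. i < n \<Longrightarrow> 0 \<le> l i" and \<epsilon>: "0 < \<epsilon>"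
  shows "(\<Sum>k<m. f (N k) * (cmod (\<Sum>i<n. x i * v i k))\<^sup>2) \<le> (\<Sum>i<n. f (l i + \<epsilon>) * (cmod (x i))\<^sup>2)"
proof -
  define V where "V = Matrix.mat m n (\<lambda>(k, i). v i k)"
  define V' where "V' = mat_adjoint V"
  have V: "V \<in> carrier_mat m n" and V': "V' \<in> carrier_mat n m"
    by (auto simp: V_def V'_def mat_adjoint_index)
  have V'V: "V' * V = 1\<^sub>m n"
  proof (rule eq_matI)
    fix i j assume ij: "i < dim_row (1\<^sub>m n)" "j < dim_col (1\<^sub>m n)"
    have "(V' * V) $$ (i, j) = (\<Sum>k<m. v j k * cnj (v i k))"
      using ij by (simp add: V'_def V_def mat_adjoint_index Matrix.scalar_prod_def atLeast0LessThan mult.commute)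
    then show "(V' * V) $$ (i, j) = 1\<^sub>m n $$ (i, j)" using orth ij by auto
  qed (use V V' in auto)
  \<comment> \<open>The projection onto the orthogonal complement of the range of
    \<open>V\<close>.\<close>
  define R where "R = 1\<^sub>m m - V * V'"
  have R: "R \<in> carrier_mat m m" using V V' by (auto simp: R_def)
  have VV': "V * V' \<in> carrier_mat m m" using V V' by auto
  have VVVV: "(V * V') * (V * V') = V * V'"
  proof -
    have "(V * V') * (V * V') = V * (V' * (V * V'))" using V V' by (intro assoc_mult_mat) auto
    also have "V' * (V * V') = (V' * V) * V'" using V V' by (intro assoc_mult_mat[symmetric]) auto
    finally show ?thesis unfolding V'V left_mult_one_mat[OF V'] .
  qed
  have R2: "R * R = R"
  proof -
    have "R * (V * V') = 1\<^sub>m m * (V * V') - (V * V') * (V * V')"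
      unfolding R_def by (rule minus_mult_distrib_mat[OF _ VV' VV']) auto
    also have "\<dots> = 0\<^sub>m m m"
      unfolding VVVV left_mult_one_mat[OF VV'] by (rule minus_r_inv_mat[OF VV'])
    finally have RQ: "R * (V * V') = 0\<^sub>m m m" .
    have "R * (1\<^sub>m m - V * V') = R * 1\<^sub>m m - R * (V * V')"
      by (rule mult_minus_distrib_mat[OF R _ VV']) auto
    then have "R * R = R * 1\<^sub>m m - R * (V * V')" by (simp only: R_def)
    then show ?thesis unfolding RQ right_mult_one_mat[OF R] using R by (auto intro!: eq_matI)
  qed
  have V'R: "V' * R = 0\<^sub>m n m"
  proof -
    have "V' * R = V' * 1\<^sub>m m - V' * (V * V')" unfolding R_def
      by (rule mult_minus_distrib_mat[OF V' _ VV']) auto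
    also have "V' * (V * V') = (V' * V) * V'" using V V' by (intro assoc_mult_mat[symmetric]) auto
    finally show ?thesis
      unfolding V'V left_mult_one_mat[OF V'] right_mult_one_mat[OF V'] minus_r_inv_mat[OF V'] .
  qed
  have RV: "R * V = 0\<^sub>m m n"
  proof -
    have "R * V = 1\<^sub>m m * V - (V * V') * V" unfolding R_def
      by (rule minus_mult_distrib_mat[OF _ VV' V]) auto
    also have "(V * V') * V = V * (V' * V)" using V V' by (intro assoc_mult_mat) auto
    finally show ?thesis
      unfolding V'V left_mult_one_mat[OF V] right_mult_one_mat[OF V] minus_r_inv_mat[OF V] .
  qed
  have VR: "V * V' + R * R = 1\<^sub>m m" "R * R + V * V' = 1\<^sub>m m"
  proof -
    have "X + (1\<^sub>m m - X) = 1\<^sub>m m" "(1\<^sub>m m - X) + X = 1\<^sub>m m" if "X \<in> carrier_mat m m" for X :: "complex mat"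
      using that by (auto intro!: eq_matI)
    from this[OF VV'] show "V * V' + R * R = 1\<^sub>m m" "R * R + V * V' = 1\<^sub>m m"
      by (simp_all only: R2) (simp_all only: R_def)
  qed
  \<comment> \<open>\<open>U\<close> is the unitary dilation of the isometry \<open>V\<close>, with
    \<open>V\<close> in its upper left corner, and \<open>W\<close> is its adjoint. The rows of
    \<open>U\<close> are split as m + n, its columns as n + m.\<close>
  define W where "W = four_block_mat V' (0\<^sub>m n n) R V"
  define U where "U = four_block_mat V R (0\<^sub>m n n) V'"
  have W: "W \<in> carrier_mat (n + m) (n + m)"
    using four_block_carrier_mat[OF V' V, of "0\<^sub>m n n" R] unfolding W_def by (simp add: add.commute)
  have WU: "W * U = 1\<^sub>m (n + m)"
  proof -
    have "W * U = four_block_mat (V' * V + 0\<^sub>m n n * 0\<^sub>m n n) (V' * R + 0\<^sub>m n n * V')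
        (R * V + V * 0\<^sub>m n n) (R * R + V * V')"
      unfolding W_def U_def using V V' R by (intro mult_four_block_mat) auto
    then show ?thesis unfolding VR V'V V'R RV using V V' by simp
  qed
  have UW: "U * W = 1\<^sub>m (n + m)"
  proof -
    have "U * W = four_block_mat (V * V' + R * R) (V * 0\<^sub>m n n + R * V)
        (0\<^sub>m n n * V' + V' * R) (0\<^sub>m n n * 0\<^sub>m n n + V' * V)"
      unfolding W_def U_def using V V' R by (intro mult_four_block_mat) auto
    then show ?thesis unfolding VR V'V V'R RV using V V' by (simp add: add.commute)
  qed
  have adj_VV': "cnj ((V * V') $$ (j, i)) = (V * V') $$ (i, j)" if "i < m" "j < m" for i j
    using that by (simp add: V'_def V_def mat_adjoint_index Matrix.scalar_prod_def mult.commute)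
  have adj: "mat_adjoint W = U"
  proof (rule eq_matI)
    fix i j assume "i < dim_row U" "j < dim_col U"
    then have ij: "i < m + n" "j < n + m" using V V' by (auto simp: U_def)
    show "mat_adjoint W $$ (i, j) = U $$ (i, j)"
      using ij V V' R adj_VV' VV'
      by (auto simp: mat_adjoint_index W_def U_def V'_def R_def)
  qed (use V V' in \<open>auto simp: mat_adjoint_index W_def U_def\<close>)
  define B where "B = (\<Sum>k<m. N k)"
  \<comment> \<open>The weight for the cross terms, small enough that
    \<open>(1 + \<eta>) * l i \<le> l i + \<epsilon>\<close> for all \<open>i\<close>; the 1 in the
    denominator covers vanishing \<open>l\<close>.\<close>
  define \<eta> where "\<eta> = \<epsilon> / (1 + (\<Sum>i<n. l i))"
  have sl: "0 \<le> (\<Sum>i<n. l i)" using l by (intro sum_nonneg) auto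
  have \<eta>: "0 < \<eta>" using \<epsilon> sl by (auto simp: \<eta>_def)
  have \<eta>l: "(1 + \<eta>) * l i \<le> l i + \<epsilon>" if "i < n" for i
  proof -
    have "l i \<le> (\<Sum>i<n. l i)" using that l by (intro member_le_sum) auto
    then have "\<eta> * l i \<le> \<eta> * (1 + (\<Sum>i<n. l i))" using \<eta> by (intro mult_left_mono) auto
    also have "\<dots> = \<epsilon>" using sl by (simp add: \<eta>_def)
    finally show ?thesis by (simp add: algebra_simps)
  qed
  have B0: "0 \<le> B" unfolding B_def using N by (intro sum_nonneg less_imp_le) auto
  \<comment> \<open>The price of the second block: 1 pays for the entries 1 of \<open>d\<close>, and
    the rest for the part of \<open>N\<close> seen through \<open>R\<close>, including the cross
    terms.\<close>
  define K where "K = 1 + (1 + 1 / \<eta>) * B"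
  have K: "0 < K" using B0 \<eta> by (auto simp: K_def intro!: add_pos_nonneg mult_nonneg_nonneg)
  \<comment> \<open>\<open>d\<close> and \<open>g\<close> follow the two different splittings m + n
    and n + m. The value 1 is a positive filler, while \<open>K\<close> has to be large.\<close>
  define d where "d k = (if k < m then N k else 1)" for k
  define g where "g i = (if i < n then l i + \<epsilon> else K)" for i
  have Uw: "U *\<^sub>v (y @\<^sub>v z) = (V *\<^sub>v y + R *\<^sub>v z) @\<^sub>v (V' *\<^sub>v z)"
    if "y \<in> carrier_vec n" "z \<in> carrier_vec m" for y z
  proof -
    have "U *\<^sub>v (y @\<^sub>v z) = (V *\<^sub>v y + R *\<^sub>v z) @\<^sub>v (0\<^sub>m n n *\<^sub>v y + V' *\<^sub>v z)"
      unfolding U_def by (rule four_block_mat_mult_vec[OF V R _ V' that]) auto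
    moreover have "0\<^sub>m n n *\<^sub>v y + V' *\<^sub>v z = V' *\<^sub>v z"
      using that V' by (auto intro!: eq_vecI simp: mult_mat_vec_index[of "0\<^sub>m n n" n n])
    ultimately show ?thesis by simp
  qed
  have Vy: "vec_index (V *\<^sub>v y) k = (\<Sum>i<n. vec_index y i * v i k)" if "y \<in> carrier_vec n" "k < m" for y k
    using that by (simp add: mult_mat_vec_index[OF V]) (simp add: V_def mult.commute)
  have iso: "(\<Sum>k<n + m. (cmod (vec_index (U *\<^sub>v w) k))\<^sup>2) = (\<Sum>k<n + m. (cmod (vec_index w k))\<^sup>2)"
    if w: "w \<in> carrier_vec (n + m)" for w
  proof -
    have one: "mat_diag (n + m) (\<lambda>i. complex_of_real 1) = 1\<^sub>m (n + m)"
      by simp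
    have one_adj: "mat_adjoint (1\<^sub>m (n + m) :: complex mat) = 1\<^sub>m (n + m)"
      by (rule eq_matI) (auto simp: mat_adjoint_index)
    have "complex_of_real (\<Sum>k<n + m. 1 * (cmod (vec_index (U *\<^sub>v w) k))\<^sup>2) = (1\<^sub>m (n + m) *\<^sub>v w) \<bullet>c w"
      using spectral_quadratic_form[OF W w, of "\<lambda>_. 1"] W unfolding adj one by (simp add: WU)
    also have "\<dots> = complex_of_real (\<Sum>k<n + m. 1 * (cmod (vec_index w k))\<^sup>2)"
      using spectral_quadratic_form[OF one_carrier_mat w, of "\<lambda>_. 1"] w unfolding one_adj one by simp
    finally show ?thesis by (simp only: of_real_eq_iff mult_1)
  qed
  have le: "(\<Sum>k<n + m. d k * (cmod (vec_index (mat_adjoint W *\<^sub>v w) k))\<^sup>2)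
      \<le> (\<Sum>k<n + m. g k * (cmod (vec_index w k))\<^sup>2)"
    if w: "w \<in> carrier_vec (n + m)" for w
  proof -
    define y where "y = vec_first w n"
    define z where "z = vec_last w m"
    have y: "y \<in> carrier_vec n" and z: "z \<in> carrier_vec m" by (auto simp: y_def z_def)
    have wyz: "w = y @\<^sub>v z" using w by (simp add: y_def z_def)
    have Rz: "R *\<^sub>v z \<in> carrier_vec m" and V'z: "V' *\<^sub>v z \<in> carrier_vec n" using R V' z by auto
    \<comment> \<open>Isometry of \<open>U\<close> on vectors with first block 0 gives |Rz|^2 +
      |V'z|^2 = |z|^2, so both parts are controlled by \<open>z\<close>.\<close>
    have "U *\<^sub>v (0\<^sub>v n @\<^sub>v z) = (V *\<^sub>v 0\<^sub>v n + R *\<^sub>v z) @\<^sub>v (V' *\<^sub>v z)"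
      by (rule Uw) (use z in auto)
    moreover have "V *\<^sub>v 0\<^sub>v n + R *\<^sub>v z = R *\<^sub>v z"
      unfolding mult_mat_zero_vec[OF V] by (rule left_zero_vec[OF Rz])
    ultimately have "(\<Sum>k<n + m. (cmod (vec_index ((R *\<^sub>v z) @\<^sub>v (V' *\<^sub>v z)) k))\<^sup>2) =
        (\<Sum>k<n + m. (cmod (vec_index (0\<^sub>v n @\<^sub>v z) k))\<^sup>2)"
      using iso[of "0\<^sub>v n @\<^sub>v z"] z by simp
    moreover have "(\<Sum>k<n + m. (cmod (vec_index (0\<^sub>v n @\<^sub>v z) k))\<^sup>2) = (\<Sum>k<m. (cmod (vec_index z k))\<^sup>2)"
      using sum_append_vec[OF zero_carrier_vec z, of "\<lambda>k a. (cmod a)\<^sup>2" n] by simp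
    moreover have "(\<Sum>k<n + m. (cmod (vec_index ((R *\<^sub>v z) @\<^sub>v (V' *\<^sub>v z)) k))\<^sup>2) =
        (\<Sum>k<m. (cmod (vec_index (R *\<^sub>v z) k))\<^sup>2) + (\<Sum>k<n. (cmod (vec_index (V' *\<^sub>v z) k))\<^sup>2)"
      unfolding add.commute[of n m] by (rule sum_append_vec[OF Rz V'z])
    ultimately have zz: "(\<Sum>k<m. (cmod (vec_index (R *\<^sub>v z) k))\<^sup>2) + (\<Sum>k<n. (cmod (vec_index (V' *\<^sub>v z) k))\<^sup>2)
        = (\<Sum>k<m. (cmod (vec_index z k))\<^sup>2)" by simp
    have ge0: "0 \<le> (\<Sum>k<m. (cmod (vec_index (R *\<^sub>v z) k))\<^sup>2)" "0 \<le> (\<Sum>k<n. (cmod (vec_index (V' *\<^sub>v z) k))\<^sup>2)"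
      by (auto intro: sum_nonneg)
    have NV: "(\<Sum>k<m. N k * (cmod (vec_index (V *\<^sub>v y) k))\<^sup>2) = (\<Sum>i<n. l i * (cmod (vec_index y i))\<^sup>2)"
    proof -
      have "(\<Sum>k<m. N k * (cmod (vec_index (V *\<^sub>v y) k))\<^sup>2) =
          (\<Sum>k<m. N k * (cmod (\<Sum>i<n. vec_index y i * v i k))\<^sup>2)"
        using y by (intro sum.cong) (auto simp: Vy)
      also have "\<dots> = (\<Sum>i<n. l i * (cmod (vec_index y i))\<^sup>2)"
        by (rule sum_gram_diagonal) (use diag in auto)
      finally show ?thesis .
    qed
    have "(\<Sum>k<m. N k * (cmod (vec_index (V *\<^sub>v y) k + vec_index (R *\<^sub>v z) k))\<^sup>2) \<le>
        (\<Sum>k<m. (1 + \<eta>) * (N k * (cmod (vec_index (V *\<^sub>v y) k))\<^sup>2)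
          + (1 + 1 / \<eta>) * (B * (cmod (vec_index (R *\<^sub>v z) k))\<^sup>2))"
    proof (rule sum_mono)
      fix k assume k: "k \<in> {..<m}"
      have "N k \<le> B" unfolding B_def using N k by (intro member_le_sum) (auto intro: less_imp_le)
      let ?p = "cmod (vec_index (V *\<^sub>v y) k)" and ?h = "cmod (vec_index (R *\<^sub>v z) k)"
      have "N k * (cmod (vec_index (V *\<^sub>v y) k + vec_index (R *\<^sub>v z) k))\<^sup>2
          \<le> N k * ((1 + \<eta>) * ?p\<^sup>2 + (1 + 1 / \<eta>) * ?h\<^sup>2)"
        using N k by (intro mult_left_mono weighted_norm_add_le \<eta>) (auto intro: less_imp_le)
      also have "\<dots> = (1 + \<eta>) * (N k * ?p\<^sup>2) + (1 + 1 / \<eta>) * (N k * ?h\<^sup>2)" by (simp add: algebra_simps)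
      also have "(1 + 1 / \<eta>) * (N k * ?h\<^sup>2) \<le> (1 + 1 / \<eta>) * (B * ?h\<^sup>2)"
        using \<open>N k \<le> B\<close> \<eta> by (intro mult_left_mono mult_right_mono) auto
      finally show "N k * (cmod (vec_index (V *\<^sub>v y) k + vec_index (R *\<^sub>v z) k))\<^sup>2
        \<le> (1 + \<eta>) * (N k * ?p\<^sup>2) + (1 + 1 / \<eta>) * (B * ?h\<^sup>2)" by simp
    qed
    also have "\<dots> = (1 + \<eta>) * (\<Sum>i<n. l i * (cmod (vec_index y i))\<^sup>2)
        + (1 + 1 / \<eta>) * B * (\<Sum>k<m. (cmod (vec_index (R *\<^sub>v z) k))\<^sup>2)"
      by (simp add: sum.distrib sum_distrib_left[symmetric] NV mult.assoc)
    also have "\<dots> \<le> (\<Sum>i<n. (l i + \<epsilon>) * (cmod (vec_index y i))\<^sup>2)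
        + (1 + 1 / \<eta>) * B * (\<Sum>k<m. (cmod (vec_index z k))\<^sup>2)"
    proof (rule add_mono)
      show "(1 + \<eta>) * (\<Sum>i<n. l i * (cmod (vec_index y i))\<^sup>2) \<le> (\<Sum>i<n. (l i + \<epsilon>) * (cmod (vec_index y i))\<^sup>2)"
        unfolding sum_distrib_left mult.assoc[symmetric] using \<eta>l by (intro sum_mono mult_right_mono) auto
      show "(1 + 1 / \<eta>) * B * (\<Sum>k<m. (cmod (vec_index (R *\<^sub>v z) k))\<^sup>2)
          \<le> (1 + 1 / \<eta>) * B * (\<Sum>k<m. (cmod (vec_index z k))\<^sup>2)"
        using zz ge0 \<eta> B0 by (intro mult_left_mono) auto
    qed
    finally have "(\<Sum>k<m. N k * (cmod (vec_index (V *\<^sub>v y) k + vec_index (R *\<^sub>v z) k))\<^sup>2)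
        + (\<Sum>k<n. (cmod (vec_index (V' *\<^sub>v z) k))\<^sup>2)
        \<le> (\<Sum>i<n. (l i + \<epsilon>) * (cmod (vec_index y i))\<^sup>2) + K * (\<Sum>k<m. (cmod (vec_index z k))\<^sup>2)"
      using zz ge0 by (simp add: K_def algebra_simps)
    moreover have "(\<Sum>k<n + m. d k * (cmod (vec_index (mat_adjoint W *\<^sub>v w) k))\<^sup>2) =
        (\<Sum>k<m. N k * (cmod (vec_index (V *\<^sub>v y) k + vec_index (R *\<^sub>v z) k))\<^sup>2)
        + (\<Sum>k<n. (cmod (vec_index (V' *\<^sub>v z) k))\<^sup>2)"
    proof -
      have VyRz: "V *\<^sub>v y + R *\<^sub>v z \<in> carrier_vec m" using Rz mult_mat_vec_carrier[OF V y] by auto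
      have "dim_vec (R *\<^sub>v z) = m" using Rz by (rule carrier_vecD)
      then show ?thesis
        unfolding add.commute[of n m] adj wyz Uw[OF y z] sum_append_vec[OF VyRz V'z, of "\<lambda>k a. d k * (cmod a)\<^sup>2"]
        by (simp add: d_def)
    qed
    moreover have "(\<Sum>k<n + m. g k * (cmod (vec_index w k))\<^sup>2) =
        (\<Sum>i<n. (l i + \<epsilon>) * (cmod (vec_index y i))\<^sup>2) + K * (\<Sum>k<m. (cmod (vec_index z k))\<^sup>2)"
      unfolding wyz sum_append_vec[OF y z, of "\<lambda>k a. g k * (cmod a)\<^sup>2"]
      by (simp add: g_def sum_distrib_left)
    ultimately show ?thesis by simp
  qed
  \<comment> \<open>On vectors with second block 0 the constant \<open>K\<close> disappears and
    \<open>U\<close> acts as \<open>V\<close>, so what remains is the claim.\<close>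
  define y where "y = Matrix.vec n x"
  have y: "y \<in> carrier_vec n" by (simp add: y_def)
  have w: "y @\<^sub>v 0\<^sub>v m \<in> carrier_vec (n + m)" using y by auto
  have "(\<Sum>k<n + m. f (d k) * (cmod (vec_index (mat_adjoint W *\<^sub>v (y @\<^sub>v 0\<^sub>v m)) k))\<^sup>2)
      \<le> (\<Sum>k<n + m. f (g k) * (cmod (vec_index (y @\<^sub>v 0\<^sub>v m) k))\<^sup>2)"
  proof (rule operator_monotone_quadratic_form[OF f W _ _ _ _ le w])
    show "W * mat_adjoint W = 1\<^sub>m (n + m)" "mat_adjoint W * W = 1\<^sub>m (n + m)"
      by (simp_all add: adj WU UW)
    show "0 < d k" for k using N by (simp add: d_def)
    show "0 < g i" for i using l \<epsilon> K by (auto simp: g_def intro: add_nonneg_pos)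
  qed
  moreover have "(\<Sum>k<n + m. f (g k) * (cmod (vec_index (y @\<^sub>v 0\<^sub>v m) k))\<^sup>2) = (\<Sum>i<n. f (l i + \<epsilon>) * (cmod (x i))\<^sup>2)"
    unfolding sum_append_vec[OF y zero_carrier_vec, of "\<lambda>k a. f (g k) * (cmod a)\<^sup>2"]
    by (simp add: g_def y_def)
  moreover have "(\<Sum>k<n + m. f (d k) * (cmod (vec_index (mat_adjoint W *\<^sub>v (y @\<^sub>v 0\<^sub>v m)) k))\<^sup>2)
      = (\<Sum>k<m. f (N k) * (cmod (\<Sum>i<n. x i * v i k))\<^sup>2)"
  proof -
    have "V *\<^sub>v y + R *\<^sub>v 0\<^sub>v m = V *\<^sub>v y"
      unfolding mult_mat_zero_vec[OF R]
      by (rule right_zero_vec[OF mult_mat_vec_carrier[OF V y]])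
    moreover have "V' *\<^sub>v 0\<^sub>v m = 0\<^sub>v n" by (rule mult_mat_zero_vec[OF V'])
    ultimately have U0: "U *\<^sub>v (y @\<^sub>v 0\<^sub>v m) = (V *\<^sub>v y) @\<^sub>v 0\<^sub>v n"
      using Uw[OF y zero_carrier_vec] by simp
    show ?thesis
      unfolding add.commute[of n m] adj U0
        sum_append_vec[OF mult_mat_vec_carrier[OF V y] zero_carrier_vec, of "\<lambda>k a. f (d k) * (cmod a)\<^sup>2"]
      by (simp add: Vy[OF y]) (simp add: d_def y_def)
  qed
  ultimately show ?thesis by simp
qed

lemma operator_monotone_jensen_finite:
  fixes v :: "'i \<Rightarrow> 'k \<Rightarrow> complex"
  assumes f: "operator_monotone f" and fin: "finite I" "finite K"
    and orth: "\<And>i j. i \<in> I \<Longrightarrow> j \<in> I \<Longrightarrow> (\<Sum>k\<in>K. v i k * cnj (v j k)) = (if i = j then 1 else 0)"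
    and N: "\<And>k. k \<in> K \<Longrightarrow> 0 < N k"
    and diag: "\<And>i j. i \<in> I \<Longrightarrow> j \<in> I \<Longrightarrow>
      (\<Sum>k\<in>K. of_real (N k) * v i k * cnj (v j k)) = (if i = j then complex_of_real (l i) else 0)"
    and l: "\<And>i. i \<in> I \<Longrightarrow> 0 \<le> l i" and \<epsilon>: "0 < \<epsilon>"
  shows "(\<Sum>k\<in>K. f (N k) * (cmod (\<Sum>i\<in>I. x i * v i k))\<^sup>2) \<le> (\<Sum>i\<in>I. f (l i + \<epsilon>) * (cmod (x i))\<^sup>2)"
proof -
  obtain h where h: "bij_betw h {..<card I} I"
    using ex_bij_betw_nat_finite[OF fin(1)] by (auto simp: atLeast0LessThan)
  obtain g where g: "bij_betw g {..<card K} K"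
    using ex_bij_betw_nat_finite[OF fin(2)] by (auto simp: atLeast0LessThan)
  have hI: "h i \<in> I" if "i < card I" for i using h that by (auto simp: bij_betw_def)
  have gK: "g k \<in> K" if "k < card K" for k using g that by (auto simp: bij_betw_def)
  have h_eq: "h i = h j \<longleftrightarrow> i = j" if "i < card I" "j < card I" for i j
    using h that by (auto simp: bij_betw_def inj_on_def)
  note rh = sum.reindex_bij_betw[OF h] and rg = sum.reindex_bij_betw[OF g]
  have "(\<Sum>k<card K. f (N (g k)) * (cmod (\<Sum>i<card I. x (h i) * v (h i) (g k)))\<^sup>2)
      \<le> (\<Sum>i<card I. f (l (h i) + \<epsilon>) * (cmod (x (h i)))\<^sup>2)"
  proof (rule operator_monotone_jensen[OF f _ _ _ _ \<epsilon>])
    fix i j assume ij: "i < card I" "j < card I"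
    show "(\<Sum>k<card K. v (h i) (g k) * cnj (v (h j) (g k))) = (if i = j then 1 else 0)"
      using orth[OF hI[OF ij(1)] hI[OF ij(2)]] h_eq[OF ij] rg[of "\<lambda>k. v (h i) k * cnj (v (h j) k)"] by simp
    show "(\<Sum>k<card K. of_real (N (g k)) * v (h i) (g k) * cnj (v (h j) (g k))) =
        (if i = j then complex_of_real (l (h i)) else 0)"
      using diag[OF hI[OF ij(1)] hI[OF ij(2)]] h_eq[OF ij]
        rg[of "\<lambda>k. of_real (N k) * v (h i) k * cnj (v (h j) k)"] by simp
  qed (use N l hI gK in auto)
  then show ?thesis
    using rg[of "\<lambda>k. f (N k) * (cmod (\<Sum>i<card I. x (h i) * v (h i) k))\<^sup>2"]
      rh[of "\<lambda>i. f (l i + \<epsilon>) * (cmod (x i))\<^sup>2"] rh[of "\<lambda>i. x i * v i k" for k]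
    by simp
qed

section \<open>Schur products\<close>

text \<open>The argument is a kernel rather than an operator, since Gram sums and Schur products of
  sections occur before any operator with these entries is at hand. The conjugate on the second
  index matches \<open>mat_of\<close>.\<close>

definition qform :: "'a set \<Rightarrow> ('a \<Rightarrow> 'a \<Rightarrow> complex) \<Rightarrow> ('a \<Rightarrow> complex) \<Rightarrow> complex" where
  "qform F K c = (\<Sum>u\<in>F. \<Sum>v\<in>F. c u * cnj (c v) * K u v)"

lemma qform_diff: "qform F (\<lambda>u v. K u v - L u v) c = qform F K c - qform F L c"
  by (simp add: qform_def right_diff_distrib sum_subtractf)

lemma qform_cong:
  "(\<And>u v. u \<in> F \<Longrightarrow> v \<in> F \<Longrightarrow> K u v = L u v) \<Longrightarrow> qform F K c = qform F L c"
  by (auto simp: qform_def intro!: sum.cong)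

lemma qform_rank_one_sum:
  "Re (qform F (\<lambda>u v. \<Sum>k\<in>J. of_real (m k) * s k u * cnj (s k v)) c) =
    (\<Sum>k\<in>J. m k * (cmod (\<Sum>u\<in>F. c u * s k u))\<^sup>2)"
  using sum_gram[where K=J and N=m and I=F and x=c and v="\<lambda>u k. s k u", symmetric]
  by (simp add: qform_def)

lemma qform_add: "qform F (\<lambda>u v. K u v + L u v) c = qform F K c + qform F L c"
  by (simp add: qform_def distrib_left sum.distrib)

text \<open>Schur product theorem: each rank-one term of \<open>L\<close> only multiplies the
  coefficient vector entrywise, so the form becomes a nonnegative combination of values of the form
  of \<open>P\<close>.\<close>

lemma schur_product_nonneg:
  assumes P: "\<And>d. 0 \<le> Re (qform F P d)"
    and L: "\<And>u v. u \<in> F \<Longrightarrow> v \<in> F \<Longrightarrow> L u v = (\<Sum>k\<in>J. of_real (m k) * s k u * cnj (s k v))"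
    and m: "\<And>k. k \<in> J \<Longrightarrow> 0 \<le> m k"
  shows "0 \<le> Re (qform F (\<lambda>u v. P u v * L u v) c)"
proof -
  have "qform F (\<lambda>u v. P u v * L u v) c =
      (\<Sum>u\<in>F. \<Sum>v\<in>F. \<Sum>k\<in>J. of_real (m k) * ((c u * s k u) * cnj (c v * s k v) * P u v))"
    unfolding qform_def using L
    by (intro sum.cong refl) (simp add: sum_distrib_left mult_ac)
  also have "\<dots> = (\<Sum>u\<in>F. \<Sum>k\<in>J. \<Sum>v\<in>F. of_real (m k) * ((c u * s k u) * cnj (c v * s k v) * P u v))"
    by (intro sum.cong refl sum.swap)
  also have "\<dots> = (\<Sum>k\<in>J. \<Sum>u\<in>F. \<Sum>v\<in>F. of_real (m k) * ((c u * s k u) * cnj (c v * s k v) * P u v))"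
    by (rule sum.swap)
  also have "\<dots> = (\<Sum>k\<in>J. of_real (m k) * qform F P (\<lambda>u. c u * s k u))"
    unfolding qform_def by (simp only: sum_distrib_left)
  finally have "Re (qform F (\<lambda>u v. P u v * L u v) c) = (\<Sum>k\<in>J. m k * Re (qform F P (\<lambda>u. c u * s k u)))"
    by simp
  also have "0 \<le> \<dots>" using P m by (intro sum_nonneg mult_nonneg_nonneg) auto
  finally show ?thesis .
qed

section \<open>Matrix entries of operators and Schur products of finite sections\<close>

definition mat_of :: "('h::chilbert_space \<Rightarrow>\<^sub>L 'h) \<Rightarrow> 'h \<Rightarrow> 'h \<Rightarrow> complex" where
  "mat_of X u v = cinner (X u) v"

lemma mat_of_add: "mat_of (X + Y) u v = mat_of X u v + mat_of Y u v"
  by (simp add: mat_of_def blinfun.add_left cinner_simps)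

lemma mat_of_diff: "mat_of (X - Y) u v = mat_of X u v - mat_of Y u v"
  by (simp add: mat_of_def blinfun.diff_left cinner_simps)

lemma mat_of_scaleR: "mat_of (a *\<^sub>R X) u v = of_real a * mat_of X u v"
  by (simp add: mat_of_def blinfun.scaleR_left cinner_simps)

lemma mat_of_hermitian: "op_pos X \<Longrightarrow> mat_of X v u = cnj (mat_of X u v)"
  unfolding mat_of_def by (metis op_pos_selfadjoint cinner_commute)

lemma mat_of_sums:
  assumes "X \<in> bounded_ops"
  shows "mat_of X (\<Sum>i\<in>I. a i *\<^sub>C r i) (\<Sum>j\<in>J. b j *\<^sub>C s j) =
    (\<Sum>i\<in>I. \<Sum>j\<in>J. a i * cnj (b j) * mat_of X (r i) (s j))"
  unfolding mat_of_def bounded_ops_sum[OF assms] cinner_sum_left cinner_scaleC_left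
  unfolding cinner_sum_right cinner_scaleC_right sum_distrib_left by (simp add: mult_ac)

lemma qform_mat_of:
  assumes "X \<in> bounded_ops"
  shows "Re (qform F (mat_of X) c) = qf X (\<Sum>u\<in>F. c u *\<^sub>C u)"
  unfolding qf_def mat_of_def[symmetric] mat_of_sums[OF assms] qform_def ..

lemma mat_of_expansion:
  assumes X: "X \<in> bounded_ops"
    and d: "\<And>i j. i \<in> F \<Longrightarrow> j \<in> F \<Longrightarrow>
      cinner (X (r i)) (r j) = (if i = j then complex_of_real (m i) else 0)"
    and F: "finite F"
    and x: "x = (\<Sum>i\<in>F. s i x *\<^sub>C r i)" and y: "y = (\<Sum>i\<in>F. s i y *\<^sub>C r i)"
  shows "mat_of X x y = (\<Sum>i\<in>F. of_real (m i) * s i x * cnj (s i y))"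
proof -
  have "mat_of X x y = mat_of X (\<Sum>i\<in>F. s i x *\<^sub>C r i) (\<Sum>j\<in>F. s j y *\<^sub>C r j)"
    using x y by simp
  also have "\<dots> = (\<Sum>i\<in>F. \<Sum>j\<in>F. s i x * cnj (s j y) * cinner (X (r i)) (r j))"
    unfolding mat_of_sums[OF X] by (simp add: mat_of_def)
  also have "\<dots> = (\<Sum>i\<in>F. \<Sum>j\<in>F. if i = j then of_real (m i) * s i x * cnj (s i y) else 0)"
    using d by (intro sum.cong) auto
  also have "\<dots> = (\<Sum>i\<in>F. of_real (m i) * s i x * cnj (s i y))"
    using F by (intro sum.cong) auto
  finally show ?thesis .
qed

lemma pr_basis:
  assumes E: "orthonormal_basis E" and F: "finite F" "F \<subseteq> E" and u: "u \<in> F"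
  shows "pr F u = u"
  using proj_basis[OF E, of u F] proj_finite[OF E F, of u] F u by auto

text \<open>With the identity as the definite form, diagonalizing the pencil is the spectral
  decomposition of the finite section.\<close>

lemma op_pos_decomposition:
  fixes X :: "'h::chilbert_space \<Rightarrow>\<^sub>L 'h"
  assumes E: "orthonormal_basis E" and F: "finite F" "F \<subseteq> E" and X: "op_pos X"
  obtains m and s :: "'h \<Rightarrow> 'h \<Rightarrow> complex" where "\<And>k. k \<in> F \<Longrightarrow> 0 \<le> m k"
    "\<And>u v. u \<in> F \<Longrightarrow> v \<in> F \<Longrightarrow> mat_of X u v = (\<Sum>k\<in>F. of_real (m k) * s k u * cnj (s k v))"
proof -
  have p: "x \<noteq> 0 \<Longrightarrow> 0 < qf id_blinfun x" for x :: 'h by simp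
  obtain r where r: "\<And>i j. i \<in> F \<Longrightarrow> j \<in> F \<Longrightarrow>
      cinner (X (r i)) (r j) = (if i = j then complex_of_real (qf X (r i)) else 0)"
    "\<And>x. pr F x = x \<Longrightarrow> x = (\<Sum>i\<in>F. cinner x (id_blinfun (r i)) *\<^sub>C r i)"
    by (rule simultaneous_diagonalization[OF E F op_pos_id p X]) (assumption | rule that)+
  show thesis
  proof (rule that[of "\<lambda>k. qf X (r k)" "\<lambda>i x. cinner x (r i)"])
    fix u v assume "u \<in> F" "v \<in> F"
    then show "mat_of X u v = (\<Sum>k\<in>F. of_real (qf X (r k)) * cinner u (r k) * cnj (cinner v (r k)))"
      using r(2)[of u] r(2)[of v] pr_basis[OF E F]
      by (intro mat_of_expansion[OF op_pos_bounded_ops[OF X] r(1) F(1)]) auto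
  qed (rule op_pos_qf[OF X])
qed

lemma schur_op_nonneg:
  assumes E: "orthonormal_basis E" and F: "finite F" "F \<subseteq> E" and X: "op_pos X" and Y: "op_pos Y"
  shows "0 \<le> Re (qform F (\<lambda>u v. mat_of X u v * mat_of Y u v) c)"
proof -
  obtain m and s :: "'a \<Rightarrow> 'a \<Rightarrow> complex" where "\<And>k. k \<in> F \<Longrightarrow> 0 \<le> m k"
    "\<And>u v. u \<in> F \<Longrightarrow> v \<in> F \<Longrightarrow> mat_of Y u v = (\<Sum>k\<in>F. of_real (m k) * s k u * cnj (s k v))"
    using op_pos_decomposition[OF E F Y] by blast
  then show ?thesis
    by (intro schur_product_nonneg) (auto simp: qform_mat_of op_pos_bounded_ops X op_pos_qf)
qed

text \<open>The factors are increased one at a time; the difference is the sum of the Schur products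
  of \<open>X' - X\<close> with \<open>Y\<close> and of \<open>X'\<close> with
  \<open>Y' - Y\<close>.\<close>

lemma schur_op_mono:
  assumes E: "orthonormal_basis E" and F: "finite F" "F \<subseteq> E"
    and pos: "op_pos X" "op_pos Y" "op_pos X'" "op_pos Y'"
    and le: "\<And>x. qf X x \<le> qf X' x" "\<And>x. qf Y x \<le> qf Y' x"
  shows "Re (qform F (\<lambda>u v. mat_of X u v * mat_of Y u v) c)
    \<le> Re (qform F (\<lambda>u v. mat_of X' u v * mat_of Y' u v) c)"
proof -
  have "op_pos (X' - X)" "op_pos (Y' - Y)"
    using op_le_iff[OF pos(1,3)] op_le_iff[OF pos(2,4)] le by (auto simp: op_le_def)
  then have "0 \<le> Re (qform F (\<lambda>u v. mat_of (X' - X) u v * mat_of Y u v) c)"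
    "0 \<le> Re (qform F (\<lambda>u v. mat_of X' u v * mat_of (Y' - Y) u v) c)"
    using pos by (auto intro: schur_op_nonneg[OF E F])
  moreover have "mat_of (X' - X) u v * mat_of Y u v = mat_of X' u v * mat_of Y u v - mat_of X u v * mat_of Y u v"
    "mat_of X' u v * mat_of (Y' - Y) u v = mat_of X' u v * mat_of Y' u v - mat_of X' u v * mat_of Y u v"
    for u v by (auto simp: mat_of_def blinfun.diff_left cinner_simps algebra_simps)
  ultimately show ?thesis by (simp add: qform_diff)
qed

text \<open>A multiple of the identity leaves only the diagonal of the other factor.\<close>

lemma schur_scalar:
  assumes E: "orthonormal_basis E" and F: "finite F" "F \<subseteq> E"
  shows "Re (qform F (\<lambda>u v. mat_of (a *\<^sub>R id_blinfun) u v * mat_of Y u v) c) =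
    a * (\<Sum>u\<in>F. (cmod (c u))\<^sup>2 * qf Y u)"
proof -
  have "qform F (\<lambda>u v. mat_of (a *\<^sub>R id_blinfun) u v * mat_of Y u v) c =
      (\<Sum>u\<in>F. \<Sum>v\<in>F. if u = v then of_real (a * (cmod (c u))\<^sup>2) * mat_of Y u u else 0)"
    unfolding qform_def
  proof (intro sum.cong refl)
    fix u v assume "u \<in> F" "v \<in> F"
    then have "cinner u v = (if u = v then 1 else 0)" using F by (intro onb_cinner[OF E]) auto
    then show "c u * cnj (c v) * (mat_of (a *\<^sub>R id_blinfun) u v * mat_of Y u v) =
        (if u = v then of_real (a * (cmod (c u))\<^sup>2) * mat_of Y u u else 0)"
      unfolding of_real_mult complex_norm_square mat_of_scaleR by (simp add: mat_of_def)
  qed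
  also have "\<dots> = (\<Sum>u\<in>F. of_real (a * (cmod (c u))\<^sup>2) * mat_of Y u u)" using F(1) by simp
  finally show ?thesis
    by (simp add: mat_of_def qf_def sum_distrib_left mult.assoc del: of_real_mult of_real_power)
qed

lemma qf_basis_le:
  assumes E: "orthonormal_basis E" and u: "u \<in> E"
  shows "qf Y u \<le> norm Y" "norm u = 1"
proof -
  have "Re (cinner u u) = 1" using onb_cinner[OF E u u] by simp
  then show "norm u = 1" using norm_ge_zero[of u] by (simp add: power2_eq_1_iff)
  then show "qf Y u \<le> norm Y" using qf_le_norm[of Y u] by simp
qed

text \<open>\<open>X\<close> is replaced by the larger \<open>norm X\<close> times the identity,
  after which only the diagonal of \<open>Y\<close> counts.\<close>

lemma schur_op_le:
  assumes E: "orthonormal_basis E" and F: "finite F" "F \<subseteq> E" and X: "op_pos X" and Y: "op_pos Y"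
  shows "Re (qform F (\<lambda>u v. mat_of X u v * mat_of Y u v) c) \<le> norm X * norm Y * (\<Sum>u\<in>F. (cmod (c u))\<^sup>2)"
proof -
  have "Re (qform F (\<lambda>u v. mat_of X u v * mat_of Y u v) c)
      \<le> Re (qform F (\<lambda>u v. mat_of (norm X *\<^sub>R id_blinfun) u v * mat_of Y u v) c)"
    by (intro schur_op_mono[OF E F X Y _ Y] op_pos_scaleR op_pos_id)
      (auto simp: qf_simps qf_le_norm)
  also have "\<dots> = norm X * (\<Sum>u\<in>F. (cmod (c u))\<^sup>2 * qf Y u)" by (rule schur_scalar[OF E F])
  also have "\<dots> \<le> norm X * (\<Sum>u\<in>F. (cmod (c u))\<^sup>2 * norm Y)"
    using qf_basis_le(1)[OF E] F by (intro mult_left_mono sum_mono) auto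
  finally show ?thesis unfolding sum_distrib_right[symmetric] by (simp add: mult_ac)
qed

lemma qf_le_dense:
  assumes E: "orthonormal_basis E"
    and le: "\<And>F c. finite F \<Longrightarrow> F \<subseteq> E \<Longrightarrow> qf X (\<Sum>u\<in>F. c u *\<^sub>C u) \<le> qf Y (\<Sum>u\<in>F. c u *\<^sub>C u)"
  shows "qf X x \<le> qf Y x"
proof -
  have "x \<in> closure {\<Sum>u\<in>F. c u *\<^sub>C u | F c. finite F \<and> F \<subseteq> E}"
    using E by (simp add: orthonormal_basis_def)
  also have "\<dots> \<subseteq> {x. qf X x \<le> qf Y x}"
  proof (rule closure_minimal)
    show "closed {x. qf X x \<le> qf Y x}" unfolding qf_def
      by (intro closed_Collect_le continuous_intros bounded_bilinear.continuous_on[OF bounded_bilinear_cinner])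
  qed (use le in auto)
  finally show ?thesis by simp
qed

text \<open>Independence of the bound from \<open>H\<close> is the point, since this makes the
  infinite Hadamard product bounded. It comes from positivity: the section is a positive operator,
  whose norm is controlled by its quadratic form.\<close>

lemma schur_section:
  fixes X Y :: "'h::chilbert_space \<Rightarrow>\<^sub>L 'h"
  assumes E: "orthonormal_basis E" and H: "finite H" "H \<subseteq> E" and X: "op_pos X" and Y: "op_pos Y"
  shows "(norm (\<Sum>v\<in>H. (\<Sum>u\<in>H. cinner x u * (mat_of X u v * mat_of Y u v)) *\<^sub>C v)) \<le> norm X * norm Y * norm x"
proof -
  define P where "P u v = mat_of X u v * mat_of Y u v" for u v
  define g where "g x = (\<Sum>v\<in>H. (\<Sum>u\<in>H. cinner x u * P u v) *\<^sub>C v)" for x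
  obtain Z where Z: "Z \<in> bounded_ops" "blinfun_apply Z = g"
  proof (rule bounded_opsE)
    show "g (x + y) = g x + g y" for x y
      by (simp add: g_def cinner_simps distrib_right sum.distrib scaleC_add_left)
    show "g (c *\<^sub>C x) = c *\<^sub>C g x" for c x
      by (simp add: g_def cinner_simps scaleC_sum_right scaleC_scaleC sum_distrib_left mult.assoc)
    \<comment> \<open>This bound may grow with \<open>H\<close>; it serves to establish that
      \<open>g\<close> is a bounded operator at all.\<close>
    show "norm (g x) \<le> (\<Sum>v\<in>H. \<Sum>u\<in>H. cmod (P u v)) * norm x" for x
    proof -
      have "norm (g x) \<le> (\<Sum>v\<in>H. cmod (\<Sum>u\<in>H. cinner x u * P u v) * norm v)"
        unfolding g_def by (rule order_trans[OF norm_sum]) simp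
      also have "\<dots> \<le> (\<Sum>v\<in>H. \<Sum>u\<in>H. norm x * cmod (P u v))"
      proof (rule sum_mono)
        fix v assume v: "v \<in> H"
        have "cmod (\<Sum>u\<in>H. cinner x u * P u v) \<le> (\<Sum>u\<in>H. cmod (cinner x u * P u v))" by (rule norm_sum)
        also have "\<dots> \<le> (\<Sum>u\<in>H. norm x * cmod (P u v))"
        proof (rule sum_mono)
          fix u assume "u \<in> H"
          then have "norm u = 1" using qf_basis_le(2)[OF E] H by auto
          then have "cmod (cinner x u) \<le> norm x" using cauchy_schwarz[of x u] by simp
          then show "cmod (cinner x u * P u v) \<le> norm x * cmod (P u v)"
            by (simp add: norm_mult mult_right_mono)
        qed
        finally show "cmod (\<Sum>u\<in>H. cinner x u * P u v) * norm v \<le> (\<Sum>u\<in>H. norm x * cmod (P u v))"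
          using qf_basis_le(2)[OF E, of v] v H by auto
      qed
      finally show ?thesis by (simp add: sum_distrib_left[symmetric] mult.commute)
    qed
  qed blast
  have herm: "cnj (P u v) = P v u" for u v
    unfolding P_def using mat_of_hermitian[OF X, of v u] mat_of_hermitian[OF Y, of v u] by simp
  have Zq: "cinner (g x) y = (\<Sum>v\<in>H. \<Sum>u\<in>H. cinner x u * cnj (cinner y v) * P u v)" for x y
    unfolding g_def cinner_sum_left cinner_scaleC_left sum_distrib_right
    using cinner_commute[of _ y] by (intro sum.cong refl) (simp add: mult_ac)
  have sa: "cinner (g x) y = cinner x (g y)" for x y
  proof -
    have "cinner x (g y) = cnj (cinner (g y) x)" by (rule cinner_commute)
    also have "\<dots> = (\<Sum>v\<in>H. \<Sum>u\<in>H. cinner x v * cnj (cinner y u) * P v u)"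
      unfolding Zq cnj_sum by (intro sum.cong refl) (simp add: herm mult_ac)
    also have "\<dots> = cinner (g x) y" unfolding Zq by (rule sum.swap)
    finally show ?thesis by simp
  qed
  have qZ: "qf Z x = Re (qform H P (cinner x))" for x
    unfolding qf_def Z(2) Zq qform_def by (subst sum.swap) simp
  have "op_pos Z"
    by (intro op_posI Z(1)) (auto simp: Z(2) sa qZ schur_op_nonneg[OF E H X Y, folded P_def])
  moreover have "qf Z x \<le> (norm X * norm Y) * (norm x)\<^sup>2" for x
  proof -
    have "qf Z x \<le> norm X * norm Y * (\<Sum>u\<in>H. (cmod (cinner x u))\<^sup>2)"
      unfolding qZ by (rule schur_op_le[OF E H X Y, folded P_def])
    also have "\<dots> \<le> norm X * norm Y * (norm x)\<^sup>2" by (intro mult_left_mono bessel[OF E H]) auto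
    finally show ?thesis .
  qed
  ultimately have "norm (Z x) \<le> norm X * norm Y * norm x"
    by (rule op_pos_norm_le) simp
  then show ?thesis by (simp add: Z(2) g_def P_def)
qed

section \<open>The Hadamard product of operators\<close>

text \<open>For fixed \<open>v\<close> the entries \<open>P u v\<close> are square summable, so
  Riesz-Fischer yields \<open>w v\<close>, the value of the adjoint at \<open>v\<close>. The uniform
  bound on finite sections, carried over by density, then gives an operator with these
  coefficients.\<close>

lemma hadamard_exists:
  fixes X Y :: "'h::chilbert_space \<Rightarrow>\<^sub>L 'h"
  assumes E: "orthonormal_basis E" and X: "op_pos X" and Y: "op_pos Y"
  shows "\<exists>Z\<in>bounded_ops. \<forall>u\<in>E. \<forall>v\<in>E. cinner (Z u) v =
        cinner (X u) v * cinner (Y u) v"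
proof -
  define P where "P u v = mat_of X u v * mat_of Y u v" for u v
  define M where "M = norm X * norm Y"
  have "\<exists>w. \<forall>u\<in>E. cinner w u = cnj (P u v)" if v: "v \<in> E" for v
  proof (rule riesz_fischer[OF E])
    fix F assume F: "finite F" "F \<subseteq> E"
    have "(\<Sum>u\<in>F. (cmod (cnj (P u v)))\<^sup>2) \<le> (\<Sum>u\<in>F. (cmod (cinner (X v) u))\<^sup>2 * (norm Y)\<^sup>2)"
    proof (rule sum_mono)
      fix u assume "u \<in> F"
      then have u: "u \<in> E" using F by auto
      have "cmod (mat_of Y u v) \<le> norm (Y u) * norm v"
        unfolding mat_of_def by (rule cauchy_schwarz)
      also have "\<dots> \<le> norm Y"
        using norm_blinfun[of Y u] qf_basis_le(2)[OF E u] qf_basis_le(2)[OF E v] by simp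
      finally have "(cmod (mat_of Y u v))\<^sup>2 \<le> (norm Y)\<^sup>2" by (intro power_mono) auto
      moreover have "cmod (mat_of X u v) = cmod (cinner (X v) u)"
        using mat_of_hermitian[OF X, of u v] by (simp add: mat_of_def)
      ultimately show "(cmod (cnj (P u v)))\<^sup>2 \<le> (cmod (cinner (X v) u))\<^sup>2 * (norm Y)\<^sup>2"
        by (simp add: P_def norm_mult power_mult_distrib mult_left_mono)
    qed
    also have "\<dots> \<le> (norm (X v))\<^sup>2 * (norm Y)\<^sup>2"
      unfolding sum_distrib_right[symmetric] by (intro mult_right_mono bessel[OF E F]) auto
    finally show "(\<Sum>u\<in>F. (cmod (cnj (P u v)))\<^sup>2) \<le> (norm (X v))\<^sup>2 * (norm Y)\<^sup>2" .
  qed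
  then obtain w where w: "\<And>u v. u \<in> E \<Longrightarrow> v \<in> E \<Longrightarrow> cinner (w v) u = cnj (P u v)" by metis
  have w': "cinner u (w v) = P u v" if "u \<in> E" "v \<in> E" for u v
    using w[OF that] cinner_commute[of u "w v"] by simp
  have bnd: "(\<Sum>v\<in>F. (cmod (cinner x (w v)))\<^sup>2) \<le> (M * norm x)\<^sup>2" if F: "finite F" "F \<subseteq> E" for F x
  proof -
    have "x \<in> closure {\<Sum>u\<in>G. c u *\<^sub>C u | G c. finite G \<and> G \<subseteq> E}"
      using E by (simp add: orthonormal_basis_def)
    also have "\<dots> \<subseteq> {x. (\<Sum>v\<in>F. (cmod (cinner x (w v)))\<^sup>2) \<le> (M * norm x)\<^sup>2}"
    proof (rule closure_minimal)
      show "closed {x. (\<Sum>v\<in>F. (cmod (cinner x (w v)))\<^sup>2) \<le> (M * norm x)\<^sup>2}"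
        by (intro closed_Collect_le continuous_intros bounded_bilinear.continuous_on[OF bounded_bilinear_cinner])
      show "{\<Sum>u\<in>G. c u *\<^sub>C u | G c. finite G \<and> G \<subseteq> E} \<subseteq> {x. (\<Sum>v\<in>F. (cmod (cinner x (w v)))\<^sup>2) \<le> (M * norm x)\<^sup>2}"
      proof safe
        fix G c assume G: "finite G" "G \<subseteq> E"
        define x where "x = (\<Sum>u\<in>G. c u *\<^sub>C u)"
        \<comment> \<open>Large enough for both the tested indices \<open>F\<close> and the support
          \<open>G\<close> of \<open>x\<close>, so that the section on \<open>?H\<close> computes
          the coefficients exactly.\<close>
        let ?H = "F \<union> G"
        have H: "finite ?H" "?H \<subseteq> E" using F G by auto
        have xc: "cinner x u = (if u \<in> G then c u else 0)" if "u \<in> E" for u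
          unfolding x_def by (rule onb_coeff[OF E G that])
        define d where "d v = (\<Sum>u\<in>?H. cinner x u * P u v)" for v
        have "cinner x (w v) = d v" if "v \<in> E" for v
        proof -
          have "cinner x (w v) = (\<Sum>u\<in>G. c u * P u v)"
            unfolding x_def cinner_sum_left using G w' that by (intro sum.cong) (auto simp: cinner_simps)
          also have "\<dots> = (\<Sum>u\<in>G. cinner x u * P u v)" using G xc by (intro sum.cong) auto
          also have "\<dots> = d v" unfolding d_def
            using H xc by (intro sum.mono_neutral_left) (auto simp: subset_iff)
          finally show ?thesis .
        qed
        then have "(\<Sum>v\<in>F. (cmod (cinner x (w v)))\<^sup>2) = (\<Sum>v\<in>F. (cmod (d v))\<^sup>2)"
          using F by (intro sum.cong) auto
        also have "\<dots> \<le> (\<Sum>v\<in>?H. (cmod (d v))\<^sup>2)" using H by (intro sum_mono2) auto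
        also have "\<dots> = (norm (\<Sum>v\<in>?H. d v *\<^sub>C v))\<^sup>2" by (rule onb_norm_sq[OF E H, symmetric])
        also have "\<dots> \<le> (M * norm x)\<^sup>2"
          using schur_section[OF E H X Y, of x] unfolding d_def P_def M_def
          by (intro power_mono) auto
        finally show "(\<Sum>v\<in>F. (cmod (cinner (\<Sum>u\<in>G. c u *\<^sub>C u) (w v)))\<^sup>2) \<le> (M * norm (\<Sum>u\<in>G. c u *\<^sub>C u))\<^sup>2"
          by (simp only: x_def)
      qed
    qed
    finally show ?thesis by simp
  qed
  have M0: "0 \<le> M" by (simp add: M_def)
  obtain Z where "Z \<in> bounded_ops" "\<And>x v. v \<in> E \<Longrightarrow> cinner (Z x) v = cinner x (w v)"
  proof (rule op_from_coeffs[OF E, of "\<lambda>v x. cinner x (w v)" M])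
    show "(\<Sum>v\<in>F. (cmod (cinner x (w v)))\<^sup>2) \<le> (M * norm x)\<^sup>2" if "finite F" "F \<subseteq> E" for F x
      by (rule bnd[OF that])
  qed (auto simp: cinner_simps M0)
  then show ?thesis using w' by (intro bexI[of _ Z]) (auto simp: P_def mat_of_def)
qed

lemma hadamard_props:
  assumes E: "orthonormal_basis E" and X: "op_pos X" and Y: "op_pos Y"
  shows hadamard_bounded_ops: "hadamard E X Y \<in> bounded_ops"
    and mat_of_hadamard: "u \<in> E \<Longrightarrow> v \<in> E \<Longrightarrow> mat_of (hadamard E X Y) u v = mat_of X u v * mat_of Y u v"
proof -
  obtain Z where Z: "Z \<in> bounded_ops" "\<forall>u\<in>E. \<forall>v\<in>E. cinner (Z u) v =
        cinner (X u) v * cinner (Y u) v"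
    using hadamard_exists[OF E X Y] by blast
  have "hadamard E X Y = Z" unfolding hadamard_def
  proof (rule the_equality)
    fix Z' assume Z': "Z' \<in> bounded_ops \<and> (\<forall>u\<in>E. \<forall>v\<in>E. cinner (Z' u) v =
        cinner (X u) v * cinner (Y u) v)"
    have eq: "Z' u = Z u" if "u \<in> E" for u
      by (rule onb_eqI[OF E]) (use Z Z' that in auto)
    show "Z' = Z"
    proof (rule blinfun_eqI)
      fix x
      have "x \<in> {x. Z' x = Z x}"
      proof (rule onb_dense_induct[OF E])
        show "closed {x. Z' x = Z x}"
          by (intro closed_Collect_eq continuous_intros)
      qed (use Z Z' eq in \<open>auto simp: csubspace_def blinfun.add_right bounded_ops_scaleC\<close>)
      then show "Z' x = Z x" by simp
    qed
  qed (use Z in auto)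
  with Z show "hadamard E X Y \<in> bounded_ops"
    "u \<in> E \<Longrightarrow> v \<in> E \<Longrightarrow> mat_of (hadamard E X Y) u v = mat_of X u v * mat_of Y u v"
    by (auto simp: mat_of_def)
qed

lemma qf_hadamard:
  assumes E: "orthonormal_basis E" and X: "op_pos X" and Y: "op_pos Y" and F: "F \<subseteq> E"
  shows "qf (hadamard E X Y) (\<Sum>u\<in>F. c u *\<^sub>C u) = Re (qform F (\<lambda>u v. mat_of X u v * mat_of Y u v) c)"
  unfolding qform_mat_of[OF hadamard_bounded_ops[OF E X Y], symmetric]
  using F mat_of_hadamard[OF E X Y] by (intro arg_cong[of _ _ Re] qform_cong) auto

lemma hadamard_pos:
  assumes E: "orthonormal_basis E" and X: "op_pos X" and Y: "op_pos Y"
  shows "op_pos (hadamard E X Y)"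
proof (rule op_posI[OF hadamard_bounded_ops[OF assms]])
  fix x y
  show "cinner ((hadamard E X Y) x) y = cinner x ((hadamard E X Y) y)"
  proof (rule op_selfadjoint_onbI[OF E])
    fix u v assume uv: "u \<in> E" "v \<in> E"
    have "cinner ((hadamard E X Y) u) v = cnj (cinner ((hadamard E X Y) v) u)"
      using mat_of_hadamard[OF assms uv] mat_of_hadamard[OF assms uv(2,1)]
        mat_of_hermitian[OF X, of u v] mat_of_hermitian[OF Y, of u v]
      by (simp add: mat_of_def)
    then show "cinner ((hadamard E X Y) u) v = cinner u ((hadamard E X Y) v)"
      by (metis cinner_commute)
  qed (rule hadamard_bounded_ops[OF assms])+
  have "qf 0 x \<le> qf (hadamard E X Y) x"
    by (rule qf_le_dense[OF E])
      (simp add: qf_hadamard[OF assms] qf_zero schur_op_nonneg[OF E _ _ X Y])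
  then show "0 \<le> qf (hadamard E X Y) x" by (simp add: qf_zero)
qed

lemma hadamard_mono:
  assumes E: "orthonormal_basis E"
    and pos: "op_pos X" "op_pos Y" "op_pos X'" "op_pos Y'"
    and le: "\<And>x. qf X x \<le> qf X' x" "\<And>x. qf Y x \<le> qf Y' x"
  shows "qf (hadamard E X Y) x \<le> qf (hadamard E X' Y') x"
  by (rule qf_le_dense[OF E]) (simp add: qf_hadamard[OF E] pos schur_op_mono[OF E _ _ pos le])

text \<open>Replacing \<open>X\<close> by \<open>a\<close> times the identity keeps only the
  diagonal of \<open>Y\<close>, which is at least \<open>b\<close>. Strict positivity of Hadamard
  products is deduced from this.\<close>

lemma hadamard_lower_bound:
  assumes E: "orthonormal_basis E" and X: "op_pos X" and Y: "op_pos Y" and ab: "0 \<le> a" "0 \<le> b"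
    and le: "\<And>x. a * (norm x)\<^sup>2 \<le> qf X x" "\<And>x. b * (norm x)\<^sup>2 \<le> qf Y x"
  shows "a * b * (norm x)\<^sup>2 \<le> qf (hadamard E X Y) x"
proof -
  have "qf ((a * b) *\<^sub>R id_blinfun) x \<le> qf (hadamard E X Y) x"
  proof (rule qf_le_dense[OF E])
    fix F c assume F: "finite F" "F \<subseteq> E"
    have "qf ((a * b) *\<^sub>R id_blinfun) (\<Sum>u\<in>F. c u *\<^sub>C u) = a * (\<Sum>u\<in>F. (cmod (c u))\<^sup>2 * b)"
      unfolding qf_scaleR qf_id onb_norm_sq[OF E F] sum_distrib_right[symmetric] by simp
    also have "\<dots> \<le> a * (\<Sum>u\<in>F. (cmod (c u))\<^sup>2 * qf Y u)"
    proof (intro mult_left_mono sum_mono ab)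
      fix u assume "u \<in> F"
      then show "b \<le> qf Y u" using le(2)[of u] qf_basis_le(2)[OF E, of u] F by auto
    qed auto
    also have "\<dots> = Re (qform F (\<lambda>u v. mat_of (a *\<^sub>R id_blinfun) u v * mat_of Y u v) c)"
      by (rule schur_scalar[OF E F, symmetric])
    also have "\<dots> \<le> Re (qform F (\<lambda>u v. mat_of X u v * mat_of Y u v) c)"
      using le ab by (intro schur_op_mono[OF E F] X Y op_pos_scaleR op_pos_id) (auto simp: qf_simps)
    finally show "qf ((a * b) *\<^sub>R id_blinfun) (\<Sum>u\<in>F. c u *\<^sub>C u) \<le> qf (hadamard E X Y) (\<Sum>u\<in>F. c u *\<^sub>C u)"
      by (simp add: qf_hadamard[OF E X Y F(2)])
  qed
  then show ?thesis by (simp add: qf_simps)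
qed

text \<open>When the product is expanded, both correction terms contain a multiple of the identity
  and see only diagonals, which the norms bound. Shifting the factors thus costs one scalar shift
  that vanishes with \<epsilon>.\<close>

lemma hadamard_shift_le:
  assumes E: "orthonormal_basis E" and X: "op_pos X" and Y: "op_pos Y" and \<epsilon>: "0 \<le> \<epsilon>"
  shows "qf (hadamard E (X + \<epsilon> *\<^sub>R id_blinfun) (Y + \<epsilon> *\<^sub>R id_blinfun)) x \<le>
    qf (hadamard E X Y + (\<epsilon> * (norm X + norm Y + \<epsilon>)) *\<^sub>R id_blinfun) x"
proof (rule qf_le_dense[OF E])
  fix F c assume F: "finite F" "F \<subseteq> E"
  let ?q = "\<lambda>X Y. Re (qform F (\<lambda>u v. mat_of X u v * mat_of Y u v) c)"
  let ?I = "\<epsilon> *\<^sub>R id_blinfun :: 'a \<Rightarrow>\<^sub>L 'a"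
  have pos: "op_pos (X + ?I)" "op_pos (Y + ?I)"
    using X Y \<epsilon> by (auto intro: op_pos_add op_pos_scaleR op_pos_id)
  have "?q (X + ?I) (Y + ?I) = ?q X Y + ?q ?I Y + ?q ?I (X + ?I)"
    by (simp add: qform_def mat_of_add sum.distrib algebra_simps)
  also have "?q ?I Y = \<epsilon> * (\<Sum>u\<in>F. (cmod (c u))\<^sup>2 * qf Y u)" by (rule schur_scalar[OF E F])
  also have "?q ?I (X + ?I) = \<epsilon> * (\<Sum>u\<in>F. (cmod (c u))\<^sup>2 * qf (X + ?I) u)" by (rule schur_scalar[OF E F])
  also have "(\<Sum>u\<in>F. (cmod (c u))\<^sup>2 * qf Y u) \<le> (\<Sum>u\<in>F. (cmod (c u))\<^sup>2 * norm Y)"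
    using qf_basis_le(1)[OF E] F by (intro sum_mono mult_left_mono) auto
  also have "(\<Sum>u\<in>F. (cmod (c u))\<^sup>2 * qf (X + ?I) u) \<le> (\<Sum>u\<in>F. (cmod (c u))\<^sup>2 * (norm X + \<epsilon>))"
    using qf_basis_le[OF E] F by (intro sum_mono mult_left_mono) (auto simp: qf_simps subset_iff)
  finally have "?q (X + ?I) (Y + ?I) \<le> ?q X Y + \<epsilon> * (\<Sum>u\<in>F. (cmod (c u))\<^sup>2 * norm Y)
      + \<epsilon> * (\<Sum>u\<in>F. (cmod (c u))\<^sup>2 * (norm X + \<epsilon>))"
    using \<epsilon> by (simp add: mult_left_mono)
  also have "\<dots> = ?q X Y + \<epsilon> * (norm X + norm Y + \<epsilon>) * (\<Sum>u\<in>F. (cmod (c u))\<^sup>2)"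
    unfolding sum_distrib_right[symmetric] by (simp add: algebra_simps)
  finally show "qf (hadamard E (X + ?I) (Y + ?I)) (\<Sum>u\<in>F. c u *\<^sub>C u)
      \<le> qf (hadamard E X Y + (\<epsilon> * (norm X + norm Y + \<epsilon>)) *\<^sub>R id_blinfun) (\<Sum>u\<in>F. c u *\<^sub>C u)"
    by (simp add: qf_simps qf_hadamard[OF E X Y F(2)] qf_hadamard[OF E pos F(2)] onb_norm_sq[OF E F])
qed

section \<open>Finite sections of a mean\<close>

text \<open>Exchanging the two families of vectors gives the adjoint, which the transformer
  inequality asks for.\<close>

lemma finite_rank_operator:
  fixes a b :: "'i \<Rightarrow> 'h::chilbert_space"
  obtains S S' where "S \<in> bounded_ops" "S' \<in> bounded_ops"
    "\<And>x. S x = (\<Sum>i\<in>I. cinner x (a i) *\<^sub>C b i)"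
    "\<And>x y. cinner (S x) y = cinner x (S' y)"
proof -
  have ex: "\<exists>S\<in>bounded_ops. \<forall>x. S x = (\<Sum>i\<in>I. cinner x (a i) *\<^sub>C b i)"
    for a b :: "'i \<Rightarrow> 'h"
  proof -
    define g where "g x = (\<Sum>i\<in>I. cinner x (a i) *\<^sub>C b i)" for x
    obtain S where S: "S \<in> bounded_ops" "blinfun_apply S = g"
    proof (rule bounded_opsE)
      show "g (x + y) = g x + g y" for x y by (simp add: g_def cinner_simps scaleC_add_left sum.distrib)
      show "g (c *\<^sub>C x) = c *\<^sub>C g x" for c x by (simp add: g_def cinner_simps scaleC_sum_right scaleC_scaleC)
      show "norm (g x) \<le> (\<Sum>i\<in>I. norm (a i) * norm (b i)) * norm x" for x
      proof -
        have "norm (g x) \<le> (\<Sum>i\<in>I. cmod (cinner x (a i)) * norm (b i))"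
          unfolding g_def by (rule order_trans[OF norm_sum]) simp
        also have "\<dots> \<le> (\<Sum>i\<in>I. (norm x * norm (a i)) * norm (b i))"
          by (intro sum_mono mult_right_mono cauchy_schwarz) auto
        finally show ?thesis unfolding sum_distrib_right by (simp add: mult_ac)
      qed
    qed blast
    then show ?thesis by (intro bexI[of _ S]) (simp_all add: S(2) g_def)
  qed
  obtain S where S: "S \<in> bounded_ops" "\<And>x. S x = (\<Sum>i\<in>I. cinner x (a i) *\<^sub>C b i)"
    using ex[of a b] by auto
  obtain S' where S': "S' \<in> bounded_ops" "\<And>x. S' x = (\<Sum>i\<in>I. cinner x (b i) *\<^sub>C a i)"
    using ex[of b a] by auto
  have "cinner (S x) y = cinner x (S' y)" for x y
    unfolding S(2) S'(2) cinner_sum_left cinner_sum_right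
    by (intro sum.cong refl) (simp add: cinner_simps flip: cinner_commute)
  with S S' show thesis by (intro that[of S S']) auto
qed

text \<open>\<open>L\<close> acts as \<open>l u\<close> on each \<open>u\<close> in \<open>F\<close>
  and as the identity on the orthogonal complement, which keeps it invertible in infinite
  dimension.\<close>

lemma diagonal_operator:
  fixes E F :: "'h::chilbert_space set" and l :: "'h \<Rightarrow> real"
  assumes E: "orthonormal_basis E" and F: "finite F" "F \<subseteq> E" and l: "\<And>u. u \<in> F \<Longrightarrow> 0 < l u"
  obtains L where "op_strictly_pos L" "\<And>u. u \<in> F \<Longrightarrow> L u = l u *\<^sub>R u"
    "\<And>x. (\<Sum>u\<in>F. l u * (cmod (cinner x u))\<^sup>2) \<le> qf L x"
    "\<And>c. qf L (\<Sum>u\<in>F. c u *\<^sub>C u) = (\<Sum>u\<in>F. l u * (cmod (c u))\<^sup>2)"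
proof -
  define L where "L = id_blinfun + (\<Sum>u\<in>F. (l u - 1) *\<^sub>R proj E {u})"
  have P: "(proj E {u}) x = cinner x u *\<^sub>C u" if "u \<in> F" for u x
    using proj_finite[OF E, of "{u}"] F that by (auto simp: pr_def)
  have L: "L x = x + (\<Sum>u\<in>F. (l u - 1) *\<^sub>R cinner x u *\<^sub>C u)" for x
    by (simp add: L_def blinfun.add_left blinfun.sum_left blinfun.scaleR_left P)
  have qL: "qf L x = (norm x)\<^sup>2 + (\<Sum>u\<in>F. (l u - 1) * (cmod (cinner x u))\<^sup>2)" for x
  proof -
    have "qf (\<Sum>u\<in>G. (l u - 1) *\<^sub>R proj E {u}) x = (\<Sum>u\<in>G. (l u - 1) * (cmod (cinner x u))\<^sup>2)"
      if "G \<subseteq> F" for G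
      using finite_subset[OF that F(1)] that
    proof (induction G rule: finite_induct)
      case (insert u G)
      have "norm u = 1" using insert F qf_basis_le(2)[OF E, of u] by auto
      then show ?case using insert by (simp add: qf_simps proj_qf[OF E] P)
    qed (simp add: qf_zero)
    then show ?thesis by (simp add: L_def qf_simps)
  qed
  have qL': "qf L x = ((norm x)\<^sup>2 - (\<Sum>u\<in>F. (cmod (cinner x u))\<^sup>2)) + (\<Sum>u\<in>F. l u * (cmod (cinner x u))\<^sup>2)" for x
    by (simp add: qL left_diff_distrib sum_subtractf)
  \<comment> \<open>The 1 is the lower bound on the complement and also keeps the set
    nonempty.\<close>
  define c where "c = Min (insert 1 (l ` F))"
  have c: "0 < c" "c \<le> 1" "\<And>u. u \<in> F \<Longrightarrow> c \<le> l u"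
    using F(1) l by (auto simp: c_def)
  have lower: "c * (norm x)\<^sup>2 \<le> qf L x" for x
  proof -
    have "c * ((norm x)\<^sup>2 - (\<Sum>u\<in>F. (cmod (cinner x u))\<^sup>2)) \<le> 1 * ((norm x)\<^sup>2 - (\<Sum>u\<in>F. (cmod (cinner x u))\<^sup>2))"
      using bessel[OF E F, of x] c by (intro mult_right_mono) auto
    moreover have "c * (\<Sum>u\<in>F. (cmod (cinner x u))\<^sup>2) \<le> (\<Sum>u\<in>F. l u * (cmod (cinner x u))\<^sup>2)"
      unfolding sum_distrib_left using c by (intro sum_mono mult_right_mono) auto
    ultimately show ?thesis by (simp add: qL' algebra_simps)
  qed
  have LB: "L \<in> bounded_ops"
  proof -
    have "0 \<in> bounded_ops" by (simp add: bounded_ops_def)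
    then have "(\<Sum>u\<in>G. (l u - 1) *\<^sub>R proj E {u}) \<in> bounded_ops" for G
      by (induction G rule: infinite_finite_induct)
        (auto intro: bounded_ops_add bounded_ops_scaleR proj_bounded_ops[OF E])
    then show ?thesis unfolding L_def by (intro bounded_ops_add bounded_ops_id)
  qed
  have "op_pos L"
  proof (rule op_posI[OF LB])
    show "cinner (L x) y = cinner x (L y)" for x y
      unfolding L cinner_add_left cinner_add_right cinner_sum_left cinner_sum_right
      by (intro arg_cong2[of _ _ _ _ "(+)"] refl sum.cong) (simp add: cinner_simps flip: cinner_commute)
    show "0 \<le> qf L x" for x using lower[of x] c(1) by (meson mult_nonneg_nonneg less_imp_le order_trans zero_le_power2)
  qed
  then have "op_strictly_pos L" by (rule op_strictly_posI[OF _ c(1) lower])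
  moreover have "L u = l u *\<^sub>R u" if u: "u \<in> F" for u
  proof -
    have "(\<Sum>v\<in>F. (l v - 1) *\<^sub>R cinner u v *\<^sub>C v) = (\<Sum>v\<in>F. if v = u then (l u - 1) *\<^sub>R u else 0)"
    proof (intro sum.cong refl)
      fix v assume "v \<in> F"
      then have "cinner u v = (if u = v then 1 else 0)" using u F by (intro onb_cinner[OF E]) auto
      then show "(l v - 1) *\<^sub>R cinner u v *\<^sub>C v = (if v = u then (l u - 1) *\<^sub>R u else 0)" by simp
    qed
    also have "\<dots> = (l u - 1) *\<^sub>R u" using F(1) u by simp
    finally show ?thesis unfolding L by (simp add: scaleR_diff_left)
  qed
  moreover have "(\<Sum>u\<in>F. l u * (cmod (cinner x u))\<^sup>2) \<le> qf L x" for x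
    using bessel[OF E F, of x] by (simp add: qL')
  moreover have "qf L (\<Sum>u\<in>F. c u *\<^sub>C u) = (\<Sum>u\<in>F. l u * (cmod (c u))\<^sup>2)" for c
  proof -
    have "cinner (\<Sum>u\<in>F. c u *\<^sub>C u) v = c v" if "v \<in> F" for v
      using onb_coeff[OF E F, of v c] F that by auto
    then show ?thesis by (simp add: qL' onb_norm_sq[OF E F])
  qed
  ultimately show thesis by (rule that)
qed

lemma qf_expansion:
  assumes X: "X \<in> bounded_ops" and F: "finite F"
    and d: "\<And>i j. i \<in> F \<Longrightarrow> j \<in> F \<Longrightarrow>
      cinner (X (r i)) (r j) = (if i = j then complex_of_real (m i) else 0)"
  shows "qf X (\<Sum>i\<in>F. c i *\<^sub>C r i) = (\<Sum>i\<in>F. m i * (cmod (c i))\<^sup>2)"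
proof -
  have "mat_of X (\<Sum>i\<in>F. c i *\<^sub>C r i) (\<Sum>i\<in>F. c i *\<^sub>C r i) = (\<Sum>i\<in>F. of_real (m i) * c i * cnj (c i))"
    by (rule mat_of_expansion[OF X d F, of _ "\<lambda>i _. c i"]) auto
  also have "\<dots> = complex_of_real (\<Sum>i\<in>F. m i * (cmod (c i))\<^sup>2)"
    by (simp only: of_real_sum of_real_mult complex_norm_square mult.assoc)
  finally show ?thesis by (simp add: qf_def mat_of_def)
qed

text \<open>The operator \<open>S\<close> sending the basis vectors in \<open>F\<close> to the
  \<open>r i\<close> pulls \<open>A\<close> back below the identity and \<open>C\<close> back below
  the diagonal \<open>L\<close>. The transformer inequality thus carries the question to the mean of
  the identity and \<open>L\<close>, whose values on the span of \<open>F\<close> are known.\<close>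

lemma mean_section_upper:
  fixes E F :: "'h::chilbert_space set" and A C :: "'h \<Rightarrow>\<^sub>L 'h"
  assumes E: "orthonormal_basis E" and \<sigma>: "operator_mean \<sigma>" and f: "representing_function \<sigma> f"
    and F: "finite F" "F \<subseteq> E" and pos: "op_strictly_pos A" "op_strictly_pos C"
    and rA: "\<And>i j. i \<in> F \<Longrightarrow> j \<in> F \<Longrightarrow> cinner (A (r i)) (r j) = (if i = j then 1 else 0)"
    and rC: "\<And>i j. i \<in> F \<Longrightarrow> j \<in> F \<Longrightarrow>
      cinner (C (r i)) (r j) = (if i = j then complex_of_real (l i) else 0)"
    and l: "\<And>i. i \<in> F \<Longrightarrow> 0 < l i"
  shows "qf (\<sigma> A C) (\<Sum>i\<in>F. x i *\<^sub>C r i) \<le> (\<Sum>i\<in>F. f (l i) * (cmod (x i))\<^sup>2)"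
proof -
  obtain L where L: "op_strictly_pos L" "\<And>u. u \<in> F \<Longrightarrow> L u = l u *\<^sub>R u"
    "\<And>x. (\<Sum>u\<in>F. l u * (cmod (cinner x u))\<^sup>2) \<le> qf L x"
    by (rule diagonal_operator[OF E F l]) (assumption | rule that)+
  obtain S S' where S: "S \<in> bounded_ops" "S' \<in> bounded_ops"
    "\<And>x. S x = (\<Sum>i\<in>F. cinner x i *\<^sub>C r i)"
    "\<And>x y. cinner (S x) y = cinner x (S' y)"
    by (rule finite_rank_operator[where I=F and a="\<lambda>i. i" and b=r]) (rule that)
  note B = pos[THEN op_strictly_pos_pos, THEN op_pos_bounded_ops]
  have "qf (\<sigma> A C) (S (\<Sum>i\<in>F. x i *\<^sub>C i)) \<le> qf (\<sigma> id_blinfun L) (\<Sum>i\<in>F. x i *\<^sub>C i)"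
  proof (rule mean_transformer[OF \<sigma> S(1,2,4) pos op_strictly_pos_id L(1)])
    fix z
    have "qf A (S z) = (\<Sum>i\<in>F. 1 * (cmod (cinner z i))\<^sup>2)"
      unfolding S(3) by (rule qf_expansion[OF B(1) F(1)]) (use rA in auto)
    then show "qf A (S z) \<le> qf id_blinfun z" using bessel[OF E F, of z] by simp
    have "qf C (S z) = (\<Sum>i\<in>F. l i * (cmod (cinner z i))\<^sup>2)"
      unfolding S(3) by (rule qf_expansion[OF B(2) F(1) rC])
    then show "qf C (S z) \<le> qf L z" using L(3) by simp
  qed
  moreover have "S (\<Sum>i\<in>F. x i *\<^sub>C i) = (\<Sum>i\<in>F. x i *\<^sub>C r i)"
    unfolding S(3) using onb_coeff[OF E F] F by (intro sum.cong) auto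
  ultimately show ?thesis using mean_id_diagonal[OF E \<sigma> f F L(1,2) l] by simp
qed

lemma pr_selfadjoint:
  assumes E: "orthonormal_basis E" and F: "finite F" "F \<subseteq> E"
  shows "cinner (pr F x) y = cinner x (pr F y)"
  using proj_selfadjoint[OF E, of F x y] by (simp add: proj_finite[OF E F])

text \<open>The coordinate map of the basis \<open>r\<close> reverses the map used in
  \<open>mean_section_upper\<close>: now the mean of the identity and \<open>L\<close> is pulled
  back below that of \<open>X'\<close> and \<open>Y'\<close>. Domination of the compressed pair is
  enough because \<open>S\<close> factors through \<open>pr F\<close>.\<close>

lemma mean_section_lower:
  fixes E F :: "'h::chilbert_space set" and X Y X' Y' :: "'h \<Rightarrow>\<^sub>L 'h"
  assumes E: "orthonormal_basis E" and \<sigma>: "operator_mean \<sigma>" and f: "representing_function \<sigma> f"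
    and F: "finite F" "F \<subseteq> E" and XY: "op_pos X" "op_pos Y"
    and pos: "op_strictly_pos X'" "op_strictly_pos Y'"
    and le: "\<And>z. qf X (pr F z) \<le> qf X' z" "\<And>z. qf Y (pr F z) \<le> qf Y' z"
    and rX: "\<And>i j. i \<in> F \<Longrightarrow> j \<in> F \<Longrightarrow> cinner (X (r i)) (r j) = (if i = j then 1 else 0)"
    and rY: "\<And>i j. i \<in> F \<Longrightarrow> j \<in> F \<Longrightarrow>
      cinner (Y (r i)) (r j) = (if i = j then complex_of_real (l i) else 0)"
    and rF: "\<And>x. pr F x = x \<Longrightarrow> x = (\<Sum>i\<in>F. cinner x (X (r i)) *\<^sub>C r i)"
    and l: "\<And>i. i \<in> F \<Longrightarrow> 0 < l i" and x: "pr F x = x"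
  shows "(\<Sum>i\<in>F. f (l i) * (cmod (cinner x (X (r i))))\<^sup>2) \<le> qf (\<sigma> X' Y') x"
proof -
  obtain L where L: "op_strictly_pos L" "\<And>u. u \<in> F \<Longrightarrow> L u = l u *\<^sub>R u"
    "\<And>c. qf L (\<Sum>u\<in>F. c u *\<^sub>C u) = (\<Sum>u\<in>F. l u * (cmod (c u))\<^sup>2)"
    by (rule diagonal_operator[OF E F l]) (assumption | rule that)+
  obtain S S' where S: "S \<in> bounded_ops" "S' \<in> bounded_ops"
    "\<And>z. S z = (\<Sum>i\<in>F. cinner z (pr F (X (r i))) *\<^sub>C i)"
    "\<And>x y. cinner (S x) y = cinner x (S' y)"
    by (rule finite_rank_operator[where I=F and a="\<lambda>i. pr F (X (r i))" and b="\<lambda>i. i"]) (rule that)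
  define s where "s z i = cinner (pr F z) (X (r i))" for z i
  have Sz: "S z = (\<Sum>i\<in>F. s z i *\<^sub>C i)" for z
    unfolding S(3) s_def pr_selfadjoint[OF E F] ..
  have prpr: "pr F (pr F z) = pr F z" for z
    using proj_proj[OF E, of F F z] by (simp add: proj_finite[OF E F])
  have prz: "pr F z = (\<Sum>i\<in>F. s z i *\<^sub>C r i)" for z
    unfolding s_def by (rule rF[OF prpr])
  have "qf (\<sigma> id_blinfun L) (S x) \<le> qf (\<sigma> X' Y') x"
  proof (rule mean_transformer[OF \<sigma> S(1,2,4) op_strictly_pos_id L(1) pos])
    fix z
    have "qf X (pr F z) = (\<Sum>i\<in>F. 1 * (cmod (s z i))\<^sup>2)"
      unfolding prz by (rule qf_expansion[OF op_pos_bounded_ops[OF XY(1)] F(1)]) (use rX in auto)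
    then show "qf id_blinfun (S z) \<le> qf X' z"
      using le(1)[of z] by (simp add: Sz onb_norm_sq[OF E F])
    have "qf Y (pr F z) = (\<Sum>i\<in>F. l i * (cmod (s z i))\<^sup>2)"
      unfolding prz by (rule qf_expansion[OF op_pos_bounded_ops[OF XY(2)] F(1) rY])
    then show "qf L (S z) \<le> qf Y' z" using le(2)[of z] by (simp add: Sz L(3))
  qed
  then show ?thesis using mean_id_diagonal[OF E \<sigma> f F L(1,2) l] by (simp add: Sz s_def x)
qed

section \<open>From finite sections to the operators\<close>

text \<open>The images of the finitely many basis vectors in \<open>F\<close> are nearly captured by
  finite sets, and the union of these works on the whole range of \<open>pr F\<close> by
  linearity.\<close>

lemma finite_section_step:
  fixes X Y :: "'h::chilbert_space \<Rightarrow>\<^sub>L 'h"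
  assumes E: "orthonormal_basis E" and XY: "X \<in> bounded_ops" "Y \<in> bounded_ops"
    and F: "finite F" "F \<subseteq> E" and e: "0 < e"
  shows "\<exists>G. finite G \<and> G \<subseteq> E \<and> F \<subseteq> G \<and> (\<forall>p. pr F p = p \<longrightarrow>
    norm (X p - pr G (X p)) \<le> e * norm p \<and>
    norm (Y p - pr G (Y p)) \<le> e * norm p)"
proof -
  \<comment> \<open>The error allowed per basis vector, as each coefficient of \<open>p\<close> is
    at most \<open>norm p\<close>; the 1 covers empty \<open>F\<close>.\<close>
  define \<eta> where "\<eta> = e / (real (card F) + 1)"
  have \<eta>: "0 < \<eta>" "real (card F) * \<eta> \<le> e" using e by (auto simp: \<eta>_def field_simps)
  have "\<forall>z. \<exists>H. finite H \<and> H \<subseteq> E \<and> norm (z - pr H z) < \<eta>"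
  proof
    fix z
    obtain H where "finite H" "H \<subseteq> E" "norm (z - pr H z) < \<eta>"
      by (rule onb_approx[OF E \<eta>(1), of z])
    then show "\<exists>H. finite H \<and> H \<subseteq> E \<and> norm (z - pr H z) < \<eta>" by blast
  qed
  then obtain H where "\<forall>z. finite (H z) \<and> H z \<subseteq> E \<and> norm (z - pr (H z) z) < \<eta>"
    by (rule choice[THEN exE])
  then have H: "finite (H z)" "H z \<subseteq> E" "norm (z - pr (H z) z) < \<eta>" for z by auto
  define G where "G = F \<union> (\<Union>u\<in>F. H (X u) \<union> H (Y u))"
  have G: "finite G" "G \<subseteq> E" using F H by (auto simp: G_def)
  have bound: "norm (Z p - pr G (Z p)) \<le> e * norm p"
    if Z: "Z \<in> bounded_ops" "\<And>u. u \<in> F \<Longrightarrow> H (Z u) \<subseteq> G" and p: "pr F p = p" for Z p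
  proof -
    have lin: "z - pr G z = (id_blinfun - proj E G) z" for z
      by (simp add: blinfun.diff_left proj_finite[OF E G])
    have B: "id_blinfun - proj E G \<in> bounded_ops"
      by (intro bounded_ops_diff bounded_ops_id proj_bounded_ops[OF E])
    have Zp: "Z p = (\<Sum>u\<in>F. cinner p u *\<^sub>C Z u)"
      by (subst (1) p[symmetric]) (simp add: pr_def bounded_ops_sum[OF Z(1)])
    have "norm (Z p - pr G (Z p)) =
        norm (\<Sum>u\<in>F. cinner p u *\<^sub>C (Z u - pr G (Z u)))"
      unfolding lin Zp bounded_ops_sum[OF B] ..
    also have "\<dots> \<le> (\<Sum>u\<in>F. cmod (cinner p u) * norm (Z u - pr G (Z u)))"
      by (rule order_trans[OF norm_sum]) simp
    also have "\<dots> \<le> (\<Sum>u\<in>F. norm p * \<eta>)"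
    proof (intro sum_mono mult_mono)
      fix u assume u: "u \<in> F"
      then show "cmod (cinner p u) \<le> norm p"
        using cauchy_schwarz[of p u] qf_basis_le(2)[OF E, of u] F by auto
      show "norm (Z u - pr G (Z u)) \<le> \<eta>"
        using pr_mono[OF E G Z(2)[OF u], of "Z u"] H(3)[of "Z u"] by simp
    qed auto
    also have "\<dots> = (real (card F) * \<eta>) * norm p" by simp
    also have "\<dots> \<le> e * norm p" using \<eta>(2) by (intro mult_right_mono) auto
    finally show ?thesis .
  qed
  have "norm (X p - pr G (X p)) \<le> e * norm p"
    "norm (Y p - pr G (Y p)) \<le> e * norm p" if "pr F p = p" for p
    using bound[OF XY(1) _ that] bound[OF XY(2) _ that] by (auto simp: G_def)
  then show ?thesis using G by (intro exI[of _ G]) (auto simp: G_def)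
qed

text \<open>Split \<open>z = p + v\<close> with \<open>p = pr F z\<close>. On \<open>p\<close>
  nothing changes; the cross terms change by at most \<open>2 * e\<close> times the squared norm of
  \<open>z\<close>, because \<open>X p\<close> is almost in the range of \<open>pr G\<close>; the
  part at \<open>v\<close> is paid for by \<open>M\<close> times the complement of
  \<open>F\<close>.\<close>

lemma compression_le:
  fixes X :: "'h::chilbert_space \<Rightarrow>\<^sub>L 'h"
  assumes E: "orthonormal_basis E" and X: "op_pos X"
    and FG: "finite F" "finite G" "F \<subseteq> G" "G \<subseteq> E" and e: "0 \<le> e"
    and approx: "\<And>p. pr F p = p \<Longrightarrow> norm (X p - pr G (X p)) \<le> e * norm p"
    and M: "norm X \<le> M"
  shows "qf X (pr G z) \<le> qf (X + (2 * e) *\<^sub>R id_blinfun + M *\<^sub>R (id_blinfun - proj E F)) z"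
proof -
  have FE: "F \<subseteq> E" using FG by auto
  define p where "p = pr F z"
  define v where "v = z - p"
  have FF: "pr F p = p" and GF: "pr G p = p"
    using proj_proj[OF E, of F F z] proj_proj[OF E, of G F z] FG
    by (auto simp: p_def proj_finite[OF E] FE Int_absorb1)
  have prG: "pr G (x + y) = pr G x + pr G y" for x y
    by (simp add: pr_def cinner_simps scaleC_add_left sum.distrib)
  have "pr G z = p + pr G v" using prG[of p v] GF by (simp add: v_def)
  then have "qf X (pr G z) = qf X p + 2 * Re (cinner (X p) (pr G v)) + qf X (pr G v)"
    by (simp add: qf_add_arg[OF X])
  moreover have "qf X z = qf X p + 2 * Re (cinner (X p) v) + qf X v"
    using qf_add_arg[OF X, of p v] by (simp add: v_def)
  moreover have "Re (cinner (X p) (pr G v)) - Re (cinner (X p) v) \<le> e * (norm z)\<^sup>2"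
  proof -
    let ?w = "X p - pr G (X p)"
    have "cinner (X p) (pr G v) - cinner (X p) v = - cinner ?w v"
      using pr_selfadjoint[OF E FG(2,4), of "X p" v] by (simp add: cinner_simps)
    then have "Re (cinner (X p) (pr G v)) - Re (cinner (X p) v) \<le> cmod (cinner ?w v)"
      using abs_Re_le_cmod[of "cinner ?w v"] by (metis abs_le_D2 minus_complex.simps(1) uminus_complex.simps(1))
    also have "\<dots> \<le> norm ?w * norm v" by (rule cauchy_schwarz)
    also have "\<dots> \<le> (e * norm p) * norm v" by (intro mult_right_mono approx FF) simp
    also have "\<dots> \<le> (e * norm z) * norm z"
      using pr_norm_le[OF E FG(1) FE, of z] e by (intro mult_mono) (auto simp: p_def v_def mult_left_mono)
    finally show ?thesis by (simp add: power2_eq_square mult.assoc)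
  qed
  moreover have "qf X (pr G v) \<le> M * (norm v)\<^sup>2"
  proof -
    have "qf X (pr G v) \<le> norm X * (norm (pr G v))\<^sup>2" by (rule qf_le_norm)
    also have "\<dots> \<le> M * (norm v)\<^sup>2"
      using pr_norm_le(1)[OF E FG(2,4), of v] M order_trans[OF norm_ge_zero M]
      by (intro mult_mono power_mono) auto
    finally show ?thesis .
  qed
  moreover have "0 \<le> qf X v" by (rule op_pos_qf[OF X])
  moreover have qc: "qf (id_blinfun - proj E F) z = (norm v)\<^sup>2"
    unfolding proj_complement_qf[OF E] by (simp add: v_def p_def proj_finite[OF E FG(1) FE])
  ultimately show ?thesis unfolding qf_add qf_scaleR qf_id qc mult.assoc by linarith
qed

text \<open>The mean is only continuous along decreasing sequences, and finite sections do not decrease.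
  They are dominated by \<open>X + 2 e\<^sub>n I + M (I - P\<^sub>n)\<close>, which decreases to \<open>X + M (I - P)\<close> for
  a projection \<open>P\<close> that commutes with \<open>X\<close>, so the extra term is invisible on the range of \<open>P\<close>.\<close>

lemma mean_ge_if_sections_ge:
  fixes X Y :: "'h::chilbert_space \<Rightarrow>\<^sub>L 'h"
  assumes E: "orthonormal_basis E" and \<sigma>: "operator_mean \<sigma>"
    and pos: "op_pos X" "op_pos Y" and c: "0 < c"
    and lower: "\<And>z. c * (norm z)\<^sup>2 \<le> qf X z" "\<And>z. c * (norm z)\<^sup>2 \<le> qf Y z"
    and F0: "finite F0" "F0 \<subseteq> E" and x: "pr F0 x = x"
    and sections: "\<And>F X' Y'. finite F \<Longrightarrow> F0 \<subseteq> F \<Longrightarrow> F \<subseteq> E \<Longrightarrow> op_strictly_pos X' \<Longrightarrow> op_strictly_pos Y' \<Longrightarrow>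
      (\<And>z. qf X (pr F z) \<le> qf X' z) \<Longrightarrow> (\<And>z. qf Y (pr F z) \<le> qf Y' z) \<Longrightarrow> a \<le> qf (\<sigma> X' Y') x"
  shows "a \<le> qf (\<sigma> X Y) x"
proof -
  note B = pos[THEN op_pos_bounded_ops]
  define e where "e n = inverse (real (Suc n))" for n
  have e0: "0 < e n" for n by (simp add: e_def)
  define good where "good n F G \<longleftrightarrow> F \<subseteq> G \<and> (\<forall>p. pr F p = p \<longrightarrow>
    norm (X p - pr G (X p)) \<le> e n * norm p \<and>
    norm (Y p - pr G (Y p)) \<le> e n * norm p)" for n F G
  \<comment> \<open>Dependent choice: each set nearly captures what \<open>X\<close> and
    \<open>Y\<close> do to the range of the previous one, with error \<open>e n\<close>.\<close>
  have "\<exists>F. \<forall>n. (finite (F n) \<and> F n \<subseteq> E \<and> F0 \<subseteq> F n) \<and> good n (F n) (F (Suc n))"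
  proof (rule dependent_nat_choice)
    show "\<exists>F. finite F \<and> F \<subseteq> E \<and> F0 \<subseteq> F" using F0 by blast
    fix F and n :: nat assume F: "finite F \<and> F \<subseteq> E \<and> F0 \<subseteq> F"
    then obtain G where "finite G \<and> G \<subseteq> E \<and> F \<subseteq> G \<and> (\<forall>p. pr F p = p \<longrightarrow>
      norm (X p - pr G (X p)) \<le> e n * norm p \<and>
      norm (Y p - pr G (Y p)) \<le> e n * norm p)"
      using finite_section_step[OF E B _ _ e0, of F n] by (elim conjE exE) blast
    with F show "\<exists>G. (finite G \<and> G \<subseteq> E \<and> F0 \<subseteq> G) \<and> good n F G"
      unfolding good_def by (intro exI[of _ G]) auto
  qed
  then obtain F where FF: "\<forall>n. (finite (F n) \<and> F n \<subseteq> E \<and> F0 \<subseteq> F n) \<and> good n (F n) (F (Suc n))"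
    by (rule exE)
  have F: "finite (F n)" "F n \<subseteq> E" "F0 \<subseteq> F n" and gd: "good n (F n) (F (Suc n))" for n
    using spec[OF FF, of n] by auto
  have mono: "F n \<subseteq> F (Suc n)" for n using gd by (simp add: good_def)
  then have inc: "incseq F" by (rule incseq_SucI)
  have apX: "norm (X p - pr (F (Suc n)) (X p)) \<le> e n * norm p"
    and apY: "norm (Y p - pr (F (Suc n)) (Y p)) \<le> e n * norm p"
    if "pr (F n) p = p" for n p using gd[of n] that by (auto simp: good_def)
  define G where "G = (\<Union>n. F n)"
  define M where "M = norm X + norm Y"
  have M: "norm X \<le> M" "norm Y \<le> M" "0 \<le> M" by (auto simp: M_def)
  define app where "app Z n = Z + (2 * e n) *\<^sub>R id_blinfun + M *\<^sub>R (id_blinfun - proj E (F n))"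
    for Z :: "'h \<Rightarrow>\<^sub>L 'h" and n
  define lim where "lim Z = Z + M *\<^sub>R (id_blinfun - proj E G)" for Z :: "'h \<Rightarrow>\<^sub>L 'h"
  have app_pos: "op_strictly_pos (app Z n)" and lim_pos: "op_strictly_pos (lim Z)"
    if Z: "op_pos Z" "\<And>z. c * (norm z)\<^sup>2 \<le> qf Z z" for Z n
  proof -
    have nn: "0 \<le> M * qf (id_blinfun - proj E H) z" for H z
      using M(3) op_pos_qf[OF proj_complement_pos[OF E]] by (intro mult_nonneg_nonneg) auto
    show "op_strictly_pos (app Z n)" unfolding app_def
    proof (rule op_strictly_posI[OF _ c])
      show "c * (norm z)\<^sup>2 \<le> qf (Z + (2 * e n) *\<^sub>R id_blinfun + M *\<^sub>R (id_blinfun - proj E (F n))) z" for z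
        using Z(2)[of z] nn[of "F n" z] e0[of n] unfolding qf_add qf_scaleR qf_id
        by (simp add: add_increasing2)
    qed (use Z(1) M(3) e0[of n] in \<open>intro op_pos_add op_pos_scaleR op_pos_id proj_complement_pos[OF E]; simp\<close>)
    show "op_strictly_pos (lim Z)" unfolding lim_def
    proof (rule op_strictly_posI[OF _ c])
      show "c * (norm z)\<^sup>2 \<le> qf (Z + M *\<^sub>R (id_blinfun - proj E G)) z" for z
        using Z(2)[of z] nn[of G z] unfolding qf_add qf_scaleR by simp
    qed (use Z(1) M(3) in \<open>intro op_pos_add op_pos_scaleR op_pos_id proj_complement_pos[OF E]; simp\<close>)
  qed
  have app_dec: "qf (app Z (Suc n)) z \<le> qf (app Z n) z" for Z n z
  proof -
    have "e (Suc n) \<le> e n" unfolding e_def by (rule inverse_Suc_decreasing)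
    then have "2 * e (Suc n) * (norm z)\<^sup>2 \<le> 2 * e n * (norm z)\<^sup>2" by (intro mult_right_mono) auto
    moreover have "M * (qf id_blinfun z - qf (proj E (F (Suc n))) z) \<le> M * (qf id_blinfun z - qf (proj E (F n)) z)"
      using proj_mono_qf[OF E mono] M(3) by (intro mult_left_mono) auto
    ultimately show ?thesis unfolding app_def qf_add qf_scaleR qf_id qf_diff by linarith
  qed
  have app_lim: "strong_limit (app Z) (lim Z) sequentially" for Z
    unfolding strong_limit_def
  proof
    fix z
    have "(\<lambda>n. Z z + (2 * e n) *\<^sub>R z + M *\<^sub>R (z - (proj E (F n)) z))
        \<longlonglongrightarrow> Z z + (2 * 0) *\<^sub>R z + M *\<^sub>R (z - (proj E G) z)"
      unfolding G_def e_def
      by (intro tendsto_intros LIMSEQ_inverse_real_of_nat proj_strong_limit[OF E F(1,2) inc])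
    then show "(\<lambda>n. (app Z n) z) \<longlonglongrightarrow> (lim Z) z"
      by (simp add: app_def lim_def blinfun.add_left blinfun.diff_left blinfun.scaleR_left)
  qed
  have "strong_limit (\<lambda>n. \<sigma> (app X n) (app Y n)) (\<sigma> (lim X) (lim Y)) sequentially"
    by (intro mean_continuous[OF \<sigma>] app_pos lim_pos pos lower app_dec app_lim)
  from strong_limit_qf[OF this, of x] have "a \<le> qf (\<sigma> (lim X) (lim Y)) x"
  proof (rule tendsto_lowerbound)
    \<comment> \<open>The index is shifted: \<open>app _ n\<close> penalizes the complement of
      \<open>F n\<close> but dominates the section on the next set \<open>F (Suc n)\<close>.\<close>
    have "a \<le> qf (\<sigma> (app X n) (app Y n)) x" for n
    proof (rule sections[of "F (Suc n)"])
      show "qf X (pr (F (Suc n)) z) \<le> qf (app X n) z" for z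
        unfolding app_def using apX M(1) e0[of n]
        by (intro compression_le[OF E pos(1) F(1) F(1) mono F(2)]) auto
      show "qf Y (pr (F (Suc n)) z) \<le> qf (app Y n) z" for z
        unfolding app_def using apY M(2) e0[of n]
        by (intro compression_le[OF E pos(2) F(1) F(1) mono F(2)]) auto
    qed (intro F app_pos pos lower)+
    then show "\<forall>\<^sub>F n in sequentially. a \<le> qf (\<sigma> (app X n) (app Y n)) x" by simp
  qed simp
  also have "\<dots> = qf (\<sigma> (lim X) (lim Y)) ((proj E G) x)"
  proof -
    have "F0 \<subseteq> G" using F(3) by (auto simp: G_def)
    then have "(proj E G) (pr F0 x) = pr F0 x"
      using proj_proj[OF E, of G F0 x] by (simp add: proj_finite[OF E F0] Int_absorb1)
    then show ?thesis by (simp add: x)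
  qed
  \<comment> \<open>The transformer inequality with \<open>S = proj E G\<close> compresses the
    penalty term away, and \<open>x\<close> lies in the range of this projection.\<close>
  also have "\<dots> \<le> qf (\<sigma> X Y) x"
  proof (rule mean_transformer[OF \<sigma> proj_bounded_ops[OF E] proj_bounded_ops[OF E] proj_selfadjoint[OF E]])
    have le: "qf (lim Z) ((proj E G) z) \<le> qf Z z"
      if Z: "op_pos Z" and ap: "\<And>n p. pr (F n) p = p \<Longrightarrow>
        norm (Z p - pr (F (Suc n)) (Z p)) \<le> e n * norm p" for Z z
    proof -
      let ?P = "blinfun_apply (proj E G)"
      define p where "p = ?P z"
      define v where "v = z - p"
      have Pp: "?P p = p" using proj_proj[OF E, of G G z] by (simp add: p_def)
      have Pv: "?P v = 0" by (simp add: v_def blinfun.diff_right Pp p_def[symmetric])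
      \<comment> \<open>Invariance of the range of \<open>?P\<close> under \<open>Z\<close>: on the
        range of \<open>pr (F n)\<close> the image leaves it by at most \<open>e n\<close>, so in
        the limit \<open>Z p\<close> stays inside and the cross term with \<open>v\<close>
        vanishes.\<close>
      have lin: "(\<lambda>n. Z (pr (F n) z) - ?P (Z (pr (F n) z)))
          \<longlonglongrightarrow> Z p - ?P (Z p)"
        using proj_strong_limit[OF E F(1,2) inc, of z] unfolding G_def[symmetric] p_def proj_finite[OF E F(1,2)]
        by (intro tendsto_intros)
      have small: "norm (Z (pr (F n) z) - ?P (Z (pr (F n) z))) \<le> e n * norm z" for n
      proof -
        let ?w = "Z (pr (F n) z)"
        have FF: "pr (F n) (pr (F n) z) = pr (F n) z"
          using proj_proj[OF E, of "F n" "F n" z] by (simp add: proj_finite[OF E F(1,2)])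
        have "?P (pr (F (Suc n)) ?w) = pr (F (Suc n)) ?w"
          using proj_proj[OF E, of G "F (Suc n)" ?w]
          by (simp add: proj_finite[OF E F(1,2)] G_def Int_absorb1 UN_upper)
        then have "?w - ?P ?w = (?w - pr (F (Suc n)) ?w) - ?P (?w - pr (F (Suc n)) ?w)"
          by (simp add: blinfun.diff_right)
        moreover have "norm (y - ?P y) \<le> norm y" for y
        proof -
          have "(norm (y - ?P y))\<^sup>2 \<le> (norm y)\<^sup>2"
            using proj_complement_qf[OF E, of G y] op_pos_qf[OF proj_pos[OF E], of G y]
            unfolding qf_diff qf_id by linarith
          then show ?thesis by (rule power2_le_imp_le) simp
        qed
        ultimately have "norm (?w - ?P ?w) \<le> norm (?w - pr (F (Suc n)) ?w)" by metis
        also have "\<dots> \<le> e n * norm (pr (F n) z)" by (rule ap[OF FF])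
        also have "\<dots> \<le> e n * norm z"
          using pr_norm_le(1)[OF E F(1,2)] e0[of n] by (intro mult_left_mono) auto
        finally show ?thesis .
      qed
      have "(\<lambda>n. e n * norm z) \<longlonglongrightarrow> 0 * norm z"
        unfolding e_def by (intro tendsto_intros LIMSEQ_inverse_real_of_nat)
      then have "(\<lambda>n. e n * norm z) \<longlonglongrightarrow> 0" by simp
      then have "(\<lambda>n. Z (pr (F n) z) - ?P (Z (pr (F n) z))) \<longlonglongrightarrow> 0"
        by (rule Lim_null_comparison[rotated]) (simp add: small)
      with lin have "Z p - ?P (Z p) = 0" by (rule LIMSEQ_unique)
      then have "?P (Z p) = Z p" by simp
      then have "cinner (Z p) v = 0"
        using proj_selfadjoint[OF E, of G "Z p" v] Pv by simp
      then have "qf Z z = qf Z p + qf Z v"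
        using qf_add_arg[OF Z, of p v] by (simp add: v_def)
      moreover have "qf (id_blinfun - proj E G) p = 0" unfolding proj_complement_qf[OF E] by (simp add: Pp)
      ultimately show ?thesis
        using op_pos_qf[OF Z, of v] unfolding lim_def p_def[symmetric] qf_add qf_scaleR by simp
    qed
    show "qf (lim X) ((proj E G) z) \<le> qf X z" for z by (rule le[OF pos(1) apX])
    show "qf (lim Y) ((proj E G) z) \<le> qf Y z" for z by (rule le[OF pos(2) apY])
  qed (intro lim_pos pos lower op_strictly_posI[OF _ c])+
  finally show ?thesis .
qed

section \<open>Hadamard products of means\<close>

text \<open>The rows \<open>s k\<close> are the coordinates in a basis that diagonalizes the pencil
  of \<open>A\<close> and \<open>C\<close>. The last clause states domination rather than equality,
  since a section of a mean lies below the mean of the sections; this is the direction that the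
  Schur product estimate uses.\<close>

lemma mean_section_dominant:
  fixes A C :: "'h::chilbert_space \<Rightarrow>\<^sub>L 'h"
  assumes E: "orthonormal_basis E" and \<sigma>: "operator_mean \<sigma>" and f: "representing_function \<sigma> f"
    and F: "finite F" "F \<subseteq> E" and pos: "op_pos A" "op_pos C" and c: "0 < c"
    and lower: "\<And>z. c * (norm z)\<^sup>2 \<le> qf A z" "\<And>z. c * (norm z)\<^sup>2 \<le> qf C z"
  obtains m :: "'h \<Rightarrow> real" and s :: "'h \<Rightarrow> 'h \<Rightarrow> complex" where "\<And>k. k \<in> F \<Longrightarrow> 0 < m k"
    "\<And>u v. u \<in> F \<Longrightarrow> v \<in> F \<Longrightarrow> mat_of A u v = (\<Sum>k\<in>F. s k u * cnj (s k v))"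
    "\<And>u v. u \<in> F \<Longrightarrow> v \<in> F \<Longrightarrow> mat_of C u v = (\<Sum>k\<in>F. of_real (m k) * s k u * cnj (s k v))"
    "\<And>d. 0 \<le> Re (qform F (\<lambda>u v. (\<Sum>k\<in>F. of_real (f (m k)) * s k u * cnj (s k v)) - mat_of (\<sigma> A C) u v) d)"
proof -
  have A0: "0 < qf A z" if "z \<noteq> 0" for z
    using lower(1)[of z] mult_pos_pos[OF c, of "(norm z)\<^sup>2"] that by simp
  obtain r where rA: "\<And>i j. i \<in> F \<Longrightarrow> j \<in> F \<Longrightarrow> cinner (A (r i)) (r j) = (if i = j then 1 else 0)"
    and rC: "\<And>i j. i \<in> F \<Longrightarrow> j \<in> F \<Longrightarrow>
      cinner (C (r i)) (r j) = (if i = j then complex_of_real (qf C (r i)) else 0)"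
    and rF: "\<And>x. pr F x = x \<Longrightarrow> x = (\<Sum>i\<in>F. cinner x (A (r i)) *\<^sub>C r i)"
    by (rule simultaneous_diagonalization[OF E F pos(1) A0 pos(2)]) (assumption | rule that)+
  have l: "0 < qf C (r i)" if "i \<in> F" for i
  proof -
    have "r i \<noteq> 0" using rA[OF that that] by auto
    then show ?thesis using lower(2)[of "r i"] mult_pos_pos[OF c, of "(norm (r i))\<^sup>2"] by simp
  qed
  have sp: "op_strictly_pos A" "op_strictly_pos C" by (intro op_strictly_posI[OF _ c] pos lower)+
  define s where "s i x = cinner x (A (r i))" for i x
  have exp: "u = (\<Sum>i\<in>F. s i u *\<^sub>C r i)" if "u \<in> F" for u
    unfolding s_def by (rule rF[OF pr_basis[OF E F that]])
  show thesis
  proof (rule that[of "\<lambda>i. qf C (r i)" s])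
    fix u v assume uv: "u \<in> F" "v \<in> F"
    show "mat_of A u v = (\<Sum>k\<in>F. s k u * cnj (s k v))"
      using mat_of_expansion[OF op_pos_bounded_ops[OF pos(1)] _ F(1) exp[OF uv(1)] exp[OF uv(2)], of "\<lambda>_. 1"] rA
      by simp
    show "mat_of C u v = (\<Sum>k\<in>F. of_real (qf C (r k)) * s k u * cnj (s k v))"
      by (rule mat_of_expansion[OF op_pos_bounded_ops[OF pos(2)] rC F(1) exp[OF uv(1)] exp[OF uv(2)]])
  next
    fix d
    define y where "y = (\<Sum>u\<in>F. d u *\<^sub>C u)"
    define t where "t i = (\<Sum>u\<in>F. d u * s i u)" for i
    have "y = (\<Sum>u\<in>F. d u *\<^sub>C (\<Sum>i\<in>F. s i u *\<^sub>C r i))"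
      unfolding y_def using exp by (intro sum.cong) auto
    also have "\<dots> = (\<Sum>i\<in>F. t i *\<^sub>C r i)"
      unfolding t_def scaleC_sum_right scaleC_sum_left scaleC_scaleC by (rule sum.swap)
    finally have "qf (\<sigma> A C) y \<le> (\<Sum>i\<in>F. f (qf C (r i)) * (cmod (t i))\<^sup>2)"
      using mean_section_upper[OF E \<sigma> f F sp rA rC l] by simp
    then show "0 \<le> Re (qform F (\<lambda>u v. (\<Sum>k\<in>F. of_real (f (qf C (r k))) * s k u * cnj (s k v)) - mat_of (\<sigma> A C) u v) d)"
      using qform_mat_of[OF op_pos_bounded_ops[OF mean_pos[OF \<sigma> sp]], of F d]
      unfolding qform_diff minus_complex.simps qform_rank_one_sum t_def y_def by simp
  qed (rule l)
qed

lemma sum_gram_bilinear: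
  fixes w :: "'k \<Rightarrow> 'u \<Rightarrow> complex"
  shows "(\<Sum>k\<in>K. n k * (\<Sum>u\<in>F. a u * w k u) * cnj (\<Sum>v\<in>F. b v * w k v)) =
    (\<Sum>u\<in>F. \<Sum>v\<in>F. a u * cnj (b v) * (\<Sum>k\<in>K. n k * w k u * cnj (w k v)))"
proof -
  have "(\<Sum>k\<in>K. n k * (\<Sum>u\<in>F. a u * w k u) * cnj (\<Sum>v\<in>F. b v * w k v)) =
      (\<Sum>k\<in>K. \<Sum>u\<in>F. \<Sum>v\<in>F. a u * cnj (b v) * (n k * w k u * cnj (w k v)))"
    unfolding mult.assoc cnj_sum sum_product
    unfolding sum_distrib_left by (simp add: mult_ac)
  also have "\<dots> = (\<Sum>u\<in>F. \<Sum>k\<in>K. \<Sum>v\<in>F. a u * cnj (b v) * (n k * w k u * cnj (w k v)))"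
    by (rule sum.swap)
  also have "\<dots> = (\<Sum>u\<in>F. \<Sum>v\<in>F. \<Sum>k\<in>K. a u * cnj (b v) * (n k * w k u * cnj (w k v)))"
    by (intro sum.cong refl sum.swap)
  finally show ?thesis by (simp only: sum_distrib_left)
qed

text \<open>Schur domination, super-multiplicativity and Jensen's inequality act in turn on a single
  sum over pairs of indices. As \<open>r\<close> diagonalizes the pencil of the two Hadamard
  products, Jensen's inequality ends in the values \<open>f (l i)\<close>.\<close>

lemma hadamard_mean_section:
  fixes A B C D :: "'h::chilbert_space \<Rightarrow>\<^sub>L 'h"
  assumes E: "orthonormal_basis E" and \<sigma>: "operator_mean \<sigma>" and f: "representing_function \<sigma> f"
    and sm: "super_multiplicative f" and F: "finite F" "F \<subseteq> E"
    and pos: "op_pos A" "op_pos B" "op_pos C" "op_pos D" and c: "0 < c"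
    and lower: "\<And>z. c * (norm z)\<^sup>2 \<le> qf A z" "\<And>z. c * (norm z)\<^sup>2 \<le> qf B z"
      "\<And>z. c * (norm z)\<^sup>2 \<le> qf C z" "\<And>z. c * (norm z)\<^sup>2 \<le> qf D z"
    and rX: "\<And>i j. i \<in> F \<Longrightarrow> j \<in> F \<Longrightarrow>
      cinner ((hadamard E A B) (r i)) (r j) = (if i = j then 1 else 0)"
    and rY: "\<And>i j. i \<in> F \<Longrightarrow> j \<in> F \<Longrightarrow>
      cinner ((hadamard E C D) (r i)) (r j) = (if i = j then complex_of_real (l i) else 0)"
    and rp: "\<And>i. i \<in> F \<Longrightarrow> pr F (r i) = r i"
    and rF: "\<And>x. pr F x = x \<Longrightarrow> x = (\<Sum>i\<in>F. cinner x ((hadamard E A B) (r i)) *\<^sub>C r i)"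
    and l: "\<And>i. i \<in> F \<Longrightarrow> 0 < l i" and x: "pr F x = x"
  shows "qf (hadamard E (\<sigma> A C) (\<sigma> B D)) x \<le>
    (\<Sum>i\<in>F. f (l i) * (cmod (cinner x ((hadamard E A B) (r i))))\<^sup>2)"
proof -
  have fpos: "0 < f t" if "0 < t" for t using f that by (simp add: representing_function_def)
  have mono: "operator_monotone f" using f by (simp add: representing_function_def)
  have sp: "op_strictly_pos A" "op_strictly_pos B" "op_strictly_pos C" "op_strictly_pos D"
    by (intro op_strictly_posI[OF _ c] pos lower)+
  have AC: "op_pos (\<sigma> A C)" and BD: "op_pos (\<sigma> B D)" by (intro mean_pos[OF \<sigma>] sp)+
  obtain m and s :: "'h \<Rightarrow> 'h \<Rightarrow> complex" where m: "\<And>k. k \<in> F \<Longrightarrow> 0 < m k"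
    and sA: "\<And>u v. u \<in> F \<Longrightarrow> v \<in> F \<Longrightarrow> mat_of A u v = (\<Sum>k\<in>F. s k u * cnj (s k v))"
    and sC: "\<And>u v. u \<in> F \<Longrightarrow> v \<in> F \<Longrightarrow> mat_of C u v = (\<Sum>k\<in>F. of_real (m k) * s k u * cnj (s k v))"
    and sAC: "\<And>d. 0 \<le> Re (qform F (\<lambda>u v. (\<Sum>k\<in>F. of_real (f (m k)) * s k u * cnj (s k v)) - mat_of (\<sigma> A C) u v) d)"
    by (rule mean_section_dominant[OF E \<sigma> f F pos(1,3) c lower(1,3)]) (assumption | rule that)+
  obtain m' and t :: "'h \<Rightarrow> 'h \<Rightarrow> complex" where m': "\<And>k. k \<in> F \<Longrightarrow> 0 < m' k"
    and tB: "\<And>u v. u \<in> F \<Longrightarrow> v \<in> F \<Longrightarrow> mat_of B u v = (\<Sum>k\<in>F. t k u * cnj (t k v))"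
    and tD: "\<And>u v. u \<in> F \<Longrightarrow> v \<in> F \<Longrightarrow> mat_of D u v = (\<Sum>k\<in>F. of_real (m' k) * t k u * cnj (t k v))"
    and tBD: "\<And>d. 0 \<le> Re (qform F (\<lambda>u v. (\<Sum>k\<in>F. of_real (f (m' k)) * t k u * cnj (t k v)) - mat_of (\<sigma> B D) u v) d)"
    by (rule mean_section_dominant[OF E \<sigma> f F pos(2,4) c lower(2,4)]) (assumption | rule that)+
  define S where "S u v = (\<Sum>k\<in>F. of_real (f (m k)) * s k u * cnj (s k v))" for u v
  define T where "T u v = (\<Sum>k\<in>F. of_real (f (m' k)) * t k u * cnj (t k v))" for u v
  define q where "q K = Re (qform F K (cinner x))" for K
  \<comment> \<open>One row for each pair of indices, so that a product of two Gram sums becomes one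
    Gram sum.\<close>
  define w where "w p u = s (fst p) u * t (snd p) u" for p u
  have prodw: "(\<Sum>k\<in>F. a k * s k u * cnj (s k v)) * (\<Sum>j\<in>F. b j * t j u * cnj (t j v)) =
      (\<Sum>p\<in>F \<times> F. a (fst p) * b (snd p) * w p u * cnj (w p v))" for a b u v
    unfolding sum_product sum.cartesian_product w_def
    by (intro sum.cong refl) (simp add: case_prod_unfold mult_ac)
  have xx: "x = (\<Sum>u\<in>F. cinner x u *\<^sub>C u)" using x by (simp add: pr_def)
  have "qf (hadamard E (\<sigma> A C) (\<sigma> B D)) x = q (\<lambda>u v. mat_of (\<sigma> A C) u v * mat_of (\<sigma> B D) u v)"
    unfolding q_def qf_hadamard[OF E AC BD F(2), symmetric] using xx by simp
  also have "\<dots> \<le> q (\<lambda>u v. S u v * T u v)"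
  proof -
    obtain n and y :: "'h \<Rightarrow> 'h \<Rightarrow> complex" where n: "\<And>k. k \<in> F \<Longrightarrow> 0 \<le> n k"
      "\<And>u v. u \<in> F \<Longrightarrow> v \<in> F \<Longrightarrow> mat_of (\<sigma> B D) u v = (\<Sum>k\<in>F. of_real (n k) * y k u * cnj (y k v))"
      by (rule op_pos_decomposition[OF E F BD]) (assumption | rule that)+
    \<comment> \<open>The factors are replaced one at a time: each step multiplies a nonnegative
      difference by a kernel that is a nonnegative sum of rank-one terms.\<close>
    have "0 \<le> q (\<lambda>u v. (S u v - mat_of (\<sigma> A C) u v) * mat_of (\<sigma> B D) u v)"
      unfolding q_def by (rule schur_product_nonneg[OF _ n(2) n(1)]) (simp_all add: sAC S_def)
    moreover have "0 \<le> q (\<lambda>u v. (T u v - mat_of (\<sigma> B D) u v) * S u v)"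
      unfolding q_def
    proof (rule schur_product_nonneg)
      show "S u v = (\<Sum>k\<in>F. of_real (f (m k)) * s k u * cnj (s k v))" for u v by (rule S_def)
      show "0 \<le> f (m k)" if "k \<in> F" for k using fpos[OF m[OF that]] by simp
    qed (simp add: tBD T_def)
    moreover have "q (\<lambda>u v. (S u v - mat_of (\<sigma> A C) u v) * mat_of (\<sigma> B D) u v)
        + q (\<lambda>u v. (T u v - mat_of (\<sigma> B D) u v) * S u v)
        = q (\<lambda>u v. S u v * T u v) - q (\<lambda>u v. mat_of (\<sigma> A C) u v * mat_of (\<sigma> B D) u v)"
      unfolding q_def qform_def
      by (simp only: left_diff_distrib right_diff_distrib sum_subtractf minus_complex.simps mult.commute[of "T _ _" "S _ _"]
          mult.commute[of "mat_of (\<sigma> B D) _ _" "S _ _"])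
    ultimately show ?thesis by linarith
  qed
  also have "\<dots> = (\<Sum>p\<in>F \<times> F. (f (m (fst p)) * f (m' (snd p))) * (cmod (\<Sum>u\<in>F. cinner x u * w p u))\<^sup>2)"
    unfolding q_def S_def T_def prodw of_real_mult[symmetric] by (rule qform_rank_one_sum)
  also have "\<dots> \<le> (\<Sum>p\<in>F \<times> F. f (m (fst p) * m' (snd p)) * (cmod (\<Sum>u\<in>F. cinner x u * w p u))\<^sup>2)"
  proof (intro sum_mono mult_right_mono)
    fix p assume "p \<in> F \<times> F"
    then have "0 < m (fst p)" "0 < m' (snd p)" using m m' by auto
    then show "f (m (fst p)) * f (m' (snd p)) \<le> f (m (fst p) * m' (snd p))"
      using sm by (simp add: super_multiplicative_def)
  qed simp
  also have "\<dots> \<le> (\<Sum>i\<in>F. f (l i) * (cmod (cinner x ((hadamard E A B) (r i))))\<^sup>2)"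
  proof -
    define z where "z i = cinner x ((hadamard E A B) (r i))" for i
    \<comment> \<open>The vectors \<open>r i\<close> in the coordinates \<open>w\<close>: by
      \<open>rX\<close> these columns are orthonormal, and by \<open>rY\<close> they compress the
      diagonal of products \<open>m * m'\<close> to the diagonal \<open>l\<close>, as Jensen's
      inequality requires.\<close>
    define v where "v i p = (\<Sum>u\<in>F. cinner (r i) u * w p u)" for i p
    have rr: "r i = (\<Sum>u\<in>F. cinner (r i) u *\<^sub>C u)" if "i \<in> F" for i
      using rp[OF that] by (simp add: pr_def)
    have xz: "x = (\<Sum>i\<in>F. z i *\<^sub>C r i)" unfolding z_def by (rule rF[OF x])
    have xw: "(\<Sum>u\<in>F. cinner x u * w p u) = (\<Sum>i\<in>F. z i * v i p)" for p
    proof -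
      have "cinner x u = (\<Sum>i\<in>F. z i * cinner (r i) u)" for u
        by (subst xz) (simp add: cinner_sum_left cinner_simps)
      then have "(\<Sum>u\<in>F. cinner x u * w p u) = (\<Sum>u\<in>F. \<Sum>i\<in>F. z i * (cinner (r i) u * w p u))"
        by (simp add: sum_distrib_right mult.assoc)
      also have "\<dots> = (\<Sum>i\<in>F. \<Sum>u\<in>F. z i * (cinner (r i) u * w p u))" by (rule sum.swap)
      finally show ?thesis by (simp only: v_def sum_distrib_left)
    qed
    have gram: "(\<Sum>p\<in>F \<times> F. n p * v i p * cnj (v j p)) = cinner (Z (r i)) (r j)"
      if Z: "Z \<in> bounded_ops" and n: "\<And>u v. u \<in> F \<Longrightarrow> v \<in> F \<Longrightarrow>
        mat_of Z u v = (\<Sum>p\<in>F \<times> F. n p * w p u * cnj (w p v))" and ij: "i \<in> F" "j \<in> F" for n Z i j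
    proof -
      have "(\<Sum>p\<in>F \<times> F. n p * v i p * cnj (v j p)) =
          (\<Sum>u\<in>F. \<Sum>u'\<in>F. cinner (r i) u * cnj (cinner (r j) u') * (\<Sum>p\<in>F \<times> F. n p * w p u * cnj (w p u')))"
        unfolding v_def by (rule sum_gram_bilinear)
      also have "\<dots> = (\<Sum>u\<in>F. \<Sum>u'\<in>F. cinner (r i) u * cnj (cinner (r j) u') * mat_of Z u u')"
        using n by (intro sum.cong) auto
      also have "\<dots> = mat_of Z (r i) (r j)"
        unfolding mat_of_sums[OF Z, symmetric] rr[OF ij(1), symmetric] rr[OF ij(2), symmetric] ..
      finally show ?thesis by (simp add: mat_of_def)
    qed
    have X: "mat_of (hadamard E A B) u v = (\<Sum>p\<in>F \<times> F. 1 * w p u * cnj (w p v))" if "u \<in> F" "v \<in> F" for u v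
      using prodw[of "\<lambda>_. 1" u v "\<lambda>_. 1"] sA[OF that] tB[OF that] mat_of_hadamard[OF E pos(1,2)] that F(2)
      by (simp add: subset_iff)
    have Y: "mat_of (hadamard E C D) u v = (\<Sum>p\<in>F \<times> F. of_real (m (fst p) * m' (snd p)) * w p u * cnj (w p v))"
      if "u \<in> F" "v \<in> F" for u v
      using prodw[of "\<lambda>k. of_real (m k)" u v "\<lambda>k. of_real (m' k)"] sC[OF that] tD[OF that]
        mat_of_hadamard[OF E pos(3,4)] that F(2)
      by (simp add: subset_iff)
    let ?e = "\<lambda>n. inverse (real (Suc n))"
    have le: "(\<Sum>p\<in>F \<times> F. f (m (fst p) * m' (snd p)) * (cmod (\<Sum>i\<in>F. z i * v i p))\<^sup>2)
        \<le> (\<Sum>i\<in>F. f (l i + ?e n) * (cmod (z i))\<^sup>2)" for n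
    proof (rule operator_monotone_jensen_finite[OF mono F(1)])
      fix i j assume ij: "i \<in> F" "j \<in> F"
      show "(\<Sum>p\<in>F \<times> F. v i p * cnj (v j p)) = (if i = j then 1 else 0)"
        using gram[OF hadamard_bounded_ops[OF E pos(1,2)] X ij] rX[OF ij] by simp
      show "(\<Sum>p\<in>F \<times> F. of_real (m (fst p) * m' (snd p)) * v i p * cnj (v j p)) =
          (if i = j then complex_of_real (l i) else 0)"
        using gram[OF hadamard_bounded_ops[OF E pos(3,4)] Y ij] rY[OF ij] by simp
    next
      show "0 < m (fst p) * m' (snd p)" if "p \<in> F \<times> F" for p using that m m' by auto
      show "0 \<le> l i" if "i \<in> F" for i using l[OF that] by simp
    qed (use F(1) in auto)
    \<comment> \<open>The shift left by Jensen's inequality is removed by right continuity of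
      \<open>f\<close>; a basis vector serves as the unit vector.\<close>
    have "(\<lambda>n. \<Sum>i\<in>F. f (l i + ?e n) * (cmod (z i))\<^sup>2) \<longlonglongrightarrow> (\<Sum>i\<in>F. f (l i) * (cmod (z i))\<^sup>2)"
    proof (intro tendsto_sum tendsto_mult_right)
      fix i assume i: "i \<in> F"
      then show "(\<lambda>n. f (l i + ?e n)) \<longlonglongrightarrow> f (l i)"
        using F(2) by (intro representing_function_right_continuous[OF \<sigma> f l] qf_basis_le(2)[OF E]) auto
    qed
    then show ?thesis unfolding xw z_def[symmetric] using le by (intro LIMSEQ_le_const) auto
  qed
  finally show ?thesis .
qed

text \<open>For every finite \<open>F\<close> containing \<open>F0\<close> the two estimates meet in
  the same sum: the Hadamard product of the means lies below it, the mean of any dominating pair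
  above it. The lower bound \<open>c\<close> becomes \<open>c * c\<close> for the Hadamard
  products.\<close>

lemma hadamard_mean_strict:
  fixes A B C D :: "'h::chilbert_space \<Rightarrow>\<^sub>L 'h"
  assumes E: "orthonormal_basis E" and \<sigma>: "operator_mean \<sigma>" and f: "representing_function \<sigma> f"
    and sm: "super_multiplicative f"
    and pos: "op_pos A" "op_pos B" "op_pos C" "op_pos D" and c: "0 < c"
    and lower: "\<And>z. c * (norm z)\<^sup>2 \<le> qf A z" "\<And>z. c * (norm z)\<^sup>2 \<le> qf B z"
      "\<And>z. c * (norm z)\<^sup>2 \<le> qf C z" "\<And>z. c * (norm z)\<^sup>2 \<le> qf D z"
  shows "qf (hadamard E (\<sigma> A C) (\<sigma> B D)) x \<le> qf (\<sigma> (hadamard E A B) (hadamard E C D)) x"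
proof (rule qf_le_dense[OF E])
  fix F0 a assume F0: "finite F0" "F0 \<subseteq> E"
  let ?X = "hadamard E A B" and ?Y = "hadamard E C D"
  have XY: "op_pos ?X" "op_pos ?Y" by (intro hadamard_pos[OF E] pos)+
  have cc: "0 < c * c" using c by simp
  have lowerXY: "c * c * (norm z)\<^sup>2 \<le> qf ?X z" "c * c * (norm z)\<^sup>2 \<le> qf ?Y z" for z
    using c by (intro hadamard_lower_bound[OF E] pos lower; simp)+
  define x where "x = (\<Sum>u\<in>F0. a u *\<^sub>C u)"
  have prx: "pr F x = x" if F: "finite F" "F0 \<subseteq> F" "F \<subseteq> E" for F
  proof (rule onb_eqI[OF E])
    fix u assume u: "u \<in> E"
    show "cinner (pr F x) u = cinner x u"
      unfolding pr_coeff[OF E F(1,3) u] x_def onb_coeff[OF E F0 u] using F(2) by auto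
  qed
  have "qf (hadamard E (\<sigma> A C) (\<sigma> B D)) x \<le> qf (\<sigma> ?X ?Y) x"
  proof (rule mean_ge_if_sections_ge[OF E \<sigma> XY cc lowerXY F0 prx[OF F0(1) order_refl F0(2)]])
    fix F X' Y' assume F: "finite F" "F0 \<subseteq> F" "F \<subseteq> E" and pos': "op_strictly_pos X'" "op_strictly_pos Y'"
      and le: "\<And>z. qf ?X (pr F z) \<le> qf X' z" "\<And>z. qf ?Y (pr F z) \<le> qf Y' z"
    have X0: "0 < qf ?X z" if "z \<noteq> 0" for z
      using lowerXY(1)[of z] mult_pos_pos[OF cc, of "(norm z)\<^sup>2"] that by simp
    obtain r where rX: "\<And>i j. i \<in> F \<Longrightarrow> j \<in> F \<Longrightarrow> cinner (?X (r i)) (r j) = (if i = j then 1 else 0)"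
      and rY: "\<And>i j. i \<in> F \<Longrightarrow> j \<in> F \<Longrightarrow>
        cinner (?Y (r i)) (r j) = (if i = j then complex_of_real (qf ?Y (r i)) else 0)"
      and rp: "\<And>i. i \<in> F \<Longrightarrow> pr F (r i) = r i"
      and rF: "\<And>x. pr F x = x \<Longrightarrow> x = (\<Sum>i\<in>F. cinner x (?X (r i)) *\<^sub>C r i)"
      by (rule simultaneous_diagonalization[OF E F(1,3) XY(1) X0 XY(2)]) (assumption | rule that)+
    have l: "0 < qf ?Y (r i)" if "i \<in> F" for i
    proof -
      have "r i \<noteq> 0" using rX[OF that that] by auto
      then show ?thesis using lowerXY(2)[of "r i"] mult_pos_pos[OF cc, of "(norm (r i))\<^sup>2"] by simp
    qed
    have "qf (hadamard E (\<sigma> A C) (\<sigma> B D)) x \<le> (\<Sum>i\<in>F. f (qf ?Y (r i)) * (cmod (cinner x (?X (r i))))\<^sup>2)"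
      by (rule hadamard_mean_section[OF E \<sigma> f sm F(1,3) pos c lower rX rY rp rF l prx[OF F]])
    also have "\<dots> \<le> qf (\<sigma> X' Y') x"
      by (rule mean_section_lower[OF E \<sigma> f F(1,3) XY pos' le rX rY rF l prx[OF F]])
    finally show "qf (hadamard E (\<sigma> A C) (\<sigma> B D)) x \<le> qf (\<sigma> X' Y') x" .
  qed
  then show "qf (hadamard E (\<sigma> A C) (\<sigma> B D)) (\<Sum>u\<in>F0. a u *\<^sub>C u) \<le> qf (\<sigma> ?X ?Y) (\<Sum>u\<in>F0. a u *\<^sub>C u)"
    by (simp only: x_def)
qed

text \<open>Shifting all four operators makes the strict case applicable; the shifted Hadamard
  products are then bounded by one common scalar shift of the original ones, along which the
  extended mean is a limit.\<close>

lemma hadamard_mean: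
  fixes A B C D :: "'h::chilbert_space \<Rightarrow>\<^sub>L 'h"
  assumes E: "orthonormal_basis E" and \<sigma>: "operator_mean \<sigma>" and f: "representing_function \<sigma> f"
    and sm: "super_multiplicative f" and pos: "op_pos A" "op_pos B" "op_pos C" "op_pos D"
  shows "qf (hadamard E (mean_ext \<sigma> A C) (mean_ext \<sigma> B D)) x
    \<le> qf (mean_ext \<sigma> (hadamard E A B) (hadamard E C D)) x"
proof -
  let ?X = "hadamard E A B" and ?Y = "hadamard E C D"
  have XY: "op_pos ?X" "op_pos ?Y" by (intro hadamard_pos[OF E] pos)+
  define M where "M = norm A + norm B + norm C + norm D"
  have M: "norm A + norm B \<le> M" "norm C + norm D \<le> M" "0 \<le> M" by (auto simp: M_def)
  \<comment> \<open>\<open>M\<close> dominates both sums of norms occurring in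
    \<open>hadamard_shift_le\<close>, so the same shift serves for both arguments of the
    mean.\<close>
  define g where "g \<epsilon> = \<epsilon> * (M + \<epsilon>)" for \<epsilon> :: real
  have g0: "0 < g \<epsilon>" if "0 < \<epsilon>" for \<epsilon> using that M(3) by (simp add: g_def add_nonneg_pos)
  have le: "qf (hadamard E (mean_ext \<sigma> A C) (mean_ext \<sigma> B D)) x
      \<le> qf (\<sigma> (?X + g \<epsilon> *\<^sub>R id_blinfun) (?Y + g \<epsilon> *\<^sub>R id_blinfun)) x" if \<epsilon>: "0 < \<epsilon>" for \<epsilon>
  proof -
    let ?I = "\<epsilon> *\<^sub>R id_blinfun :: 'h \<Rightarrow>\<^sub>L 'h"
    have pos': "op_pos (Z + ?I)" if "op_pos Z" for Z
      using that \<epsilon> by (intro op_pos_add op_pos_scaleR op_pos_id) auto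
    have lower: "\<epsilon> * (norm z)\<^sup>2 \<le> qf (Z + ?I) z" if "op_pos Z" for Z z
      using op_pos_qf[OF that, of z] by (simp add: qf_simps)
    have spos: "op_strictly_pos (Z + ?I)" if "op_pos Z" for Z using that \<epsilon> by (rule op_strictly_pos_add_id)
    have "qf (hadamard E (mean_ext \<sigma> A C) (mean_ext \<sigma> B D)) x
        \<le> qf (hadamard E (\<sigma> (A + ?I) (C + ?I)) (\<sigma> (B + ?I) (D + ?I))) x"
      by (intro hadamard_mono[OF E] mean_ext_pos[OF \<sigma>] mean_pos[OF \<sigma>] mean_ext_le_eps[OF \<sigma>] pos spos \<epsilon>)
    also have "\<dots> \<le> qf (\<sigma> (hadamard E (A + ?I) (B + ?I)) (hadamard E (C + ?I) (D + ?I))) x"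
      by (rule hadamard_mean_strict[OF E \<sigma> f sm _ _ _ _ \<epsilon>]) (intro pos' lower pos)+
    also have "\<dots> \<le> qf (\<sigma> (?X + g \<epsilon> *\<^sub>R id_blinfun) (?Y + g \<epsilon> *\<^sub>R id_blinfun)) x"
    proof (rule mean_mono[OF \<sigma>])
      have hs: "op_strictly_pos (hadamard E (Z + ?I) (W + ?I))" if "op_pos Z" "op_pos W" for Z W
        using \<epsilon> by (intro op_strictly_posI[of _ "\<epsilon> * \<epsilon>"] hadamard_pos[OF E] hadamard_lower_bound[OF E]
            pos' lower that; simp)
      show "op_strictly_pos (hadamard E (A + ?I) (B + ?I))" "op_strictly_pos (hadamard E (C + ?I) (D + ?I))"
        by (intro hs pos)+
      show "op_strictly_pos (?X + g \<epsilon> *\<^sub>R id_blinfun)" "op_strictly_pos (?Y + g \<epsilon> *\<^sub>R id_blinfun)"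
        by (intro op_strictly_pos_add_id XY g0 \<epsilon>)+
      have shift: "qf (hadamard E (Z + ?I) (W + ?I)) z \<le> qf (hadamard E Z W + g \<epsilon> *\<^sub>R id_blinfun) z"
        if ZW: "op_pos Z" "op_pos W" "norm Z + norm W \<le> M" for Z W z
      proof -
        have "qf (hadamard E (Z + ?I) (W + ?I)) z
            \<le> qf (hadamard E Z W + (\<epsilon> * (norm Z + norm W + \<epsilon>)) *\<^sub>R id_blinfun) z"
          using \<epsilon> by (intro hadamard_shift_le[OF E ZW(1,2)]) simp
        also have "\<dots> \<le> qf (hadamard E Z W + g \<epsilon> *\<^sub>R id_blinfun) z"
          unfolding qf_add qf_scaleR qf_id g_def using \<epsilon> ZW(3)
          by (intro add_left_mono mult_right_mono mult_left_mono) auto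
        finally show ?thesis .
      qed
      show "qf (hadamard E (A + ?I) (B + ?I)) z \<le> qf (?X + g \<epsilon> *\<^sub>R id_blinfun) z"
        "qf (hadamard E (C + ?I) (D + ?I)) z \<le> qf (?Y + g \<epsilon> *\<^sub>R id_blinfun) z" for z
        by (intro shift pos M)+
    qed
    finally show ?thesis .
  qed
  \<comment> \<open>Convergence to 0 from the right lets \<open>g\<close> reparametrize the defining
    limit of the extended mean.\<close>
  have "filterlim g (at_right 0) (at_right 0)"
    unfolding filterlim_at
  proof
    have "g \<epsilon> \<in> {0<..} \<and> g \<epsilon> \<noteq> 0" if "0 < \<epsilon>" for \<epsilon>
      using g0[OF that] by simp
    then show "\<forall>\<^sub>F \<epsilon> in at_right 0. g \<epsilon> \<in> {0<..} \<and> g \<epsilon> \<noteq> 0"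
      unfolding eventually_at_right_field by (intro exI[of _ 1]) simp
    have "((\<lambda>\<epsilon>. \<epsilon> * (M + \<epsilon>)) \<longlongrightarrow> 0 * (M + 0)) (at_right 0)" by (intro tendsto_intros)
    then show "(g \<longlongrightarrow> 0) (at_right 0)" by (simp add: g_def[abs_def])
  qed
  from filterlim_compose[OF strong_limit_qf[OF mean_ext_strong_limit[OF \<sigma> XY]] this]
  show ?thesis
  proof (rule tendsto_lowerbound)
    show "\<forall>\<^sub>F \<epsilon> in at_right 0. qf (hadamard E (mean_ext \<sigma> A C) (mean_ext \<sigma> B D)) x
      \<le> qf (\<sigma> (?X + g \<epsilon> *\<^sub>R id_blinfun) (?Y + g \<epsilon> *\<^sub>R id_blinfun)) x"
      using le by (auto simp: eventually_at_right_field intro!: exI[of _ 1])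
  qed simp
qed

section \<open>Strong Bochner integrals\<close>

text \<open>A contraction does not increase distances to the simple functions, so their images
  approximate the image function equally well in the integral norm.\<close>

lemma strong_bochner_contraction:
  fixes T :: "'b::real_normed_vector \<Rightarrow> 'c::{banach, second_countable_topology}"
  assumes T: "bounded_linear T" "\<And>y. norm (T y) \<le> norm y" and f: "has_strong_bochner_integral M f x"
  shows "\<exists>g. has_bochner_integral M g (T x) \<and> (AE t in M. g t = T (f t))"
proof -
  obtain s where s: "\<And>i. Bochner_Integration.simple_bochner_integrable M (s i)"
    and lim: "AE t in M. (\<lambda>i. s i t) \<longlonglongrightarrow> f t"
    and norm: "(\<lambda>i. \<integral>\<^sup>+t. ennreal (norm (f t - s i t)) \<partial>M) \<longlonglongrightarrow> 0"
    and int: "(\<lambda>i. Bochner_Integration.simple_bochner_integral M (s i)) \<longlonglongrightarrow> x"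
    using f unfolding has_strong_bochner_integral_def by blast
  have Ts: "Bochner_Integration.simple_bochner_integrable M (\<lambda>t. T (s i t))" for i
    using simple_bochner_integrable_compose2[where p="\<lambda>a b. T a", OF _ s s] by (simp add: linear_0[OF bounded_linear.linear[OF T(1)]])
  then have meas: "(\<lambda>t. T (s i t)) \<in> borel_measurable M" for i
    by (auto elim!: simple_bochner_integrable.cases intro: borel_measurable_simple_function)
  \<comment> \<open>A pointwise limit of the images of the simple functions is Borel measurable,
    whereas \<open>T (f t)\<close> is known to agree with it only almost everywhere.\<close>
  define g where "g t = lim (\<lambda>i. T (s i t))" for t
  have g: "AE t in M. g t = T (f t)"
    using lim
  proof eventually_elim
    case (elim t)
    then have "(\<lambda>i. T (s i t)) \<longlonglongrightarrow> T (f t)" by (rule bounded_linear.tendsto[OF T(1)])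
    then show ?case unfolding g_def by (rule limI)
  qed
  have "has_bochner_integral M g (T x)"
  proof (rule has_bochner_integral.intros[OF _ Ts])
    show "g \<in> borel_measurable M" unfolding g_def[abs_def] by (rule borel_measurable_lim_metric[OF meas])
    show "(\<lambda>i. \<integral>\<^sup>+t. ennreal (norm (g t - T (s i t))) \<partial>M) \<longlonglongrightarrow> 0"
    proof (rule tendsto_sandwich[OF _ _ tendsto_const norm])
      show "\<forall>\<^sub>F i in sequentially. (\<integral>\<^sup>+t. ennreal (norm (g t - T (s i t))) \<partial>M)
          \<le> (\<integral>\<^sup>+t. ennreal (norm (f t - s i t)) \<partial>M)"
      proof (rule always_eventually, rule allI, rule nn_integral_mono_AE)
        fix i
        show "AE t in M. ennreal (norm (g t - T (s i t))) \<le> ennreal (norm (f t - s i t))"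
          using g T(2) by (auto elim!: eventually_mono intro!: ennreal_leI
              simp flip: linear_diff[OF bounded_linear.linear[OF T(1)]])
      qed
    qed simp
    have "Bochner_Integration.simple_bochner_integral M (\<lambda>t. T (s i t)) =
        T (Bochner_Integration.simple_bochner_integral M (s i))" for i
      by (rule simple_bochner_integral_linear[OF _ s]) (simp add: bounded_linear.linear T(1))
    then show "(\<lambda>i. Bochner_Integration.simple_bochner_integral M (\<lambda>t. T (s i t))) \<longlonglongrightarrow> T x"
      using bounded_linear.tendsto[OF T(1) int] by simp
  qed
  with g show ?thesis by blast
qed

text \<open>Composing with a bounded functional gives an integrable function only up to a null set, as strong
  measurability is measurability with respect to the completion of \<open>M\<close>.\<close>

lemma strong_bochner_functional:
  fixes T :: "'b::real_normed_vector \<Rightarrow> 'c::{banach, second_countable_topology}"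
  assumes T: "bounded_linear T" and f: "has_strong_bochner_integral M f x"
  shows "\<exists>g. has_bochner_integral M g (T x) \<and> (AE t in M. g t = T (f t))"
proof -
  obtain K where K: "0 < K" "\<And>y. norm (T y) \<le> norm y * K" using bounded_linear.pos_bounded[OF T] by blast
  have bl: "bounded_linear (\<lambda>y. (1 / K) *\<^sub>R T y)" by (intro bounded_linear_scaleR_right bounded_linear_compose[OF _ T])
  obtain g where g: "has_bochner_integral M g ((1 / K) *\<^sub>R T x)" "AE t in M. g t = (1 / K) *\<^sub>R T (f t)"
    using strong_bochner_contraction[OF bl _ f] K by (auto simp: field_simps)
  have "has_bochner_integral M (\<lambda>t. K *\<^sub>R g t) (K *\<^sub>R (1 / K) *\<^sub>R T x)"
    by (rule has_bochner_integral_scaleR_right) (rule g(1))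
  moreover have "AE t in M. K *\<^sub>R g t = T (f t)"
    using g(2) K(1) by (auto elim!: eventually_mono)
  ultimately show ?thesis using K(1) by (intro exI[of _ "\<lambda>t. K *\<^sub>R g t"]) simp
qed

lemma has_bochner_integral_nonneg_AE:
  fixes g :: "'a \<Rightarrow> real"
  assumes "has_bochner_integral M g x" "AE t in M. 0 \<le> g t"
  shows "0 \<le> x"
  using integral_nonneg_AE[OF assms(2)] has_bochner_integral_integral_eq[OF assms(1)] by simp

lemma strong_bochner_functional_nonneg:
  fixes T :: "'b::real_normed_vector \<Rightarrow> real"
  assumes "bounded_linear T" "has_strong_bochner_integral M f x" "\<And>t. 0 \<le> T (f t)"
  shows "0 \<le> T x"
proof -
  obtain g where g: "has_bochner_integral M g (T x)" "AE t in M. g t = T (f t)"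
    using strong_bochner_functional[OF assms(1,2)] by blast
  show ?thesis
    by (rule has_bochner_integral_nonneg_AE[OF g(1)]) (use g(2) assms(3) in \<open>auto elim!: eventually_mono\<close>)
qed

lemma strong_bochner_functional_zero:
  fixes T :: "'b::real_normed_vector \<Rightarrow> 'c::{banach, second_countable_topology}"
  assumes "bounded_linear T" "has_strong_bochner_integral M f x" "\<And>t. T (f t) = 0"
  shows "T x = 0"
proof -
  obtain g where g: "has_bochner_integral M g (T x)" "AE t in M. g t = T (f t)"
    using strong_bochner_functional[OF assms(1,2)] by blast
  have "has_bochner_integral M (\<lambda>_. 0) (T x) \<longleftrightarrow> has_bochner_integral M g (T x)"
    using g assms(3) by (intro has_bochner_integral_cong_AE) (auto simp: has_bochner_integral.simps elim!: eventually_mono)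
  with g(1) have "has_bochner_integral M (\<lambda>_. 0 :: 'c) (T x)" by simp
  then show ?thesis using has_bochner_integral_integral_eq by fastforce
qed

lemma bounded_linear_mat_of: "bounded_linear (\<lambda>X. mat_of X u v)"
  unfolding mat_of_def
  by (rule bounded_linear_compose[OF bounded_bilinear.bounded_linear_left[OF bounded_bilinear_cinner]
        blinfun.bounded_linear_left])

lemma bounded_linear_qf: "bounded_linear (\<lambda>X. qf X x)"
  using bounded_linear_compose[OF bounded_linear_Re bounded_linear_mat_of[of x x]]
  by (simp add: qf_def mat_of_def)

text \<open>An operator is determined by its matrix entries, and these are ordinary scalar
  integrals.\<close>

lemma strong_bochner_unique:
  fixes f :: "'a \<Rightarrow> ('h::chilbert_space \<Rightarrow>\<^sub>L 'h)"
  assumes "has_strong_bochner_integral M f X" "has_strong_bochner_integral M f Y"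
  shows "X = Y"
proof (rule blinfun_eqI, rule cinner_ext_left)
  fix u v
  obtain g where g: "has_bochner_integral M g (mat_of X u v)" "AE t in M. g t = mat_of (f t) u v"
    using strong_bochner_functional[OF bounded_linear_mat_of assms(1)] by blast
  obtain h where h: "has_bochner_integral M h (mat_of Y u v)" "AE t in M. h t = mat_of (f t) u v"
    using strong_bochner_functional[OF bounded_linear_mat_of assms(2)] by blast
  have "AE t in M. g t = h t" using g(2) h(2) by eventually_elim simp
  then have "integral\<^sup>L M g = integral\<^sup>L M h"
    using g(1) h(1) by (intro integral_cong_AE) (auto simp: has_bochner_integral.simps)
  then show "cinner (X u) v = cinner (Y u) v"
    using has_bochner_integral_integral_eq[OF g(1)] has_bochner_integral_integral_eq[OF h(1)]
    by (simp add: mat_of_def)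
qed

lemma bochner_integrable_has_integral:
  fixes f :: "'a \<Rightarrow> ('h::chilbert_space \<Rightarrow>\<^sub>L 'h)"
  assumes "bochner_integrable M f"
  shows "has_strong_bochner_integral M f (bochner_integral M f)"
proof -
  obtain X where X: "has_strong_bochner_integral M f X" using assms by (auto simp: bochner_integrable_def)
  then have "bochner_integral M f = X"
    unfolding bochner_integral_def using strong_bochner_unique by blast
  with X show ?thesis by simp
qed

text \<open>Complex linearity and symmetry say that certain bounded real-linear functionals of the
  operator vanish, and positivity that others are nonnegative; both kinds of condition pass through
  the integral.\<close>

lemma strong_bochner_op_pos:
  fixes f :: "'a \<Rightarrow> ('h::chilbert_space \<Rightarrow>\<^sub>L 'h)"
  assumes f: "has_strong_bochner_integral M f X" and pos: "\<And>t. op_pos (f t)"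
  shows "op_pos X"
proof (rule op_posI)
  show "X \<in> bounded_ops" unfolding bounded_ops_def mem_Collect_eq
  proof (intro allI cinner_ext_left)
    fix c u v
    have "mat_of X (c *\<^sub>C u) v - c * mat_of X u v = 0"
    proof (rule strong_bochner_functional_zero[OF _ f])
      show "bounded_linear (\<lambda>X. mat_of X (c *\<^sub>C u) v - c * mat_of X u v)"
        by (intro bounded_linear_sub bounded_linear_const_mult bounded_linear_mat_of)
      show "mat_of (f t) (c *\<^sub>C u) v - c * mat_of (f t) u v = 0" for t
        by (simp add: mat_of_def bounded_ops_scaleC[OF op_pos_bounded_ops[OF pos]] cinner_simps)
    qed
    then show "cinner (X (c *\<^sub>C u)) v = cinner (c *\<^sub>C X u) v"
      by (simp add: mat_of_def cinner_simps)
  qed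
  show "cinner (X u) v = cinner u (X v)" for u v
  proof -
    have "mat_of X u v - cnj (mat_of X v u) = 0"
    proof (rule strong_bochner_functional_zero[OF _ f])
      show "bounded_linear (\<lambda>X. mat_of X u v - cnj (mat_of X v u))"
        by (intro bounded_linear_sub bounded_linear_compose[OF bounded_linear_cnj] bounded_linear_mat_of)
      show "mat_of (f t) u v - cnj (mat_of (f t) v u) = 0" for t
        using mat_of_hermitian[OF pos[of t], of u v] by simp
    qed
    then show ?thesis using cinner_commute[of u "X v"] by (simp add: mat_of_def)
  qed
  show "0 \<le> qf X u" for u
    by (rule strong_bochner_functional_nonneg[OF bounded_linear_qf f]) (rule op_pos_qf[OF pos])
qed

section \<open>The Chebyshev inequality\<close>

text \<open>The Chebyshev trick without a product measure: the pointwise inequality is integrated over one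
  variable at a time, which is possible because every term is a finite sum of products.\<close>

lemma chebyshev_schur_integral:
  fixes \<kappa> \<eta> :: "'u \<Rightarrow> 'u \<Rightarrow> 't \<Rightarrow> complex" and \<rho> \<alpha> :: "'t \<Rightarrow> real"
  assumes \<kappa>: "\<And>u v. u \<in> F \<Longrightarrow> v \<in> F \<Longrightarrow> has_bochner_integral M (\<kappa> u v) (k u v)"
    and \<eta>: "\<And>u v. u \<in> F \<Longrightarrow> v \<in> F \<Longrightarrow> has_bochner_integral M (\<eta> u v) (l u v)"
    and \<rho>: "has_bochner_integral M \<rho> r" and \<alpha>: "has_bochner_integral M \<alpha> a"
    and good: "AE t in M. good t"
    and le: "\<And>s t. good s \<Longrightarrow> good t \<Longrightarrow>
      Re (\<Sum>u\<in>F. \<Sum>v\<in>F. c u v * (\<kappa> u v t * \<eta> u v s + \<kappa> u v s * \<eta> u v t)) \<le> \<alpha> s * \<rho> t + \<alpha> t * \<rho> s"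
  shows "Re (\<Sum>u\<in>F. \<Sum>v\<in>F. c u v * (k u v * l u v)) \<le> a * r"
proof -
  \<comment> \<open>The slack of the hypothesis at fixed \<open>t\<close>, already integrated over
    \<open>s\<close>.\<close>
  define G where "G t = a * \<rho> t + \<alpha> t * r
    - Re (\<Sum>u\<in>F. \<Sum>v\<in>F. c u v * (\<kappa> u v t * l u v + k u v * \<eta> u v t))" for t
  have "0 \<le> G t" if t: "good t" for t
  proof (rule has_bochner_integral_nonneg_AE)
    show "has_bochner_integral M (\<lambda>s. \<alpha> s * \<rho> t + \<alpha> t * \<rho> s
        - Re (\<Sum>u\<in>F. \<Sum>v\<in>F. c u v * (\<kappa> u v t * \<eta> u v s + \<kappa> u v s * \<eta> u v t))) (G t)"
      unfolding G_def
      by (intro has_bochner_integral_diff has_bochner_integral_add has_bochner_integral_sum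
          has_bochner_integral_bounded_linear[OF bounded_linear_Re]
          has_bochner_integral_mult_left has_bochner_integral_mult_right \<kappa> \<eta> \<rho> \<alpha>)
    show "AE s in M. 0 \<le> \<alpha> s * \<rho> t + \<alpha> t * \<rho> s
        - Re (\<Sum>u\<in>F. \<Sum>v\<in>F. c u v * (\<kappa> u v t * \<eta> u v s + \<kappa> u v s * \<eta> u v t))"
      using good by eventually_elim (use le[OF _ t] in simp)
  qed
  then have "AE t in M. 0 \<le> G t" using good by (auto elim!: eventually_mono)
  \<comment> \<open>Both mixed terms integrate to the same value, so the result is twice the
    claim.\<close>
  moreover have "has_bochner_integral M G (a * r + a * r
      - Re (\<Sum>u\<in>F. \<Sum>v\<in>F. c u v * (k u v * l u v + k u v * l u v)))"
    unfolding G_def[abs_def]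
    by (intro has_bochner_integral_diff has_bochner_integral_add has_bochner_integral_sum
        has_bochner_integral_bounded_linear[OF bounded_linear_Re]
        has_bochner_integral_mult_left has_bochner_integral_mult_right \<kappa> \<eta> \<rho> \<alpha>)
  ultimately have "0 \<le> a * r + a * r - Re (\<Sum>u\<in>F. \<Sum>v\<in>F. c u v * (k u v * l u v + k u v * l u v))"
    using has_bochner_integral_nonneg_AE by blast
  moreover have "(\<Sum>u\<in>F. \<Sum>v\<in>F. c u v * (k u v * l u v + k u v * l u v)) =
      (\<Sum>u\<in>F. \<Sum>v\<in>F. c u v * (k u v * l u v)) + (\<Sum>u\<in>F. \<Sum>v\<in>F. c u v * (k u v * l u v))"
    by (simp only: distrib_left sum.distrib)
  ultimately show ?thesis by (simp only: plus_complex.simps)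
qed

lemma schur_chebyshev_pointwise:
  assumes E: "orthonormal_basis E" and F: "finite F" "F \<subseteq> E"
    and pos: "op_pos K" "op_pos L" "op_pos K'" "op_pos L'"
    and le: "\<And>x. qf K x \<le> qf K' x" "\<And>x. qf L x \<le> qf L' x"
  shows "Re (qform F (\<lambda>u v. mat_of K u v * mat_of L' u v + mat_of K' u v * mat_of L u v) c) \<le>
    Re (qform F (\<lambda>u v. mat_of K u v * mat_of L u v) c) + Re (qform F (\<lambda>u v. mat_of K' u v * mat_of L' u v) c)"
proof -
  have "op_pos (K' - K)" "op_pos (L' - L)"
    using op_le_iff[OF pos(1,3)] op_le_iff[OF pos(2,4)] le by (auto simp: op_le_def)
  then have "0 \<le> Re (qform F (\<lambda>u v. mat_of (K' - K) u v * mat_of (L' - L) u v) c)"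
    by (rule schur_op_nonneg[OF E F])
  also have "(\<lambda>u v. mat_of (K' - K) u v * mat_of (L' - L) u v) =
      (\<lambda>u v. (mat_of K u v * mat_of L u v + mat_of K' u v * mat_of L' u v)
        - (mat_of K u v * mat_of L' u v + mat_of K' u v * mat_of L u v))"
    by (intro ext) (simp add: mat_of_diff algebra_simps)
  also have "Re (qform F \<dots> c) =
      Re (qform F (\<lambda>u v. mat_of K u v * mat_of L u v) c) + Re (qform F (\<lambda>u v. mat_of K' u v * mat_of L' u v) c)
      - Re (qform F (\<lambda>u v. mat_of K u v * mat_of L' u v + mat_of K' u v * mat_of L u v) c)"
    unfolding qform_diff qform_add[of F "\<lambda>u v. mat_of K u v * mat_of L u v"
      "\<lambda>u v. mat_of K' u v * mat_of L' u v"] by simp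
  finally show ?thesis by simp
qed

text \<open>The claim is symmetric in \<open>s\<close> and \<open>t\<close>, and the order on the
  index set is total, so one of the two points may be taken as the smaller. The diagonal terms are
  then raised to \<open>R\<close> by the pointwise inequality for Hadamard products.\<close>

lemma schur_mean_chebyshev_pointwise:
  fixes A B C D :: "'t::linorder \<Rightarrow> ('h::chilbert_space \<Rightarrow>\<^sub>L 'h)"
  assumes E: "orthonormal_basis E" and \<sigma>: "operator_mean \<sigma>" and f: "representing_function \<sigma> f"
    and sm: "super_multiplicative f" and F: "finite F" "F \<subseteq> E"
    and pos: "\<And>t. op_pos (A t)" "\<And>t. op_pos (B t)" "\<And>t. op_pos (C t)" "\<And>t. op_pos (D t)"
    and inc: "\<And>s t. s \<le> t \<Longrightarrow> A s \<le>\<^sub>o\<^sub>p A t" "\<And>s t. s \<le> t \<Longrightarrow> B s \<le>\<^sub>o\<^sub>p B t"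
      "\<And>s t. s \<le> t \<Longrightarrow> C s \<le>\<^sub>o\<^sub>p C t" "\<And>s t. s \<le> t \<Longrightarrow> D s \<le>\<^sub>o\<^sub>p D t"
  defines "K t \<equiv> mean_ext \<sigma> (A t) (C t)" and "L t \<equiv> mean_ext \<sigma> (B t) (D t)"
    and "R t \<equiv> mean_ext \<sigma> (hadamard E (A t) (B t)) (hadamard E (C t) (D t))"
  shows "Re (qform F (\<lambda>u v. mat_of (K t) u v * mat_of (L s) u v + mat_of (K s) u v * mat_of (L t) u v) c)
    \<le> qf (R t) (\<Sum>u\<in>F. c u *\<^sub>C u) + qf (R s) (\<Sum>u\<in>F. c u *\<^sub>C u)"
proof -
  let ?x = "\<Sum>u\<in>F. c u *\<^sub>C u"
  let ?q = "\<lambda>X Y. Re (qform F (\<lambda>u v. mat_of X u v * mat_of Y u v) c)"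
  have KL: "op_pos (K t)" "op_pos (L t)" for t
    unfolding K_def L_def by (intro mean_ext_pos[OF \<sigma>] pos)+
  have mono: "qf (K s) x \<le> qf (K t) x" "qf (L s) x \<le> qf (L t) x" if "s \<le> t" for s t x
    unfolding K_def L_def using that by (intro mean_ext_mono[OF \<sigma>] pos op_le_qf inc; simp)+
  have diag: "?q (K t) (L t) \<le> qf (R t) ?x" for t
    using hadamard_mean[OF E \<sigma> f sm pos(1,2,3,4), of t t t t ?x] qf_hadamard[OF E KL F(2), of t t c]
    by (simp add: K_def L_def R_def)
  have cheb: "Re (qform F (\<lambda>u v. mat_of (K s) u v * mat_of (L t) u v + mat_of (K t) u v * mat_of (L s) u v) c)
      \<le> ?q (K s) (L s) + ?q (K t) (L t)" if "s \<le> t" for s t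
    by (rule schur_chebyshev_pointwise[OF E F KL KL mono[OF that]])
  have "Re (qform F (\<lambda>u v. mat_of (K t) u v * mat_of (L s) u v + mat_of (K s) u v * mat_of (L t) u v) c)
      \<le> ?q (K t) (L t) + ?q (K s) (L s)"
    using cheb[of s t] cheb[of t s] linear[of s t] by (auto simp: add.commute)
  with diag[of t] diag[of s] show ?thesis by linarith
qed

theorem theorem3p1:
  fixes E :: "'h::chilbert_space set"
    and \<A> :: "('h \<Rightarrow>\<^sub>L 'h) set"
    and \<mu> :: "'t::{t2_space,linorder} measure"
    and A B C D :: "'t \<Rightarrow> ('h \<Rightarrow>\<^sub>L 'h)"
    and \<alpha> :: "'t \<Rightarrow> real"
    and \<sigma> :: "'h op_binary"
    and f :: "real \<Rightarrow> real"
  assumes "orthonormal_basis E"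
    and "cstar_subalgebra \<A>"
    and "compact (UNIV :: 't set)"
    and "radon_measure \<mu>"
    and "increasing_positive_field \<A> A"
    and "increasing_positive_field \<A> B"
    and "increasing_positive_field \<A> C"
    and "increasing_positive_field \<A> D"
    and "\<alpha> \<in> borel_measurable \<mu>"
    and "\<And>t. 0 \<le> \<alpha> t"
    and "operator_mean \<sigma>"
    and "representing_function \<sigma> f"
    and "super_multiplicative f"
    and "integrable \<mu> \<alpha>"
    and "bochner_integrable \<mu>
           (\<lambda>t. \<alpha> t *\<^sub>R mean_ext \<sigma> (hadamard E (A t) (B t)) (hadamard E (C t) (D t)))"
    and "bochner_integrable \<mu> (\<lambda>t. \<alpha> t *\<^sub>R mean_ext \<sigma> (A t) (C t))"
    and "bochner_integrable \<mu> (\<lambda>s. \<alpha> s *\<^sub>R mean_ext \<sigma> (B s) (D s))"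
  shows "hadamard E
           (bochner_integral \<mu> (\<lambda>t. \<alpha> t *\<^sub>R mean_ext \<sigma> (A t) (C t)))
           (bochner_integral \<mu> (\<lambda>s. \<alpha> s *\<^sub>R mean_ext \<sigma> (B s) (D s)))
         \<le>\<^sub>o\<^sub>p
         (LINT s|\<mu>. \<alpha> s) *\<^sub>R
           bochner_integral \<mu>
             (\<lambda>t. \<alpha> t *\<^sub>R mean_ext \<sigma> (hadamard E (A t) (B t)) (hadamard E (C t) (D t)))"
proof -
  note E = assms(1) and \<alpha>0 = assms(10) and \<sigma> = assms(11) and f = assms(12) and sm = assms(13)
  have pos: "op_pos (A t)" "op_pos (B t)" "op_pos (C t)" "op_pos (D t)" for t
    using assms(5-8) by (auto simp: increasing_positive_field_def)
  have inc: "A s \<le>\<^sub>o\<^sub>p A t" "B s \<le>\<^sub>o\<^sub>p B t" "C s \<le>\<^sub>o\<^sub>p C t" "D s \<le>\<^sub>o\<^sub>p D t" if "s \<le> t" for s t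
    using assms(5-8) that by (auto simp: increasing_positive_field_def)
  define K where "K t = mean_ext \<sigma> (A t) (C t)" for t
  define L where "L t = mean_ext \<sigma> (B t) (D t)" for t
  define R where "R t = mean_ext \<sigma> (hadamard E (A t) (B t)) (hadamard E (C t) (D t))" for t
  define IK where "IK = bochner_integral \<mu> (\<lambda>t. \<alpha> t *\<^sub>R K t)"
  define IL where "IL = bochner_integral \<mu> (\<lambda>t. \<alpha> t *\<^sub>R L t)"
  define IR where "IR = bochner_integral \<mu> (\<lambda>t. \<alpha> t *\<^sub>R R t)"
  define a where "a = (LINT s|\<mu>. \<alpha> s)"
  have IK: "has_strong_bochner_integral \<mu> (\<lambda>t. \<alpha> t *\<^sub>R K t) IK"
    and IL: "has_strong_bochner_integral \<mu> (\<lambda>t. \<alpha> t *\<^sub>R L t) IL"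
    and IR: "has_strong_bochner_integral \<mu> (\<lambda>t. \<alpha> t *\<^sub>R R t) IR"
    unfolding IK_def IL_def IR_def K_def L_def R_def
    by (intro bochner_integrable_has_integral assms)+
  have KLR: "op_pos (K t)" "op_pos (L t)" "op_pos (R t)" for t
    unfolding K_def L_def R_def by (intro mean_ext_pos[OF \<sigma>] pos hadamard_pos[OF E])+
  have posI: "op_pos IK" "op_pos IL" "op_pos IR"
    by (rule strong_bochner_op_pos[OF IK] strong_bochner_op_pos[OF IL] strong_bochner_op_pos[OF IR];
        intro op_pos_scaleR KLR \<alpha>0)+
  have a: "has_bochner_integral \<mu> \<alpha> a" unfolding a_def using assms(14) by (rule has_bochner_integral_integrable)
  have "0 \<le> a" unfolding a_def using \<alpha>0 by (intro integral_nonneg_AE) auto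
  have "qf (hadamard E IK IL) x \<le> qf (a *\<^sub>R IR) x" for x
  proof (rule qf_le_dense[OF E])
    fix F c assume F: "finite F" "F \<subseteq> E"
    define y where "y = (\<Sum>u\<in>F. c u *\<^sub>C u)"
    \<comment> \<open>A measurable and integrable representative of the matrix entry, equal to the
      entry itself only almost everywhere.\<close>
    define \<kappa> where "\<kappa> u v = (SOME g. has_bochner_integral \<mu> g (mat_of IK u v) \<and>
        (AE t in \<mu>. g t = mat_of (\<alpha> t *\<^sub>R K t) u v))" for u v
    have \<kappa>: "has_bochner_integral \<mu> (\<kappa> u v) (mat_of IK u v)"
      "AE t in \<mu>. \<kappa> u v t = mat_of (\<alpha> t *\<^sub>R K t) u v" for u v
      using someI_ex[OF strong_bochner_functional[OF bounded_linear_mat_of[of u v] IK]]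
      unfolding \<kappa>_def by auto
    define \<eta> where "\<eta> u v = (SOME g. has_bochner_integral \<mu> g (mat_of IL u v) \<and>
        (AE t in \<mu>. g t = mat_of (\<alpha> t *\<^sub>R L t) u v))" for u v
    have \<eta>: "has_bochner_integral \<mu> (\<eta> u v) (mat_of IL u v)"
      "AE t in \<mu>. \<eta> u v t = mat_of (\<alpha> t *\<^sub>R L t) u v" for u v
      using someI_ex[OF strong_bochner_functional[OF bounded_linear_mat_of[of u v] IL]]
      unfolding \<eta>_def by auto
    obtain \<rho> where \<rho>: "has_bochner_integral \<mu> \<rho> (qf IR y)" "AE t in \<mu>. \<rho> t = qf (\<alpha> t *\<^sub>R R t) y"
      using strong_bochner_functional[OF bounded_linear_qf IR] by blast
    \<comment> \<open>As \<open>F\<close> is finite, the exceptional null sets of all the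
      representatives can be united; \<open>F\<close> and \<open>c\<close> are fixed before the
      exceptional set is formed.\<close>
    define good where "good t \<longleftrightarrow> \<rho> t = qf (\<alpha> t *\<^sub>R R t) y \<and> (\<forall>u\<in>F. \<forall>v\<in>F.
      \<kappa> u v t = mat_of (\<alpha> t *\<^sub>R K t) u v \<and> \<eta> u v t = mat_of (\<alpha> t *\<^sub>R L t) u v)" for t
    have good: "AE t in \<mu>. good t"
      unfolding good_def by (intro AE_conjI AE_finite_allI F(1) \<kappa>(2) \<eta>(2) \<rho>(2))
    have "Re (\<Sum>u\<in>F. \<Sum>v\<in>F. c u * cnj (c v) * (mat_of IK u v * mat_of IL u v)) \<le> a * qf IR y"
    proof (rule chebyshev_schur_integral[OF \<kappa>(1) \<eta>(1) \<rho>(1) a good])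
      fix s t assume st: "good s" "good t"
      have "(\<Sum>u\<in>F. \<Sum>v\<in>F. c u * cnj (c v) * (\<kappa> u v t * \<eta> u v s + \<kappa> u v s * \<eta> u v t)) =
          of_real (\<alpha> s * \<alpha> t) *
          qform F (\<lambda>u v. mat_of (K t) u v * mat_of (L s) u v + mat_of (K s) u v * mat_of (L t) u v) c"
        unfolding qform_def sum_distrib_left using st
        by (intro sum.cong refl) (simp add: good_def mat_of_scaleR algebra_simps)
      then have "Re (\<Sum>u\<in>F. \<Sum>v\<in>F. c u * cnj (c v) * (\<kappa> u v t * \<eta> u v s + \<kappa> u v s * \<eta> u v t)) =
          \<alpha> s * \<alpha> t * Re (qform F (\<lambda>u v. mat_of (K t) u v * mat_of (L s) u v + mat_of (K s) u v * mat_of (L t) u v) c)"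
        by simp
      also have "\<dots> \<le> \<alpha> s * \<alpha> t * (qf (R t) y + qf (R s) y)"
        unfolding y_def K_def L_def R_def
        by (intro mult_left_mono schur_mean_chebyshev_pointwise[OF E \<sigma> f sm F pos inc] mult_nonneg_nonneg \<alpha>0)
      \<comment> \<open>At good points one weight is absorbed into \<open>\<rho>\<close> and the
        other stays, which gives the products that can be integrated one variable at a time.\<close>
      also have "\<dots> = \<alpha> s * \<rho> t + \<alpha> t * \<rho> s"
        using st by (simp add: good_def qf_scaleR algebra_simps)
      finally show "Re (\<Sum>u\<in>F. \<Sum>v\<in>F. c u * cnj (c v) * (\<kappa> u v t * \<eta> u v s + \<kappa> u v s * \<eta> u v t))
        \<le> \<alpha> s * \<rho> t + \<alpha> t * \<rho> s" .
    qed
    then show "qf (hadamard E IK IL) (\<Sum>u\<in>F. c u *\<^sub>C u) \<le> qf (a *\<^sub>R IR) (\<Sum>u\<in>F. c u *\<^sub>C u)"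
      unfolding qf_hadamard[OF E posI(1,2) F(2)] qform_def qf_scaleR y_def .
  qed
  then have "hadamard E IK IL \<le>\<^sub>o\<^sub>p a *\<^sub>R IR"
    using op_le_iff[OF hadamard_pos[OF E posI(1,2)] op_pos_scaleR[OF posI(3) \<open>0 \<le> a\<close>]] by simp
  then show ?thesis unfolding IK_def IL_def IR_def K_def L_def R_def a_def .
qed

end
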